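(* Let $\lambda > 0$ and $(c, \omega) \in \mathbb{R}^2$. Up to the invariance by translations and by phase shifts (of the map $\check{V}_{c,\omega}$), the unique non-trivial solutions $V_{c,\omega}$ to (TW$_{c,\omega}$) in the energy space $\mathcal{E}(\mathbb{R})$ are given by the following formulae. (i) For $\omega = c = 0$: for all $x \in \mathbb{R}$, $$\check{V}_{0,0}(x) = \frac{1}{\cosh(\lambda^{\frac12} x)}, \quad \text{and} \quad [V_{0,0}]_2(x) = \delta \tanh \big( \lambda^{\frac12} x \big),$$ with $\delta \in \{ \pm 1 \}$. (ii) For $0 < -\omega \delta < \lambda$ and $c^2 < 4 (\lambda + \omega \delta)$, or for $\omega \delta \geq 0$ and $0 < c^2 < 4 (\lambda + \omega \delta)$, where $\delta \in \{\pm 1\}$: for all $x \in \mathbb{R}$, $$\begin{aligned} \check{V}_{c,\omega}(x) = {} & \frac{(4 (\lambda + \delta \omega) - c^2)^{\frac12} \, e^{\frac{i c \delta x}{2}}}{2 \lambda + \delta \omega + (\lambda c^2 + \omega^2)^{\frac12} \cosh \big( (4 (\lambda + \delta \omega) - c^2)^{\frac12} x \big)} \\ & \times \bigg( \Big( 2 (\lambda c^2 + \omega^2)^{\frac12} + c^2 - 2 \delta \omega \Big)^{\frac12} \cosh \Big( \Big( (\lambda + \delta \omega) - \frac{c^2}{4} \Big)^{\frac12} x \Big) \\ & \quad + i \, \mathrm{sign}(c) \, \delta \Big( 2 (\lambda c^2 + \omega^2)^{\frac12} - c^2 + 2 \delta \omega \Big)^{\frac12} \sinh \Big( \Big( (\lambda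 + \delta \omega) - \frac{c^2}{4} \Big)^{\frac12} x \Big) \bigg), \end{aligned}$$ and $$[V_{c,\omega}]_2(x) = \delta \Bigg( 1 - \frac{4 (\lambda + \delta \omega) - c^2}{2 \lambda + \delta \omega + (\lambda c^2 + \omega^2)^{\frac12} \cosh \big( (4 (\lambda + \delta \omega) - c^2)^{\frac12} x \big)} \Bigg).$$ Moreover, when $c \neq 0$, the map $\check{V}_{c,\omega}$ can be lifted as $\check{V}_{c,\omega} = |\check{V}_{c,\omega}| e^{i \varphi_{c,\omega}}$, with $$\varphi_{c,\omega}(x) = \frac{c \delta x}{2} + \mathrm{sign}(c) \, \delta \arctan \bigg( \Big( \frac{2 (\lambda c^2 + \omega^2)^{\frac12} - c^2 + 2 \delta \omega}{2 (\lambda c^2 + \omega^2)^{\frac12} + c^2 - 2 \delta \omega} \Big)^{\frac12} \tanh \Big( \Big( (\lambda + \delta \omega) - \frac{c^2}{4} \Big)^{\frac12} x \Big) \bigg).$$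
   Context: The energy space is $$\mathcal{E}(\mathbb{R}) := \big\{ v = (v_1,v_2,v_3) \in L^1_{\rm loc}(\mathbb{R}, \mathbb{S}^2) : v' \in L^2(\mathbb{R}) \text{ and } (v_1, v_3) \in L^2(\mathbb{R})^2 \big\},$$ where $\mathbb{S}^2$ is the unit sphere of $\mathbb{R}^3$. For a map $v = (v_1, v_2, v_3)$, write $\check{v} := v_1 + i v_3$; likewise $\check{V}_{c,\omega} = [V_{c,\omega}]_1 + i [V_{c,\omega}]_3$. For $z_1, z_2 \in \mathbb{C}$, $\langle z_1, z_2 \rangle_{\mathbb{C}} := \mathrm{Re}(z_1 \bar z_2)$. (TW$_{c,\omega}$) is the ordinary differential system on $\mathbb{R}$ $$\begin{cases} - \check{v}'' + i c \big( v_2 \check{v}' - v_2' \check{v} \big) - \big( |\check{v}'|^2 + |v_2'|^2 + \lambda |\check{v}|^2 \big) \check{v} + \lambda \check{v} + \omega v_2 \check{v} = 0, \\ - v_2'' + c \langle i \check{v}, \check{v}' \rangle_{\mathbb{C}} - \big( |\check{v}'|^2 + |v_2'|^2 + \lambda |\check{v}|^2 \big) v_2 - \omega |\check{v}|^2 = 0. \end{cases}$$ It describes the profiles of solitons $\check m(x,t) = \check V_{c,\omega}(x - ct) e^{i \omega t}$, $m_2(x,t) = [V_{c,\omega}]_2(x - ct)$ with speed $c$ and angular velocity $\omega$ of the one-dimensional Landau-Lifshitz equation $\partial_t m + m \times (\partial_{xx} m - \lambda(m_1 e_1 + m_3 e_3)) = 0$. The system is invariant by translations $v \mapsto v(\cdot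 - a)$, $a\in\mathbb{R}$, and by phase shifts $\check{v} \mapsto e^{i\theta} \check{v}$, $\theta\in\mathbb{R}$ (with $v_2$ unchanged). The only constant solutions in $\mathcal{E}(\mathbb{R})$ are the trivial solutions $(0,1,0)$ and $(0,-1,0)$; "non-trivial" means different from these. When $c = 0$ in case (ii), the coefficient of the $\sinh$ term vanishes, so the value of $\mathrm{sign}(0)$ is irrelevant.
   Formalization: For c = 0 and ω ≠ 0 the printed list omits a solution; the formal theorem adds, for c = 0 and ωδ > 0, the explicit profile through (0,−δ,0), the c→0 limit of (ii), with V̌ a sinh-type real function up to phase. All other cases are as printed. *)

theory Defs
  imports "HOL-Analysis.Analysis"
begin

section \<open>Weak derivatives and the energy space\<close>

text \<open>Functions are taken up to equality almost everywhere; since Lebesgue measure is complete,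
  every property defined here is invariant under modification on a null set.\<close>

definition locally_integrable :: "(real \<Rightarrow> 'a::euclidean_space) \<Rightarrow> bool" where
  "locally_integrable f \<longleftrightarrow> (\<forall>a b. f absolutely_integrable_on {a..b})"

definition square_integrable :: "(real \<Rightarrow> 'a::euclidean_space) \<Rightarrow> bool" where
  "square_integrable f \<longleftrightarrow>
     f \<in> borel_measurable lebesgue \<and> integrable lebesgue (\<lambda>x. (norm (f x))\<^sup>2)"

definition test_function :: "(real \<Rightarrow> real) \<Rightarrow> bool" where
  "test_function \<phi> \<longleftrightarrow>
     (\<forall>n x. (deriv ^^ n) \<phi> differentiable (at x)) \<and> compact (closure {x. \<phi> x \<noteq> 0})"

definition has_weak_deriv ::
  "(real \<Rightarrow> 'a::euclidean_space) \<Rightarrow> (real \<Rightarrow> 'a) \<Rightarrow> bool" where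
  "has_weak_deriv f g \<longleftrightarrow> locally_integrable f \<and> locally_integrable g \<and>
     (\<forall>\<phi>. test_function \<phi> \<longrightarrow>
        (LINT x|lebesgue. deriv \<phi> x *\<^sub>R f x) = - (LINT x|lebesgue. \<phi> x *\<^sub>R g x))"

definition energy_space :: "(real \<Rightarrow> real^3) set" where
  "energy_space = {v. locally_integrable v \<and> (AE x in lebesgue. v x \<in> sphere 0 1) \<and>
     (\<exists>w. has_weak_deriv v w \<and> square_integrable w) \<and>
     square_integrable (\<lambda>x. v x $ 1) \<and> square_integrable (\<lambda>x. v x $ 3)}"

section \<open>The travelling wave system\<close>

definition vcheck :: "real^3 \<Rightarrow> complex" where
  "vcheck u = Complex (u $ 1) (u $ 3)"

definition inner_C :: "complex \<Rightarrow> complex \<Rightarrow> real" where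
  "inner_C z1 z2 = Re (z1 * cnj z2)"

text \<open>The system is understood in the sense of distributions: it is tested against \<open>\<phi>\<close>, and the
  second-order term \<open>- v''\<close> becomes \<open>+ v' \<phi>'\<close>. Below \<open>w = v'\<close>, which is unique up to null sets.
  For \<open>v\<close> in the energy space \<open>v\<close> is bounded and \<open>w\<close> is square integrable, so that all integrands
  are integrable.\<close>

definition TW_solution :: "real \<Rightarrow> real \<Rightarrow> real \<Rightarrow> (real \<Rightarrow> real^3) \<Rightarrow> bool" where
  "TW_solution lam c \<omega> v \<longleftrightarrow> (\<exists>w. has_weak_deriv v w \<and>
     (\<forall>\<phi>. test_function \<phi> \<longrightarrow>
        (LINT x|lebesgue. (deriv \<phi> x *\<^sub>R vcheck (w x) + \<phi> x *\<^sub>R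
           (\<i> * of_real c * (of_real (v x $ 2) * vcheck (w x) - of_real (w x $ 2) * vcheck (v x))
            - of_real ((cmod (vcheck (w x)))\<^sup>2 + \<bar>w x $ 2\<bar>\<^sup>2 + lam * (cmod (vcheck (v x)))\<^sup>2)
                * vcheck (v x)
            + of_real lam * vcheck (v x) + of_real \<omega> * of_real (v x $ 2) * vcheck (v x)))) = 0 \<and>
        (LINT x|lebesgue. (deriv \<phi> x * (w x $ 2) + \<phi> x *
           (c * inner_C (\<i> * vcheck (v x)) (vcheck (w x))
            - ((cmod (vcheck (w x)))\<^sup>2 + \<bar>w x $ 2\<bar>\<^sup>2 + lam * (cmod (vcheck (v x)))\<^sup>2) * (v x $ 2)
            - \<omega> * (cmod (vcheck (v x)))\<^sup>2))) = 0))"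

definition nontrivial :: "(real \<Rightarrow> real^3) \<Rightarrow> bool" where
  "nontrivial v \<longleftrightarrow>
     \<not> (AE x in lebesgue. v x = vector [0, 1, 0]) \<and> \<not> (AE x in lebesgue. v x = vector [0, -1, 0])"

text \<open>Equality of \<open>v\<close>, up to a translation and a phase shift, with the map \<open>V\<close> such that
  \<open>vcheck \<circ> V = Z\<close> and whose second component is \<open>V2\<close>.\<close>

definition same_up_to_invariance ::
  "(real \<Rightarrow> real^3) \<Rightarrow> (real \<Rightarrow> complex) \<Rightarrow> (real \<Rightarrow> real) \<Rightarrow> bool" where
  "same_up_to_invariance v Z V2 \<longleftrightarrow> (\<exists>a \<theta>. AE x in lebesgue.
     vcheck (v x) = exp (\<i> * of_real \<theta>) * Z (x - a) \<and> v x $ 2 = V2 (x - a))"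

section \<open>Explicit profiles\<close>

definition static_check :: "real \<Rightarrow> real \<Rightarrow> complex" where
  "static_check lam x = of_real (1 / cosh (sqrt lam * x))"

definition static_2 :: "real \<Rightarrow> real \<Rightarrow> real \<Rightarrow> real" where
  "static_2 lam \<delta> x = \<delta> * tanh (sqrt lam * x)"

definition soliton_range :: "real \<Rightarrow> real \<Rightarrow> real \<Rightarrow> real \<Rightarrow> bool" where
  "soliton_range lam c \<omega> \<delta> \<longleftrightarrow>
     (0 < - \<omega> * \<delta> \<and> - \<omega> * \<delta> < lam \<and> c\<^sup>2 < 4 * (lam + \<omega> * \<delta>)) \<or>
     (0 \<le> \<omega> * \<delta> \<and> 0 < c\<^sup>2 \<and> c\<^sup>2 < 4 * (lam + \<omega> * \<delta>))"

definition soliton_check :: "real \<Rightarrow> real \<Rightarrow> real \<Rightarrow> real \<Rightarrow> real \<Rightarrow> complex" where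
  "soliton_check lam c \<omega> \<delta> x =
     of_real (sqrt (4 * (lam + \<delta> * \<omega>) - c\<^sup>2)) * exp (\<i> * of_real (c * \<delta> * x / 2))
     / of_real (2 * lam + \<delta> * \<omega>
         + sqrt (lam * c\<^sup>2 + \<omega>\<^sup>2) * cosh (sqrt (4 * (lam + \<delta> * \<omega>) - c\<^sup>2) * x))
     * (of_real (sqrt (2 * sqrt (lam * c\<^sup>2 + \<omega>\<^sup>2) + c\<^sup>2 - 2 * \<delta> * \<omega>)
          * cosh (sqrt ((lam + \<delta> * \<omega>) - c\<^sup>2 / 4) * x))
        + \<i> * of_real (sgn c * \<delta> * sqrt (2 * sqrt (lam * c\<^sup>2 + \<omega>\<^sup>2) - c\<^sup>2 + 2 * \<delta> * \<omega>)
          * sinh (sqrt ((lam + \<delta> * \<omega>) - c\<^sup>2 / 4) * x)))"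

definition soliton_2 :: "real \<Rightarrow> real \<Rightarrow> real \<Rightarrow> real \<Rightarrow> real \<Rightarrow> real" where
  "soliton_2 lam c \<omega> \<delta> x =
     \<delta> * (1 - (4 * (lam + \<delta> * \<omega>) - c\<^sup>2)
       / (2 * lam + \<delta> * \<omega>
          + sqrt (lam * c\<^sup>2 + \<omega>\<^sup>2) * cosh (sqrt (4 * (lam + \<delta> * \<omega>) - c\<^sup>2) * x)))"

definition soliton_phase :: "real \<Rightarrow> real \<Rightarrow> real \<Rightarrow> real \<Rightarrow> real \<Rightarrow> real" where
  "soliton_phase lam c \<omega> \<delta> x =
     c * \<delta> * x / 2 + sgn c * \<delta> *
       arctan (sqrt ((2 * sqrt (lam * c\<^sup>2 + \<omega>\<^sup>2) - c\<^sup>2 + 2 * \<delta> * \<omega>)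
                   / (2 * sqrt (lam * c\<^sup>2 + \<omega>\<^sup>2) + c\<^sup>2 - 2 * \<delta> * \<omega>))
               * tanh (sqrt ((lam + \<delta> * \<omega>) - c\<^sup>2 / 4) * x))"

text \<open>For \<open>c = 0\<close> and \<open>\<omega> \<delta> > 0\<close>, which \<open>soliton_range\<close> excludes, the limit as \<open>c \<rightarrow> 0\<close> of the
  soliton exists, is not trivial, and still solves the system: with \<open>v = (sin \<theta>, \<delta> cos \<theta>, 0)\<close> the
  latter reads \<open>\<theta>'' = lam sin \<theta> cos \<theta> + \<omega> \<delta> sin \<theta>\<close>, and \<open>\<theta>\<close> increases from \<open>0\<close> to \<open>2 \<pi>\<close> with
  \<open>\<theta>'\<^sup>2 = lam sin\<^sup>2 \<theta> + 2 \<omega> \<delta> (1 - cos \<theta>)\<close>. The profile passes through the pole \<open>(0, - \<delta>, 0)\<close>. It is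
  \<open>soliton_check\<close>, \<open>soliton_2\<close> at \<open>c = 0\<close> with \<open>sgn c\<close> replaced by \<open>\<plusminus> 1\<close>, up to a phase. A
  classification of all solutions has to include it.\<close>

definition wall_check :: "real \<Rightarrow> real \<Rightarrow> real \<Rightarrow> real \<Rightarrow> complex" where
  "wall_check lam \<omega> \<delta> x =
     of_real (4 * sqrt ((lam + \<delta> * \<omega>) * (\<delta> * \<omega>)) * sinh (sqrt (lam + \<delta> * \<omega>) * x)
       / (2 * lam + \<delta> * \<omega> + \<delta> * \<omega> * cosh (2 * sqrt (lam + \<delta> * \<omega>) * x)))"

definition wall_2 :: "real \<Rightarrow> real \<Rightarrow> real \<Rightarrow> real \<Rightarrow> real" where
  "wall_2 lam \<omega> \<delta> x =
     \<delta> * (1 - 4 * (lam + \<delta> * \<omega>)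
       / (2 * lam + \<delta> * \<omega> + \<delta> * \<omega> * cosh (2 * sqrt (lam + \<delta> * \<omega>) * x)))"

end

(* The equation is translated into the language of curves (x, m, y) = (v1, v2, v3) on the sphere. Weak solutions
   are classical, by the lemma of du Bois-Reymond applied first to v and then to v'. Along a sequence tending
   to infinity on which v' and (x, y) tend to 0, m tends to some delta = +1 or -1; this fixes the constants in
   the two first integrals
     |v'|^2 = lam (1 - m^2) + 2 omega (delta - m)   and   x y' - y x' = c (delta - m).
   They yield u'^2 = u^2 (k^2 - 2 alpha u + lam u^2) for u = 1 - delta m, with k^2 = 4 (lam + delta omega) - c^2 and
   alpha = 2 lam + delta omega. Hence u is identically 0 or nowhere 0, and in the latter case w = 1 / u solves
   the linear equation w'' = k^2 w - alpha; it is positive and unbounded at infinity, which leaves only the stated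
   formulas for m. Given m, the pair (x, y) solves a linear system and is unique up to a rotation. *)

theory Submission
  imports Defs
begin

section \<open>Smooth test functions\<close>

text \<open>A solution may pass through a pole, where polar coordinates for (x, y) break down and
  the phase has no lift; the argument therefore stays with Cartesian components and the invariants
  x^2 + y^2 and x y' - y x'. The relation for u'^2 alone would not determine u, since constant
  pieces can be glued in at its turning points. The second-order equation for u, taken from the
  m-component of the system, removes this ambiguity, and the relation for u'^2 is left to fix the
  product of the two exponential modes of w. Conversely, the formulas must be shown to solve the
  system. Away from the poles it is enough to check the equation for u and the values of x^2 + y^2
  and x y' - y x', because these determine (x', y') linearly; the complex profile is then
  differentiated only once. For c = 0 and \<omega> \<delta> > 0 the profile reaches u = 2, this
  reduction divides by zero, and the system is verified by direct differentiation. Finite energy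
  needs no estimate on derivatives: by the first integrals the integrand is a function of m
  alone.\<close>

primrec times_differentiable :: "nat \<Rightarrow> (real \<Rightarrow> real) \<Rightarrow> bool" where
  "times_differentiable 0 f = True"
| "times_differentiable (Suc n) f =
     (\<exists>f'. (\<forall>x. (f has_real_derivative f' x) (at x)) \<and> times_differentiable n f')"

lemma times_differentiable_Suc_imp:
  "times_differentiable (Suc n) f \<Longrightarrow> times_differentiable n f"
  proof (induction n arbitrary: f)
  case (Suc n)
  then obtain f' where "\<forall>x. (f has_real_derivative f' x) (at x)" "times_differentiable (Suc n) f'"
    unfolding times_differentiable.simps(2)[of "Suc n"] by blast
  with Suc.IH show ?case
    by auto
qed simp

text \<open>\<open>test_function\<close> iterates \<open>deriv\<close>, whose value is arbitrary
  where no derivative exists. Closure under sums, products and affine substitution is therefore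
  proved for a predicate that carries derivatives as witnesses, and translated here. The extra order
  accounts for differentiability of the n-th derivative itself.\<close>

lemma times_differentiable_funpow_deriv:
  "times_differentiable (Suc n) f \<Longrightarrow> (deriv ^^ n) f differentiable (at x)"
proof (induction n arbitrary: f)
  case 0
  then show ?case
    by (auto simp: real_differentiable_def)
next
  case (Suc n)
  then obtain f' where f': "\<And>x. (f has_real_derivative f' x) (at x)" "times_differentiable (Suc n) f'"
    unfolding times_differentiable.simps(2)[of "Suc n"] by blast
  then have "deriv f = f'"
    by (auto intro!: ext DERIV_imp_deriv)
  then show ?case
    using Suc.IH[OF f'(2)] by (simp add: funpow_Suc_right del: funpow.simps)
qed

lemma times_differentiable_const: "times_differentiable n (\<lambda>_. c)"
  by (induction n arbitrary: c) (auto intro!: exI[of _ "\<lambda>_. 0::real"] derivative_eq_intros)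

lemma times_differentiable_add:
  "times_differentiable n f \<Longrightarrow> times_differentiable n g \<Longrightarrow>
    times_differentiable n (\<lambda>x. f x + g x)"
proof (induction n arbitrary: f g)
  case (Suc n)
  then obtain f' g' where "\<And>x. (f has_real_derivative f' x) (at x)" "times_differentiable n f'"
    "\<And>x. (g has_real_derivative g' x) (at x)" "times_differentiable n g'" by auto
  then show ?case
    using Suc.IH[of f' g'] by (auto intro!: exI[of _ "\<lambda>x. f' x + g' x"] derivative_eq_intros)
qed auto

lemma times_differentiable_mult:
  "times_differentiable n f \<Longrightarrow> times_differentiable n g \<Longrightarrow>
    times_differentiable n (\<lambda>x. f x * g x)"
proof (induction n arbitrary: f g)
  case (Suc n)
  then obtain f' g' where *: "\<And>x. (f has_real_derivative f' x) (at x)" "times_differentiable n f'"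
    "\<And>x. (g has_real_derivative g' x) (at x)" "times_differentiable n g'" by auto
  have "times_differentiable n f" "times_differentiable n g"
    using Suc.prems by (auto dest: times_differentiable_Suc_imp simp del: times_differentiable.simps)
  then have "times_differentiable n (\<lambda>x. f' x * g x + f x * g' x)"
    using Suc.IH * by (intro times_differentiable_add) auto
  moreover have "((\<lambda>x. f x * g x) has_real_derivative f' x * g x + f x * g' x) (at x)" for x
    using * by (auto intro!: derivative_eq_intros)
  ultimately show ?case by (auto intro!: exI[of _ "\<lambda>x. f' x * g x + f x * g' x"])
qed auto

lemma times_differentiable_affine:
  "times_differentiable n f \<Longrightarrow> times_differentiable n (\<lambda>x. f (a * x + b))"
proof (induction n arbitrary: f)
  case (Suc n)
  then obtain f' where *: "\<And>x. (f has_real_derivative f' x) (at x)" "times_differentiable n f'"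
    by auto
  then have "times_differentiable n (\<lambda>x. f' (a * x + b) * a)"
    using Suc.IH by (intro times_differentiable_mult times_differentiable_const) auto
  moreover have "((\<lambda>x. f (a * x + b)) has_real_derivative f' (a * x + b) * a) (at x)" for x
    by (rule DERIV_chain2[OF *(1)]) (auto intro!: derivative_eq_intros)
  ultimately show ?case by (auto intro!: exI[of _ "\<lambda>x. f' (a * x + b) * a"])
qed auto

text \<open>The polynomial factor makes the class closed under differentiation: with y = 1 / x,
  differentiating p(y) exp(-y) replaces p by y^2 (p - p'). Smoothness of all members is then a
  single induction.\<close>

definition flat :: "real poly \<Rightarrow> real \<Rightarrow> real" where
  "flat p x = (if x \<le> 0 then 0 else poly p (1 / x) * exp (- (1 / x)))"

lemma poly_times_exp_neg_tendsto_0: "((\<lambda>y. poly p y * exp (- y)) \<longlongrightarrow> (0::real)) at_top"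
proof -
  have "((\<lambda>y. \<Sum>i\<le>degree p. coeff p i * (y ^ i / exp y)) \<longlongrightarrow> (\<Sum>i\<le>degree p. coeff p i * 0)) at_top"
    by (intro tendsto_intros tendsto_power_div_exp_0)
  then show ?thesis
    by (simp add: poly_altdef exp_minus sum_distrib_right divide_inverse mult.assoc)
qed

lemma flat_has_derivative:
  "(flat p has_real_derivative flat ([:0, 0, 1:] * (p - pderiv p)) x) (at x)"
proof -
  consider "x < 0" | "x = 0" | "x > 0" by linarith
  then show ?thesis
  proof cases
    case 1
    have "((\<lambda>_. 0) has_real_derivative flat ([:0, 0, 1:] * (p - pderiv p)) x) (at x)"
      using 1 by (auto simp: flat_def)
    then show ?thesis
      by (rule has_field_derivative_transform_within_open[where S = "{..<0}"])
         (use 1 in \<open>auto simp: flat_def\<close>)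
  next
    case 3
    have "((\<lambda>x. poly p (1 / x) * exp (- (1 / x))) has_real_derivative
       flat ([:0, 0, 1:] * (p - pderiv p)) x) (at x)"
      using 3 by (auto intro!: derivative_eq_intros DERIV_chain2[OF poly_DERIV]
          simp: flat_def field_simps power2_eq_square)
    then show ?thesis
      by (rule has_field_derivative_transform_within_open[where S = "{0<..}"])
         (use 3 in \<open>auto simp: flat_def\<close>)
  next
    case 2
    \<comment> \<open>With y = 1 / x, the difference quotient of \<open>flat p\<close> at 0 from the
      right is y p(y) exp(-y), and \<open>pCons 0 p\<close> is the polynomial y p(y).\<close>
    have "((\<lambda>x. poly (pCons 0 p) (inverse x) * exp (- inverse x)) \<longlongrightarrow> 0) (at_right (0::real))"
      by (rule filterlim_compose[OF poly_times_exp_neg_tendsto_0 filterlim_inverse_at_top_right])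
    then have r: "((\<lambda>y. (flat p y - flat p 0) / (y - 0)) \<longlongrightarrow> 0) (at_right 0)"
      by (rule Lim_transform_eventually)
         (auto simp: flat_def eventually_at_filter field_simps)
    have l: "((\<lambda>y. (flat p y - flat p 0) / (y - 0)) \<longlongrightarrow> 0) (at_left 0)"
      by (rule Lim_transform_eventually[OF tendsto_const[of 0]])
         (auto simp: flat_def eventually_at_filter)
    show ?thesis
      using filterlim_split_at[OF l r] 2 by (simp add: has_field_derivative_iff flat_def)
  qed
qed

lemma flat_times_differentiable: "times_differentiable n (flat p)"
  by (induction n arbitrary: p) (auto intro: flat_has_derivative)

lemma continuous_imp_antiderivative:
  fixes f :: "real \<Rightarrow> real"
  assumes "\<And>x. isCont f x"
  obtains F where "\<And>x. (F has_real_derivative f x) (at x)"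
  using einterval_antiderivative[of "-\<infinity>" "\<infinity>" f] assms
  by (auto simp: has_real_derivative_iff_has_vector_derivative)

text \<open>Integrating a bump supported in [0, 1] gives, after normalization, a smooth step H, and
  integrating again gives K, a smooth substitute for max 0. As n grows, K(n t) / n tends to max 0 t
  and H(n t) to the indicator of t > 0, so piecewise linear functions become limits of smooth ones
  without any convolution.\<close>

lemma smooth_ramp_exists:
  obtains K H :: "real \<Rightarrow> real"
  where "\<And>n. times_differentiable n K" "\<And>x. (K has_real_derivative H x) (at x)"
    "\<And>x. x \<le> 0 \<Longrightarrow> K x = 0" "\<And>x. x \<le> 0 \<Longrightarrow> H x = 0" "\<And>x. 1 \<le> x \<Longrightarrow> H x = 1"
    "\<And>x. 0 \<le> H x" "\<And>x. H x \<le> 1"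
proof -
  define b where "b x = flat 1 x * flat 1 (-1 * x + 1)" for x
  have b_smooth: "times_differentiable n b" for n
    unfolding b_def
    by (intro times_differentiable_mult times_differentiable_affine flat_times_differentiable)
  from this[of 1] have "isCont b x" for x
    by (auto dest: DERIV_isCont)
  then obtain B where B: "\<And>x. (B has_real_derivative b x) (at x)"
    using continuous_imp_antiderivative by blast
  have b_nonneg: "b x \<ge> 0" for x
    by (simp add: b_def flat_def)
  have mono: "B x \<le> B y" if "x \<le> y" for x y
    using DERIV_nonneg_imp_nondecreasing[OF that, of B] B b_nonneg by blast
  have const: "B x = B y" if "x \<le> y" "\<And>t. x \<le> t \<Longrightarrow> t \<le> y \<Longrightarrow> b t = 0" for x y
  proof -
    have "B y \<le> B x"
      by (rule DERIV_nonpos_imp_nonincreasing[OF that(1)]) (metis B that(2) order_refl)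
    then show ?thesis using mono[OF that(1)] by simp
  qed
  have "B 0 < B 1"
  proof (rule DERIV_pos_imp_increasing_open[where f = B])
    fix x :: real assume "0 < x" "x < 1"
    then show "\<exists>y. (B has_real_derivative y) (at x) \<and> y > 0"
      using B[of x] by (intro exI[of _ "b x"]) (auto simp: b_def flat_def)
  next
    show "continuous_on {0..1} B"
      using B by (auto intro!: continuous_at_imp_continuous_on DERIV_isCont)
  qed simp
  define d where "d = B 1 - B 0"
  have d: "d > 0" using \<open>B 0 < B 1\<close> by (simp add: d_def)
  define H where "H x = (B x - B 0) / d" for x
  have B_smooth: "times_differentiable n B" for n
    by (cases n) (use B b_smooth in auto)
  have "times_differentiable n (\<lambda>x. (1 / d) * B x + (- B 0 / d))" for n
    by (intro times_differentiable_add times_differentiable_mult times_differentiable_const B_smooth)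
  moreover have "H = (\<lambda>x. (1 / d) * B x + (- B 0 / d))"
    by (auto simp: H_def diff_divide_distrib)
  ultimately have H_smooth: "times_differentiable n H" for n by simp
  from this[of 1] have "isCont H x" for x
    by (auto dest: DERIV_isCont)
  then obtain K0 where K0: "\<And>x. (K0 has_real_derivative H x) (at x)"
    using continuous_imp_antiderivative by blast
  define K where "K x = K0 x + (- K0 0)" for x
  have K: "(K has_real_derivative H x) (at x)" for x
    unfolding K_def using K0 by (auto intro!: derivative_eq_intros)
  have H0: "H x = 0" if "x \<le> 0" for x
    using const[OF that] by (auto simp: H_def b_def flat_def)
  have H1: "H x = 1" if "1 \<le> x" for x
    using const[OF that] d by (auto simp: H_def b_def flat_def d_def)
  show thesis
  proof (rule that[of K H])
    show "times_differentiable n K" for n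
      by (cases n) (use K H_smooth in auto)
    show "K x = 0" if "x \<le> 0" for x
    proof -
      have "K x = K 0"
        using MVT2[of x 0 K H] K H0 that by (cases "x = 0") fastforce+
      then show ?thesis by (simp add: K_def)
    qed
    show "0 \<le> H x" for x
      using mono[of 0 x] H0[of x] d by (cases "x \<le> 0") (auto simp: H_def)
    show "H x \<le> 1" for x
      using mono[of x 1] H1[of x] d by (cases "x \<ge> 1") (auto simp: H_def d_def)
  qed (use K H0 H1 in auto)
qed

section \<open>Weakly differentiable functions\<close>

lemma locally_integrable_indicator:
  "locally_integrable f \<Longrightarrow> integrable lebesgue (\<lambda>x. indicator {a..b} x *\<^sub>R f x)"
  by (simp add: locally_integrable_def set_integrable_def)

text \<open>Dominated convergence with majorant C |f| on {a..b}. A common bound and a common bounded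
  support are all that is asked of the \<phi> n, so weak identities pass to limits that are not test
  functions.\<close>

lemma LINT_locally_integrable_tendsto:
  fixes f :: "real \<Rightarrow> 'a::euclidean_space" and \<phi> :: "nat \<Rightarrow> real \<Rightarrow> real"
  assumes f: "locally_integrable f"
    and meas: "\<And>n. \<phi> n \<in> borel_measurable lebesgue"
    and bound: "\<And>n x. \<bar>\<phi> n x\<bar> \<le> C"
    and supp: "\<And>n x. x \<notin> {a..b} \<Longrightarrow> \<phi> n x = 0"
    and lim: "\<And>x. (\<lambda>n. \<phi> n x) \<longlonglongrightarrow> \<psi> x"
  shows "(\<lambda>n. LINT x|lebesgue. \<phi> n x *\<^sub>R f x) \<longlonglongrightarrow> (LINT x|lebesgue. \<psi> x *\<^sub>R f x)"
proof -
  let ?f = "\<lambda>x. indicator {a..b} x *\<^sub>R f x"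
  have int: "integrable lebesgue ?f"
    using f by (rule locally_integrable_indicator)
  note [measurable] = borel_measurable_integrable[OF int] meas
  have eq: "\<phi> n x *\<^sub>R f x = \<phi> n x *\<^sub>R ?f x" for n x
    using supp[of x n] by (auto simp: indicator_def)
  have \<psi>0: "\<psi> x = 0" if "x \<notin> {a..b}" for x
    using lim[of x] supp[OF that] by (simp add: LIMSEQ_const_iff)
  have eq': "\<psi> x *\<^sub>R f x = \<psi> x *\<^sub>R ?f x" for x
    using \<psi>0[of x] by (auto simp: indicator_def)
  have [measurable]: "\<psi> \<in> borel_measurable lebesgue"
    by (rule borel_measurable_LIMSEQ_metric[of \<phi>]) (use meas lim in auto)
  have "(\<lambda>n. LINT x|lebesgue. \<phi> n x *\<^sub>R ?f x) \<longlonglongrightarrow> (LINT x|lebesgue. \<psi> x *\<^sub>R ?f x)"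
  proof (rule integral_dominated_convergence)
    show "integrable lebesgue (\<lambda>x. C * norm (?f x))"
      using int by (intro integrable_mult_right integrable_norm)
    show "AE x in lebesgue. norm (\<phi> n x *\<^sub>R ?f x) \<le> C * norm (?f x)" for n
      using bound by (auto intro!: mult_right_mono simp del: scaleR_scaleR)
    show "AE x in lebesgue. (\<lambda>n. \<phi> n x *\<^sub>R ?f x) \<longlonglongrightarrow> \<psi> x *\<^sub>R ?f x"
      using lim by (auto intro!: tendsto_intros simp del: scaleR_scaleR)
  qed measurable
  then show ?thesis unfolding eq eq' .
qed

lemma LINT_indicator_Ioc:
  fixes f :: "real \<Rightarrow> 'a::euclidean_space"
  assumes "locally_integrable f"
  shows "integrable lebesgue (\<lambda>x. indicator {a<..b} x *\<^sub>R f x)"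
    "(LINT x|lebesgue. indicator {a<..b} x *\<^sub>R f x) = integral {a..b} f"
proof -
  have ae: "AE x in lebesgue. indicator {a..b} x *\<^sub>R f x = indicator {a<..b} x *\<^sub>R f x"
    unfolding eventually_ae_filter_negligible
    by (rule exI[of _ "{a}"]) (auto simp: indicator_def)
  have int: "integrable lebesgue (\<lambda>x. indicator {a..b} x *\<^sub>R f x)"
    using assms by (rule locally_integrable_indicator)
  have meas: "(\<lambda>x. indicator {a<..b} x *\<^sub>R f x) \<in> borel_measurable lebesgue"
    using borel_measurable_AE[OF _ ae] int by auto
  show "integrable lebesgue (\<lambda>x. indicator {a<..b} x *\<^sub>R f x)"
    using integrable_cong_AE_imp[OF int meas] ae by auto
  have "(LINT x|lebesgue. indicator {a<..b} x *\<^sub>R f x) = (LINT x|lebesgue. indicator {a..b} x *\<^sub>R f x)"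
    by (rule integral_cong_AE) (use meas int ae in auto)
  also have "\<dots> = integral {a..b} f"
    using set_lebesgue_integral_eq_integral(2)[of "{a..b}" f] assms
    by (simp add: locally_integrable_def set_lebesgue_integral_def)
  finally show "(LINT x|lebesgue. indicator {a<..b} x *\<^sub>R f x) = integral {a..b} f" .
qed

lemma locally_integrable_imp_integrable_on: "locally_integrable f \<Longrightarrow> f integrable_on {a..b}"
  unfolding locally_integrable_def using absolutely_integrable_on_def by blast

lemma test_functionI:
  assumes "\<And>n. times_differentiable n \<phi>" "\<And>x. x \<notin> {a..b} \<Longrightarrow> \<phi> x = 0"
  shows "test_function \<phi>"
proof -
  have "bounded {x. \<phi> x \<noteq> 0}"
    by (rule bounded_subset[of "{a..b}"]) (simp, use assms(2) in blast)
  then show ?thesis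
    using times_differentiable_funpow_deriv[OF assms(1)] by (auto simp: test_function_def)
qed

text \<open>For a \<le> b and h > 0, this is the primitive, zero to the left of a, of the indicator
  of {a<..a + h} minus that of {b<..b + h}; for h \<le> b - a its graph is a trapezoid of height
  h.\<close>

definition tent :: "real \<Rightarrow> real \<Rightarrow> real \<Rightarrow> real \<Rightarrow> real" where
  "tent a b h x = max 0 (x - a) - max 0 (x - a - h) - max 0 (x - b) + max 0 (x - b - h)"

text \<open>The weak identity tested with \<open>tent a b h\<close>, whose derivative is a
  difference of two indicators. As a tent is not smooth, each max 0 is replaced by the smooth ramp
  at scale 1 / \<open>Suc n\<close>, and both sides converge by dominated convergence.\<close>

lemma weak_deriv_tent:
  fixes f g :: "real \<Rightarrow> 'a::euclidean_space"
  assumes "has_weak_deriv f g" and ab: "a \<le> b" and h: "0 < h"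
  shows "integral {a..a + h} f - integral {b..b + h} f = - (LINT x|lebesgue. tent a b h x *\<^sub>R g x)"
proof -
  from assms have f: "locally_integrable f" and g: "locally_integrable g"
    and weak: "\<And>\<phi>. test_function \<phi> \<Longrightarrow>
        (LINT x|lebesgue. deriv \<phi> x *\<^sub>R f x) = - (LINT x|lebesgue. \<phi> x *\<^sub>R g x)"
    by (auto simp: has_weak_deriv_def)
  obtain K H :: "real \<Rightarrow> real" where K: "\<And>n. times_differentiable n K"
    and KH: "\<And>x. (K has_real_derivative H x) (at x)"
    and K0: "\<And>x. x \<le> 0 \<Longrightarrow> K x = 0" and H0: "\<And>x. x \<le> 0 \<Longrightarrow> H x = 0"
    and H1: "\<And>x. 1 \<le> x \<Longrightarrow> H x = 1" and Hnn: "\<And>x. 0 \<le> H x" and Hle: "\<And>x. H x \<le> 1"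
    using smooth_ramp_exists by blast
  have lip: "0 \<le> K y - K x \<and> K y - K x \<le> y - x" if "x \<le> y" for x y
  proof (cases "x = y")
    case False
    with that obtain z where "K y - K x = (y - x) * H z"
      using MVT2[of x y K H] KH by auto
    then show ?thesis
      using Hnn[of z] Hle[of z] that by (auto intro: mult_left_le)
  qed auto
  define k where "k = K 1 - 1"
  have K_large: "K x = x + k" if "1 \<le> x" for x
  proof (cases "x = 1")
    case False
    with that obtain z where z: "1 < z" "K x - K 1 = (x - 1) * H z"
      using MVT2[of 1 x K H] KH by auto
    then show ?thesis using H1[of z] by (auto simp: k_def)
  qed (auto simp: k_def)
  have K_max: "\<bar>K x - max 0 x\<bar> \<le> 1" for x
    using K0[of x] K_large[of x] lip[of 0 1] lip[of 0 x] K0[of 0] k_def by (cases "x \<le> 0"; cases "x \<le> 1") auto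
  let ?M = "\<lambda>n. real (Suc n)"
  have K_lim: "(\<lambda>n. K (?M n * t) / ?M n) \<longlonglongrightarrow> max 0 t" for t
  proof (rule LIMSEQ_I)
    fix r :: real assume "0 < r"
    then obtain N where N: "inverse (real (Suc N)) < r"
      using reals_Archimedean by blast
    have "norm (K (?M n * t) / ?M n - max 0 t) < r" if "n \<ge> N" for n
    proof -
      have "max 0 t = max 0 (?M n * t) / ?M n"
        by (cases "t \<le> 0") (auto simp: max_def mult_le_0_iff zero_le_mult_iff)
      then have "\<bar>K (?M n * t) / ?M n - max 0 t\<bar>
        = \<bar>K (?M n * t) - max 0 (?M n * t)\<bar> / ?M n"
        by (simp add: diff_divide_distrib[symmetric] abs_divide del: of_nat_Suc)
      also have "\<dots> \<le> 1 / ?M n"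
        using K_max by (intro divide_right_mono) auto
      also have "\<dots> \<le> inverse (real (Suc N))"
        using that by (simp add: field_simps)
      finally show ?thesis using N by simp
    qed
    then show "\<exists>no. \<forall>n\<ge>no. norm (K (?M n * t) / ?M n - max 0 t) < r"
      by blast
  qed
  have H_lim: "(\<lambda>n. H (?M n * t)) \<longlonglongrightarrow> indicator {0<..} t" for t
  proof (cases "t \<le> 0")
    case True
    then have "?M n * t \<le> 0" for n
      by (simp add: mult_le_0_iff)
    with True show ?thesis by (simp add: H0 indicator_def del: of_nat_Suc)
  next
    case False
    then obtain N where N: "inverse (real (Suc N)) < t"
      using reals_Archimedean by (metis not_le)
    have "H (?M n * t) = 1" if "n \<ge> N" for n
    proof (rule H1)
      have "1 \<le> real (Suc N) * t" using N by (simp add: field_simps)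
      also have "\<dots> \<le> ?M n * t"
        using that False by (intro mult_right_mono) auto
      finally show "1 \<le> ?M n * t" .
    qed
    with False show ?thesis
      by (intro tendsto_eventually) (auto simp: eventually_sequentially indicator_def)
  qed
  define \<phi> where "\<phi> n x = (K (?M n * (x - a)) - K (?M n * (x - a - h))
    - K (?M n * (x - b)) + K (?M n * (x - b - h))) / ?M n" for n x
  define \<phi>' where "\<phi>' n x = H (?M n * (x - a)) - H (?M n * (x - a - h))
    - H (?M n * (x - b)) + H (?M n * (x - b - h))" for n x
  have d: "(\<phi> n has_real_derivative \<phi>' n x) (at x)" for n x
    unfolding \<phi>_def \<phi>'_def
    by (auto intro!: derivative_eq_intros DERIV_chain2[OF KH] simp: field_simps simp del: of_nat_Suc)
      (simp add: field_simps)?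
  then have deriv: "deriv (\<phi> n) = \<phi>' n" for n
    by (auto intro!: ext DERIV_imp_deriv)
  \<comment> \<open>The margin 1 ensures that, to the right of the interval, all four arguments
    scaled by \<open>?M n\<close> \<ge> 1 lie where K x = x + k and H x = 1, so that the affine
    terms cancel. The support is thereby bounded uniformly in n.\<close>
  have supp: "\<phi> n x = 0 \<and> \<phi>' n x = 0" if "x \<notin> {a..b + h + 1}" for n x
  proof (cases "x < a")
    case True
    with ab h have "?M n * (x - a) \<le> 0" "?M n * (x - a - h) \<le> 0"
      "?M n * (x - b) \<le> 0" "?M n * (x - b - h) \<le> 0"
      by (auto simp: mult_le_0_iff)
    then show ?thesis by (simp add: \<phi>_def \<phi>'_def K0 H0 del: of_nat_Suc)
  next
    case False
    with that have x: "x > b + h + 1" by auto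
    have ge: "1 \<le> ?M n * t" if "1 \<le> t" for t
      using mult_mono[of 1 "?M n" 1 t] that by simp
    have "1 \<le> ?M n * (x - a)" "1 \<le> ?M n * (x - a - h)"
      "1 \<le> ?M n * (x - b)" "1 \<le> ?M n * (x - b - h)"
      by (rule ge; use x ab h in simp)+
    then show ?thesis
      by (simp add: \<phi>_def \<phi>'_def K_large H1 del: of_nat_Suc) (simp add: algebra_simps)
  qed
  have smooth: "times_differentiable k (\<phi> n)" for k n
  proof -
    have *: "times_differentiable k (\<lambda>x. s * K (?M n * x + c))" for s c
      by (intro times_differentiable_mult times_differentiable_const times_differentiable_affine K)
    let ?s = "1 / ?M n"
    have "\<phi> n = (\<lambda>x. ?s * K (?M n * x + - ?M n * a)
      + (- ?s) * K (?M n * x + - ?M n * (a + h))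
      + (- ?s) * K (?M n * x + - ?M n * b)
      + ?s * K (?M n * x + - ?M n * (b + h)))"
      by (rule ext) (simp add: \<phi>_def algebra_simps add_divide_distrib diff_divide_distrib)
    then show ?thesis
      by (simp only:) (intro times_differentiable_add *)
  qed
  have test: "test_function (\<phi> n)" for n
    using smooth supp by (intro test_functionI[of _ a "b + h + 1"]) auto
  have "continuous_on UNIV (\<phi> n)" for n
    using d by (auto intro!: continuous_at_imp_continuous_on DERIV_isCont)
  then have meas: "\<phi> n \<in> borel_measurable lebesgue" for n
    by (intro measurable_completion) (auto intro: borel_measurable_continuous_onI)
  have "continuous_on UNIV (\<phi>' n)" for n
  proof -
    obtain D where "\<And>x. (\<phi> n has_real_derivative D x) (at x)" and D: "times_differentiable 1 D"
      using smooth[of 2 n] by (auto simp: numeral_2_eq_2)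
    then have "D = \<phi>' n"
      using d DERIV_unique by blast
    moreover have "isCont D x" for x
      using D by (auto dest: DERIV_isCont)
    ultimately show ?thesis
      by (simp add: continuous_at_imp_continuous_on)
  qed
  then have meas': "\<phi>' n \<in> borel_measurable lebesgue" for n
    by (intro measurable_completion) (auto intro: borel_measurable_continuous_onI)
  \<comment> \<open>K is nondecreasing with slope at most 1, so both differences of K lie between 0
    and \<open>?M n * h\<close>.\<close>
  have bound: "\<bar>\<phi> n x\<bar> \<le> h" for n x
  proof -
    have m: "0 \<le> ?M n * (x - a) - ?M n * (x - a - h)"
      "0 \<le> ?M n * (x - b) - ?M n * (x - b - h)"
      using h by (simp_all add: algebra_simps)
    have "\<bar>K (?M n * (x - a)) - K (?M n * (x - a - h))
       - (K (?M n * (x - b)) - K (?M n * (x - b - h)))\<bar> \<le> ?M n * h"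
      using lip[of "?M n * (x - a - h)" "?M n * (x - a)"]
        lip[of "?M n * (x - b - h)" "?M n * (x - b)"] m
      by (simp add: algebra_simps) (simp add: abs_le_iff)?
    then show ?thesis
      by (simp add: \<phi>_def abs_divide divide_le_eq mult.commute algebra_simps)
  qed
  have bound': "\<bar>\<phi>' n x\<bar> \<le> 2" for n x
    unfolding \<phi>'_def
    using Hnn[of "?M n * (x - a)"] Hle[of "?M n * (x - a)"]
      Hnn[of "?M n * (x - a - h)"] Hle[of "?M n * (x - a - h)"]
      Hnn[of "?M n * (x - b)"] Hle[of "?M n * (x - b)"]
      Hnn[of "?M n * (x - b - h)"] Hle[of "?M n * (x - b - h)"]
    by (auto simp: abs_le_iff simp del: of_nat_Suc)
  have lim: "(\<lambda>n. \<phi> n x) \<longlonglongrightarrow> tent a b h x" for x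
    unfolding \<phi>_def tent_def add_divide_distrib diff_divide_distrib
    by (intro tendsto_intros K_lim)
  have lim': "(\<lambda>n. \<phi>' n x) \<longlonglongrightarrow> indicator {a<..a + h} x - indicator {b<..b + h} x" for x
  proof -
    have "(\<lambda>n. \<phi>' n x) \<longlonglongrightarrow> indicator {0<..} (x - a) - indicator {0<..} (x - a - h)
      - indicator {0<..} (x - b) + indicator {0<..} (x - b - h)"
      unfolding \<phi>'_def by (intro tendsto_intros H_lim)
    also have "indicator {0<..} (x - a) - indicator {0<..} (x - a - h)
      - indicator {0<..} (x - b) + indicator {0<..} (x - b - h) =
      (indicator {a<..a + h} x - indicator {b<..b + h} x :: real)"
      using h by (auto simp: indicator_def)
    finally show ?thesis .
  qed
  have L1: "(\<lambda>n. LINT x|lebesgue. \<phi> n x *\<^sub>R g x) \<longlonglongrightarrow> (LINT x|lebesgue. tent a b h x *\<^sub>R g x)"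
    by (rule LINT_locally_integrable_tendsto[OF g meas bound _ lim]) (use supp in auto)
  have "(\<lambda>n. LINT x|lebesgue. \<phi>' n x *\<^sub>R f x) \<longlonglongrightarrow>
      (LINT x|lebesgue. (indicator {a<..a + h} x - indicator {b<..b + h} x) *\<^sub>R f x)"
    by (rule LINT_locally_integrable_tendsto[OF f meas' bound' _ lim']) (use supp in auto)
  also have "(LINT x|lebesgue. (indicator {a<..a + h} x - indicator {b<..b + h} x) *\<^sub>R f x)
      = integral {a..a + h} f - integral {b..b + h} f"
    using LINT_indicator_Ioc[OF f] by (simp add: scaleR_diff_left)
  finally have "(\<lambda>n. - (LINT x|lebesgue. \<phi> n x *\<^sub>R g x)) \<longlonglongrightarrow>
    integral {a..a + h} f - integral {b..b + h} f"
    using weak[OF test] by (simp add: deriv)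
  then show ?thesis
    using LIMSEQ_unique tendsto_minus[OF L1] by blast
qed

text \<open>Dividing \<open>weak_deriv_tent\<close> by \<open>h\<close> and letting \<open>h\<close> tend to \<open>0\<close>, the left-hand side converges
  at Lebesgue points, and the tents converge to the indicator function of \<open>{a<..b}\<close>.\<close>

lemma weak_deriv_imp_integral:
  fixes f g :: "real \<Rightarrow> 'a::euclidean_space"
  assumes weak: "has_weak_deriv f g"
  obtains N where "negligible N"
    "\<And>a b. a \<notin> N \<Longrightarrow> b \<notin> N \<Longrightarrow> a \<le> b \<Longrightarrow> f b - f a = integral {a..b} g"
proof -
  from weak have f: "locally_integrable f" and g: "locally_integrable g"
    by (auto simp: has_weak_deriv_def)
  obtain N where N: "negligible N" "\<And>x e. x \<notin> N \<Longrightarrow> 0 < e \<Longrightarrow>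
      \<exists>d>0. \<forall>h. 0 < h \<and> h < d \<longrightarrow> norm (integral {x..x + h} f /\<^sub>R h - f x) < e"
    using integrable_ccontinuous_explicit[of f] locally_integrable_imp_integrable_on[OF f]
    by (auto simp: cbox_interval)
  define h where "h n = inverse (real (Suc n))" for n
  have h0: "h \<longlonglongrightarrow> 0"
    using LIMSEQ_inverse_real_of_nat by (simp add: h_def[abs_def])
  have hpos: "h n > 0" and h1: "h n \<le> 1" for n
    by (auto simp: h_def field_simps)
  have leb: "(\<lambda>n. integral {x..x + h n} f /\<^sub>R h n) \<longlonglongrightarrow> f x" if x: "x \<notin> N" for x
  proof (rule LIMSEQ_I)
    fix e :: real assume "0 < e"
    from N(2)[OF x this] obtain d where d: "d > 0"
      "\<And>h. 0 < h \<Longrightarrow> h < d \<Longrightarrow> norm (integral {x..x + h} f /\<^sub>R h - f x) < e" by blast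
    have "\<forall>\<^sub>F n in sequentially. h n < d"
      using order_tendstoD(2)[OF h0 d(1)] .
    then show "\<exists>no. \<forall>n\<ge>no. norm (integral {x..x + h n} f /\<^sub>R h n - f x) < e"
      using d(2) hpos by (auto simp: eventually_sequentially)
  qed
  have "f b - f a = integral {a..b} g" if a: "a \<notin> N" and b: "b \<notin> N" and ab: "a \<le> b" for a b
  proof -
    define \<phi> where "\<phi> n x = tent a b (h n) x / h n" for n x
    have lim: "(\<lambda>n. \<phi> n x) \<longlonglongrightarrow> indicator {a<..b} x" for x
    proof -
      have ramp: "(\<lambda>n. (max 0 t - max 0 (t - h n)) / h n) \<longlonglongrightarrow> indicator {0<..} t" for t
      proof (cases "t \<le> 0")
        case True
        with hpos have "max 0 (t - h n) = 0" for n
          by (smt (verit))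
        with True show ?thesis by simp
      next
        case False
        then have "\<forall>\<^sub>F n in sequentially. h n < t"
          using order_tendstoD(2)[OF h0, of t] by auto
        then have "\<forall>\<^sub>F n in sequentially. (max 0 t - max 0 (t - h n)) / h n = 1"
          by eventually_elim (use False hpos in \<open>auto simp: max_def less_imp_neq[THEN not_sym]\<close>)
        with False show ?thesis by (simp add: tendsto_eventually)
      qed
      have "(\<lambda>n. (max 0 (x - a) - max 0 (x - a - h n)) / h n
        - (max 0 (x - b) - max 0 (x - b - h n)) / h n) \<longlonglongrightarrow>
        indicator {0<..} (x - a) - indicator {0<..} (x - b)"
        by (intro tendsto_intros ramp)
      moreover have "indicator {0<..} (x - a) - indicator {0<..} (x - b) = (indicator {a<..b} x :: real)"
        using ab by (auto simp: indicator_def)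
      moreover have "\<phi> n x = (max 0 (x - a) - max 0 (x - a - h n)) / h n
        - (max 0 (x - b) - max 0 (x - b - h n)) / h n" for n
        by (simp add: \<phi>_def tent_def add_divide_distrib diff_divide_distrib)
      ultimately show ?thesis by simp
    qed
    have "\<bar>tent a b (h n) x\<bar> \<le> h n" for n x
      using hpos[of n] ab by (auto simp: tent_def max_def)
    then have bound: "\<bar>\<phi> n x\<bar> \<le> 1" for n x
      using hpos[of n] by (simp add: \<phi>_def abs_divide)
    have supp: "\<phi> n x = 0" if "x \<notin> {a..b + 1}" for n x
      using that hpos[of n] h1[of n] ab by (auto simp: \<phi>_def tent_def max_def)
    have "continuous_on UNIV (\<phi> n)" for n
      unfolding \<phi>_def tent_def using hpos[of n] by (auto intro!: continuous_intros)
    then have meas: "\<phi> n \<in> borel_measurable lebesgue" for n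
      by (intro measurable_completion) (auto intro: borel_measurable_continuous_onI)
    have "(\<lambda>n. LINT x|lebesgue. \<phi> n x *\<^sub>R g x) \<longlonglongrightarrow> (LINT x|lebesgue. indicator {a<..b} x *\<^sub>R g x)"
      by (rule LINT_locally_integrable_tendsto[OF g meas bound supp lim])
    then have "(\<lambda>n. LINT x|lebesgue. \<phi> n x *\<^sub>R g x) \<longlonglongrightarrow> integral {a..b} g"
      by (simp add: LINT_indicator_Ioc[OF g])
    moreover have "(LINT x|lebesgue. \<phi> n x *\<^sub>R g x)
      = integral {b..b + h n} f /\<^sub>R h n - integral {a..a + h n} f /\<^sub>R h n" for n
    proof -
      have "(LINT x|lebesgue. \<phi> n x *\<^sub>R g x) = inverse (h n) *\<^sub>R (LINT x|lebesgue. tent a b (h n) x *\<^sub>R g x)"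
        by (subst integral_scaleR_right[symmetric]) (simp add: \<phi>_def divide_inverse mult.commute)
      also have "(LINT x|lebesgue. tent a b (h n) x *\<^sub>R g x)
        = integral {b..b + h n} f - integral {a..a + h n} f"
        using weak_deriv_tent[OF weak ab hpos, of n] by (simp add: algebra_simps)
      finally show ?thesis by (simp add: scaleR_diff_right)
    qed
    ultimately have "(\<lambda>n. integral {b..b + h n} f /\<^sub>R h n - integral {a..a + h n} f /\<^sub>R h n)
      \<longlonglongrightarrow> integral {a..b} g" by simp
    moreover have "(\<lambda>n. integral {b..b + h n} f /\<^sub>R h n - integral {a..a + h n} f /\<^sub>R h n)
      \<longlonglongrightarrow> f b - f a"
      by (intro tendsto_diff leb a b)
    ultimately show ?thesis using LIMSEQ_unique by blast
  qed
  with N(1) that show thesis by blast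
qed

lemma continuous_AE_eq_imp_eq:
  fixes F G :: "real \<Rightarrow> 'a::euclidean_space"
  assumes "continuous_on UNIV F" "continuous_on UNIV G" "AE x in lebesgue. F x = G x"
  shows "F x = G x"
proof -
  from assms(3) obtain N where N: "negligible N" "{x. F x \<noteq> G x} \<subseteq> N"
    by (auto simp: eventually_ae_filter_negligible)
  have "open {x. F x \<noteq> G x}"
    using assms(1,2) by (rule open_Collect_neq)
  moreover have "negligible {x. F x \<noteq> G x}"
    using N negligible_subset by blast
  ultimately show ?thesis
    using open_not_negligible by blast
qed

text \<open>The integral form of absolute continuity. It involves g only up to null sets, which is
  all that a weak derivative provides; pointwise derivatives of F follow once g has a continuous
  representative.\<close>

definition primitive :: "(real \<Rightarrow> 'a::euclidean_space) \<Rightarrow> (real \<Rightarrow> 'a) \<Rightarrow> bool" where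
  "primitive F g \<longleftrightarrow> (\<forall>a b. a \<le> b \<longrightarrow> F b - F a = integral {a..b} g)"

lemma weak_deriv_imp_primitive:
  fixes f g :: "real \<Rightarrow> 'a::euclidean_space"
  assumes weak: "has_weak_deriv f g"
  obtains F where "continuous_on UNIV F" "AE x in lebesgue. f x = F x" "primitive F g"
proof -
  obtain N where N: "negligible N"
    and fN: "\<And>a b. a \<notin> N \<Longrightarrow> b \<notin> N \<Longrightarrow> a \<le> b \<Longrightarrow> f b - f a = integral {a..b} g"
    using weak_deriv_imp_integral[OF weak] by blast
  have int: "g integrable_on {a..b}" for a b
    using weak locally_integrable_imp_integrable_on by (auto simp: has_weak_deriv_def)
  have comb: "integral {a..b} g + integral {b..c} g = integral {a..c} g" if "a \<le> b" "b \<le> c" for a b c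
    using Henstock_Kurzweil_Integration.integral_combine[OF that int] .
  have "N \<noteq> UNIV" using N by auto
  then obtain a where a: "a \<notin> N" by auto
  \<comment> \<open>\<open>integral {a..x} g\<close> is 0 for x < a, hence the signed second case.
    The base point lies outside N, so that f a is the value of the continuous representative
    there.\<close>
  define F where "F x = f a + (if a \<le> x then integral {a..x} g else - integral {x..a} g)" for x
  have prim: "primitive F g"
    unfolding primitive_def
  proof (intro allI impI)
    fix x y :: real assume xy: "x \<le> y"
    consider "a \<le> x" | "x < a" "a \<le> y" | "y < a" by linarith
    then show "F y - F x = integral {x..y} g"
    proof cases
      case 1
      then show ?thesis using xy by (simp add: F_def comb[OF 1 xy, symmetric])
    next
      case 2
      then have "integral {x..y} g = integral {x..a} g + integral {a..y} g"
        by (simp add: comb)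
      then show ?thesis using 2 by (simp add: F_def)
    next
      case 3
      then have "integral {x..a} g = integral {x..y} g + integral {y..a} g"
        using xy by (simp add: comb)
      then show ?thesis using 3 xy by (simp add: F_def)
    qed
  qed
  show thesis
  proof (rule that[of F])
    show "AE x in lebesgue. f x = F x"
      unfolding eventually_ae_filter_negligible
    proof (intro exI[of _ N] conjI)
      have "f x = F x" if "x \<notin> N" for x
      proof (cases "a \<le> x")
        case True
        then show ?thesis by (simp add: F_def flip: fN[OF a that True])
      next
        case False
        then have "f a - f x = integral {x..a} g" by (intro fN[OF that a]) simp
        with False show ?thesis by (simp add: F_def flip: \<open>f a - f x = _\<close>)
      qed
      then show "{x. f x \<noteq> F x} \<subseteq> N" by blast
    qed fact
    have "isCont F x" for x
    proof -
      have *: "continuous_on {x - 1..x + 1} (\<lambda>t. F (x - 1) + integral {x - 1..t} g)"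
        by (intro continuous_intros indefinite_integral_continuous_1 int)
      have "F (x - 1) + integral {x - 1..t} g = F t" if "t \<in> {x - 1..x + 1}" for t
        using that by (simp flip: prim[unfolded primitive_def, rule_format])
      with * have "continuous_on {x - 1..x + 1} F"
        by (rule continuous_on_eq)
      then show ?thesis
        by (rule continuous_on_interior) auto
    qed
    then show "continuous_on UNIV F"
      by (simp add: continuous_at_imp_continuous_on)
  qed fact
qed

text \<open>The fundamental theorem of calculus with an integrand altered on a null set: it turns
  continuity of the weak derivative into classical differentiability.\<close>

lemma primitive_has_vector_derivative:
  fixes g :: "real \<Rightarrow> 'a::euclidean_space"
  assumes "primitive F g" "AE x in lebesgue. g x = G x" "continuous_on UNIV G"
  shows "(F has_vector_derivative G x) (at x)"
proof -
  from assms(2) obtain N where N: "negligible N" "{x. g x \<noteq> G x} \<subseteq> N"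
    by (auto simp: eventually_ae_filter_negligible)
  have eq: "integral {a..b} g = integral {a..b} G" for a b
    by (rule integral_spike[OF N(1)]) (use N(2) in force)
  have "((\<lambda>u. integral {x - 1..u} G) has_vector_derivative G x) (at x within {x - 1..x + 1})"
    by (rule integral_has_vector_derivative) (use assms(3) continuous_on_subset in auto)
  then have "((\<lambda>u. F (x - 1) + integral {x - 1..u} G) has_vector_derivative G x) (at x within {x - 1..x + 1})"
    by (auto intro!: derivative_eq_intros)
  then have "((\<lambda>u. F (x - 1) + integral {x - 1..u} G) has_vector_derivative G x) (at x)"
    by (simp add: at_within_Icc_at)
  then show ?thesis
  proof (rule has_vector_derivative_transform_within_open[where S = "{x - 1<..<x + 1}"])
    fix u assume "u \<in> {x - 1<..<x + 1}"
    then show "F (x - 1) + integral {x - 1..u} G = F u"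
      using assms(1)[unfolded primitive_def, rule_format, of "x - 1" u] by (simp add: eq algebra_simps)
  qed auto
qed

text \<open>The energy space and \<open>TW_solution\<close> each assert the existence of a weak
  derivative, and the two must be identified. The continuous representatives coincide, so g and g'
  have equal integrals over all intervals, and differentiating the integral of g - g' leaves 0
  almost everywhere.\<close>

lemma weak_deriv_unique:
  fixes f g g' :: "real \<Rightarrow> 'a::euclidean_space"
  assumes "has_weak_deriv f g" "has_weak_deriv f g'"
  shows "AE x in lebesgue. g x = g' x"
proof -
  obtain F where F: "continuous_on UNIV F" "AE x in lebesgue. f x = F x" "primitive F g"
    using weak_deriv_imp_primitive[OF assms(1)] by blast
  obtain F' where F': "continuous_on UNIV F'" "AE x in lebesgue. f x = F' x" "primitive F' g'"
    using weak_deriv_imp_primitive[OF assms(2)] by blast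
  have "AE x in lebesgue. F x = F' x"
    using F(2) F'(2) by eventually_elim auto
  then have "F x = F' x" for x
    by (rule continuous_AE_eq_imp_eq[OF F(1) F'(1)])
  then have eq: "integral {a..b} g = integral {a..b} g'" if "a \<le> b" for a b
    using F(3)[unfolded primitive_def, rule_format, OF that]
      F'(3)[unfolded primitive_def, rule_format, OF that] by simp
  define d where "d x = g x - g' x" for x
  have int: "g integrable_on {a..b}" "g' integrable_on {a..b}" for a b
    using assms locally_integrable_imp_integrable_on by (auto simp: has_weak_deriv_def)
  then have "d integrable_on {a..b}" for a b
    unfolding d_def by (intro integrable_diff)
  then obtain N where N: "negligible N" "\<And>x e. x \<notin> N \<Longrightarrow> 0 < e \<Longrightarrow>
      \<exists>\<delta>>0. \<forall>h. 0 < h \<and> h < \<delta> \<longrightarrow> norm (integral {x..x + h} d /\<^sub>R h - d x) < e"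
    using integrable_ccontinuous_explicit[of d] by (auto simp: cbox_interval)
  have zero: "integral {x..x + h} d = 0" if "0 < h" for x h
    unfolding d_def using eq[of x "x + h"] that by (simp add: integral_diff int)
  have "g x = g' x" if x: "x \<notin> N" for x
  proof (rule ccontr)
    assume "g x \<noteq> g' x"
    then have "0 < norm (d x)" by (simp add: d_def)
    from N(2)[OF x this] obtain \<delta> where \<delta>: "\<delta> > 0"
      "\<forall>h. 0 < h \<and> h < \<delta> \<longrightarrow> norm (integral {x..x + h} d /\<^sub>R h - d x) < norm (d x)" by blast
    from \<delta>(2)[rule_format, of "\<delta> / 2"] \<delta>(1) show False by (simp add: zero)
  qed
  then have "{x. g x \<noteq> g' x} \<subseteq> N" by blast
  with N(1) show ?thesis
    unfolding eventually_ae_filter_negligible by blast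
qed

section \<open>Calculus of locally integrable functions and test functions\<close>

lemma locally_integrable_measurable:
  fixes f :: "real \<Rightarrow> 'a::euclidean_space"
  assumes "locally_integrable f"
  shows "f \<in> borel_measurable lebesgue"
proof (rule borel_measurable_LIMSEQ_metric)
  show "(\<lambda>x. indicator {- real n..real n} x *\<^sub>R f x) \<in> borel_measurable lebesgue" for n
    using locally_integrable_indicator[OF assms] by auto
  show "(\<lambda>n. indicator {- real n..real n} x *\<^sub>R f x) \<longlonglongrightarrow> f x" for x
  proof (rule tendsto_eventually)
    obtain N where "\<bar>x\<bar> \<le> real N" using real_arch_simple by blast
    then show "\<forall>\<^sub>F n in sequentially. indicator {- real n..real n} x *\<^sub>R f x = f x"
      unfolding eventually_sequentially by (intro exI[of _ N]) (auto simp: indicator_def)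
  qed
qed

lemma locally_integrableI:
  "(\<And>a b. integrable lebesgue (\<lambda>x. indicator {a..b} x *\<^sub>R f x)) \<Longrightarrow> locally_integrable f"
  by (simp add: locally_integrable_def set_integrable_def)

lemma locally_integrable_bound:
  fixes f :: "real \<Rightarrow> 'a::euclidean_space" and g :: "real \<Rightarrow> 'b::euclidean_space"
  assumes g: "locally_integrable g" and f: "f \<in> borel_measurable lebesgue"
    and le: "AE x in lebesgue. norm (f x) \<le> norm (g x)"
  shows "locally_integrable f"
proof (rule locally_integrableI)
  fix a b :: real
  show "integrable lebesgue (\<lambda>x. indicator {a..b} x *\<^sub>R f x)"
  proof (rule Bochner_Integration.integrable_bound)
    show "integrable lebesgue (\<lambda>x. indicator {a..b} x *\<^sub>R g x)"
      by (rule locally_integrable_indicator[OF g])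
    show "AE x in lebesgue. norm (indicator {a..b} x *\<^sub>R f x) \<le> norm (indicator {a..b} x *\<^sub>R g x)"
      using le by eventually_elim (auto simp: indicator_def)
  qed (use f in \<open>auto intro!: borel_measurable_scaleR borel_measurable_indicator\<close>)
qed

lemma locally_integrable_AE_cong:
  fixes f g :: "real \<Rightarrow> 'a::euclidean_space"
  assumes "locally_integrable f" "AE x in lebesgue. f x = g x"
  shows "locally_integrable g"
proof (rule locally_integrable_bound[OF assms(1)])
  show "g \<in> borel_measurable lebesgue"
    using borel_measurable_AE[OF locally_integrable_measurable[OF assms(1)] assms(2)] .
  show "AE x in lebesgue. norm (g x) \<le> norm (f x)"
    using assms(2) by eventually_elim auto
qed

lemma locally_integrable_continuous:
  fixes f :: "real \<Rightarrow> 'a::euclidean_space"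
  assumes "continuous_on UNIV f"
  shows "locally_integrable f"
  unfolding locally_integrable_def
  using absolutely_integrable_continuous_real continuous_on_subset[OF assms] by blast

lemma locally_integrable_add:
  fixes f g :: "real \<Rightarrow> 'a::euclidean_space"
  shows "locally_integrable f \<Longrightarrow> locally_integrable g \<Longrightarrow> locally_integrable (\<lambda>x. f x + g x)"
  by (simp add: locally_integrable_def set_integral_add)

lemma locally_integrable_cmult:
  fixes f :: "real \<Rightarrow> real"
  shows "locally_integrable f \<Longrightarrow> locally_integrable (\<lambda>x. k * f x)"
  by (simp add: locally_integrable_def)

lemma locally_integrable_bounded_linear:
  fixes f :: "real \<Rightarrow> 'a::euclidean_space" and L :: "'a \<Rightarrow> 'b::euclidean_space"
  assumes "bounded_linear L" "locally_integrable f"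
  shows "locally_integrable (\<lambda>x. L (f x))"
  unfolding locally_integrable_def
  using absolutely_integrable_linear[OF _ assms(1)] assms(2)
  by (auto simp: locally_integrable_def o_def)

lemma locally_integrable_mult_bounded:
  fixes f g :: "real \<Rightarrow> real"
  assumes "locally_integrable f" "g \<in> borel_measurable lebesgue" "AE x in lebesgue. \<bar>g x\<bar> \<le> 1"
  shows "locally_integrable (\<lambda>x. g x * f x)"
proof (rule locally_integrable_bound[OF assms(1)])
  show "(\<lambda>x. g x * f x) \<in> borel_measurable lebesgue"
    using assms(2) locally_integrable_measurable[OF assms(1)] by measurable
  show "AE x in lebesgue. norm (g x * f x) \<le> norm (f x)"
    using assms(3) by eventually_elim (simp add: abs_mult mult_left_le_one_le)
qed

lemma test_function_props:
  assumes "test_function \<phi>"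
  obtains R where "R > 0" "\<And>x. x \<notin> {-R..R} \<Longrightarrow> \<phi> x = 0" "\<And>x. x \<notin> {-R..R} \<Longrightarrow> deriv \<phi> x = 0"
    "\<And>x. (\<phi> has_real_derivative deriv \<phi> x) (at x)"
    "continuous_on UNIV \<phi>" "continuous_on UNIV (deriv \<phi>)"
proof -
  have diff: "\<And>n x. (deriv ^^ n) \<phi> differentiable (at x)"
    and comp: "compact (closure {x. \<phi> x \<noteq> 0})"
    using assms by (auto simp: test_function_def)
  have d: "(\<phi> has_real_derivative deriv \<phi> x) (at x)" for x
    using diff[of 0 x] by (simp add: DERIV_deriv_iff_real_differentiable)
  have d': "(deriv \<phi> has_real_derivative deriv (deriv \<phi>) x) (at x)" for x
    using diff[of 1 x] by (simp add: DERIV_deriv_iff_real_differentiable)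
  obtain R where R: "R > 0" "\<And>x. x \<in> closure {x. \<phi> x \<noteq> 0} \<Longrightarrow> \<bar>x\<bar> \<le> R"
    using compact_imp_bounded[OF comp] by (auto simp: bounded_pos)
  have zero: "\<phi> x = 0" if "x \<notin> {-R..R}" for x
    using R(2)[of x] that closure_subset[of "{x. \<phi> x \<noteq> 0}"] by (force simp: abs_le_iff)
  have "deriv \<phi> x = 0" if x: "x \<notin> {-R..R}" for x
  proof -
    have "((\<lambda>_. 0) has_real_derivative 0) (at x)" by simp
    then have "(\<phi> has_real_derivative 0) (at x)"
      by (rule has_field_derivative_transform_within_open[where S = "- {-R..R}"])
         (use x zero in auto)
    then show ?thesis by (rule DERIV_imp_deriv)
  qed
  with R(1) zero d d' show thesis
    by (intro that[of R]) (auto intro!: continuous_at_imp_continuous_on DERIV_isCont)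
qed

lemma integrable_compact_support:
  fixes f :: "real \<Rightarrow> 'a::euclidean_space"
  assumes \<phi>: "continuous_on UNIV \<phi>" and supp: "\<And>x. x \<notin> {-R..R} \<Longrightarrow> \<phi> x = 0"
    and f: "locally_integrable f"
  shows "integrable lebesgue (\<lambda>x. \<phi> x *\<^sub>R f x)"
proof -
  have "bounded (\<phi> ` {-R..R})"
    using \<phi> by (intro compact_imp_bounded compact_continuous_image) (auto intro: continuous_on_subset)
  then obtain B where B: "\<bar>\<phi> x\<bar> \<le> B" if "x \<in> {-R..R}" for x
    unfolding bounded_iff by fastforce
  show ?thesis
  proof (rule Bochner_Integration.integrable_bound)
    show "integrable lebesgue (\<lambda>x. B *\<^sub>R (indicator {-R..R} x *\<^sub>R f x))"
      by (intro integrable_scaleR_right locally_integrable_indicator f)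
    have "\<phi> \<in> borel_measurable lebesgue"
      by (intro measurable_completion) (use \<phi> in \<open>auto intro: borel_measurable_continuous_onI\<close>)
    then show "(\<lambda>x. \<phi> x *\<^sub>R f x) \<in> borel_measurable lebesgue"
      using locally_integrable_measurable[OF f] by measurable
    show "AE x in lebesgue. norm (\<phi> x *\<^sub>R f x) \<le> norm (B *\<^sub>R (indicator {-R..R} x *\<^sub>R f x))"
    proof (rule AE_I2)
      fix x
      show "norm (\<phi> x *\<^sub>R f x) \<le> norm (B *\<^sub>R (indicator {-R..R} x *\<^sub>R f x))"
        using supp[of x] B[of x] by (cases "x \<in> {-R..R}") (auto intro!: mult_right_mono)
    qed
  qed
qed

lemma integrable_test_function:
  fixes f :: "real \<Rightarrow> 'a::euclidean_space"
  assumes "test_function \<phi>" "locally_integrable f"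
  shows "integrable lebesgue (\<lambda>x. \<phi> x *\<^sub>R f x)" "integrable lebesgue (\<lambda>x. deriv \<phi> x *\<^sub>R f x)"
  by (rule test_function_props[OF assms(1)]; rule integrable_compact_support; use assms in blast)+

lemma has_weak_deriv_bounded_linear:
  fixes f g :: "real \<Rightarrow> 'a::euclidean_space" and L :: "'a \<Rightarrow> 'b::euclidean_space"
  assumes L: "bounded_linear L" and "has_weak_deriv f g"
  shows "has_weak_deriv (\<lambda>x. L (f x)) (\<lambda>x. L (g x))"
proof -
  interpret bounded_linear L by fact
  from assms have f: "locally_integrable f" and g: "locally_integrable g"
    and weak: "\<And>\<phi>. test_function \<phi> \<Longrightarrow>
        (LINT x|lebesgue. deriv \<phi> x *\<^sub>R f x) = - (LINT x|lebesgue. \<phi> x *\<^sub>R g x)"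
    by (auto simp: has_weak_deriv_def)
  show ?thesis
    unfolding has_weak_deriv_def
  proof (intro conjI allI impI)
    fix \<phi> assume \<phi>: "test_function \<phi>"
    have "(LINT x|lebesgue. deriv \<phi> x *\<^sub>R L (f x)) = L (LINT x|lebesgue. deriv \<phi> x *\<^sub>R f x)"
      using integral_bounded_linear[OF L integrable_test_function(2)[OF \<phi> f]] by (simp add: scaleR)
    also have "\<dots> = - (LINT x|lebesgue. \<phi> x *\<^sub>R L (g x))"
      using integral_bounded_linear[OF L integrable_test_function(1)[OF \<phi> g]]
      by (simp add: scaleR weak[OF \<phi>] neg)
    finally show "(LINT x|lebesgue. deriv \<phi> x *\<^sub>R L (f x)) = - (LINT x|lebesgue. \<phi> x *\<^sub>R L (g x))" .
  qed (use f g L locally_integrable_bounded_linear in blast)+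
qed

type_synonym real_function = "real \<Rightarrow> real"

section \<open>Equivalence of the weak and the classical formulation\<close>

text \<open>\<open>x\<close>, \<open>m\<close>, \<open>y\<close> are the components \<open>v\<^sub>1\<close>, \<open>v\<^sub>2\<close>, \<open>v\<^sub>3\<close>; the primed arguments are their derivatives.\<close>

definition tw_profile :: "real \<Rightarrow> real \<Rightarrow> real \<Rightarrow> real_function \<Rightarrow> real_function \<Rightarrow> real_function
    \<Rightarrow> real_function \<Rightarrow> real_function \<Rightarrow> real_function \<Rightarrow> bool" where
  "tw_profile lam c \<omega> x m y x' m' y' \<longleftrightarrow> (\<forall>t.
     (x has_real_derivative x' t) (at t) \<and> (m has_real_derivative m' t) (at t) \<and>
     (y has_real_derivative y' t) (at t) \<and> (x t)\<^sup>2 + (m t)\<^sup>2 + (y t)\<^sup>2 = 1 \<and>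
     (let e = (x' t)\<^sup>2 + (m' t)\<^sup>2 + (y' t)\<^sup>2 + lam * ((x t)\<^sup>2 + (y t)\<^sup>2) in
     (x' has_real_derivative (lam + \<omega> * m t - e) * x t - c * (m t * y' t - m' t * y t)) (at t) \<and>
     (m' has_real_derivative c * (x t * y' t - y t * x' t) - e * m t - \<omega> * ((x t)\<^sup>2 + (y t)\<^sup>2)) (at t) \<and>
     (y' has_real_derivative (lam + \<omega> * m t - e) * y t + c * (m t * x' t - m' t * x t)) (at t)))"

lemma tw_profileI:
  assumes "\<And>t. (x has_real_derivative x' t) (at t)" "\<And>t. (m has_real_derivative m' t) (at t)"
    "\<And>t. (y has_real_derivative y' t) (at t)" "\<And>t. (x t)\<^sup>2 + (m t)\<^sup>2 + (y t)\<^sup>2 = 1"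
    "\<And>t. (x' t)\<^sup>2 + (m' t)\<^sup>2 + (y' t)\<^sup>2 + lam * ((x t)\<^sup>2 + (y t)\<^sup>2) = e t"
    "\<And>t. (x' has_real_derivative (lam + \<omega> * m t - e t) * x t - c * (m t * y' t - m' t * y t)) (at t)"
    "\<And>t. (m' has_real_derivative c * (x t * y' t - y t * x' t) - e t * m t - \<omega> * ((x t)\<^sup>2 + (y t)\<^sup>2)) (at t)"
    "\<And>t. (y' has_real_derivative (lam + \<omega> * m t - e t) * y t + c * (m t * x' t - m' t * x t)) (at t)"
  shows "tw_profile lam c \<omega> x m y x' m' y'"
  using assms by (simp add: tw_profile_def Let_def)

lemma norm_real3_power2: "(norm u)\<^sup>2 = (u $ 1)\<^sup>2 + (u $ 2)\<^sup>2 + (u $ 3)\<^sup>2" for u :: "real^3"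
  by (simp add: norm_vec_def L2_set_def sum_3 sum_nonneg)

text \<open>Both parts must be integrable: the integral of a nonintegrable function is 0 by
  convention, and the last hypothesis would then carry no information.\<close>

lemma LINT_Complex_eq_0D:
  fixes f g :: "real \<Rightarrow> real"
  assumes "integrable lebesgue f" "integrable lebesgue g"
    and "(LINT x|lebesgue. Complex (f x) (g x)) = 0"
  shows "(LINT x|lebesgue. f x) = 0" "(LINT x|lebesgue. g x) = 0"
proof -
  have "(LINT x|lebesgue. Complex (f x) (g x)) =
    of_real (LINT x|lebesgue. f x) + \<i> * of_real (LINT x|lebesgue. g x)"
    using assms(1,2) by (simp add: Complex_eq integral_complex_of_real)
  then have "Complex (LINT x|lebesgue. f x) (LINT x|lebesgue. g x) = 0"
    using assms(3) by (simp add: Complex_eq)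
  then show "(LINT x|lebesgue. f x) = 0" "(LINT x|lebesgue. g x) = 0"
    by (simp_all add: complex_eq_iff)
qed

lemma cmod_vcheck: "(cmod (vcheck u))\<^sup>2 = (u $ 1)\<^sup>2 + (u $ 3)\<^sup>2"
  by (simp add: vcheck_def cmod_power2)

text \<open>Each equation of the tested system says that a component of w has a weak derivative
  which is polynomial in v and w. Its worst terms are |w|^2 times a bounded factor, so finite energy
  makes it locally integrable. Hence w has a continuous representative, which makes the right-hand
  side continuous and w continuously differentiable.\<close>

theorem TW_solution_imp_tw_profile:
  assumes energy: "v \<in> energy_space" and TW: "TW_solution lam c \<omega> v"
  obtains x m y x' m' y' where "tw_profile lam c \<omega> x m y x' m' y'"
    "AE t in lebesgue. v t = vector [x t, m t, y t]"
    "integrable lebesgue (\<lambda>t. (x t)\<^sup>2 + (y t)\<^sup>2 + (x' t)\<^sup>2 + (m' t)\<^sup>2 + (y' t)\<^sup>2)"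
proof -
  let ?I = "\<lambda>w \<phi> x. deriv \<phi> x *\<^sub>R vcheck (w x) + \<phi> x *\<^sub>R
           (\<i> * of_real c * (of_real (v x $ 2) * vcheck (w x) - of_real (w x $ 2) * vcheck (v x))
            - of_real ((cmod (vcheck (w x)))\<^sup>2 + \<bar>w x $ 2\<bar>\<^sup>2 + lam * (cmod (vcheck (v x)))\<^sup>2)
                * vcheck (v x)
            + of_real lam * vcheck (v x) + of_real \<omega> * of_real (v x $ 2) * vcheck (v x))"
  let ?J = "\<lambda>w \<phi> x. deriv \<phi> x * (w x $ 2) + \<phi> x *
           (c * inner_C (\<i> * vcheck (v x)) (vcheck (w x))
            - ((cmod (vcheck (w x)))\<^sup>2 + \<bar>w x $ 2\<bar>\<^sup>2 + lam * (cmod (vcheck (v x)))\<^sup>2) * (v x $ 2)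
            - \<omega> * (cmod (vcheck (v x)))\<^sup>2)"
  from TW obtain w where w: "has_weak_deriv v w"
    and TW1: "\<And>\<phi>. test_function \<phi> \<Longrightarrow> (LINT x|lebesgue. ?I w \<phi> x) = 0"
    and TW2: "\<And>\<phi>. test_function \<phi> \<Longrightarrow> (LINT x|lebesgue. ?J w \<phi> x) = 0"
    unfolding TW_solution_def by blast
  from energy obtain w0 where w0: "has_weak_deriv v w0" "square_integrable w0"
    and sphere: "AE x in lebesgue. v x \<in> sphere 0 1"
    and sq1: "square_integrable (\<lambda>x. v x $ 1)" and sq3: "square_integrable (\<lambda>x. v x $ 3)"
    by (auto simp: energy_space_def)
  define e where "e x = (w x $ 1)\<^sup>2 + (w x $ 2)\<^sup>2 + (w x $ 3)\<^sup>2" for x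
  have coord: "bounded_linear (\<lambda>u::real^3. u $ i)" for i
    by (rule bounded_linear_vec_nth)
  have vw: "has_weak_deriv (\<lambda>x. v x $ i) (\<lambda>x. w x $ i)" for i
    by (rule has_weak_deriv_bounded_linear[OF coord w])
  then have LI_v: "locally_integrable (\<lambda>x. v x $ i)" and LI_w: "locally_integrable (\<lambda>x. w x $ i)" for i
    by (auto simp: has_weak_deriv_def)
  note [measurable] = LI_v[THEN locally_integrable_measurable] LI_w[THEN locally_integrable_measurable]
  \<comment> \<open>Square integrability is known for \<open>w0\<close>, the derivative from the
    energy space, while the equation involves \<open>w\<close>; uniqueness of weak derivatives
    transfers it.\<close>
  have e_int: "integrable lebesgue e"
  proof -
    have "integrable lebesgue (\<lambda>x. (norm (w0 x))\<^sup>2)"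
      using w0(2) by (simp add: square_integrable_def)
    then show ?thesis
    proof (rule integrable_cong_AE_imp)
      show "e \<in> borel_measurable lebesgue"
        unfolding e_def[abs_def] by measurable
      show "AE x in lebesgue. (norm (w0 x))\<^sup>2 = e x"
        using weak_deriv_unique[OF w w0(1)] by eventually_elim (simp add: e_def norm_real3_power2)
    qed
  qed
  then have LI_e: "locally_integrable e"
    by (intro locally_integrableI integrable_real_mult_indicator[where 'a = real, simplified])
       (auto simp: integrable_real_mult_indicator mult.commute)
  have v_le: "AE x in lebesgue. \<bar>v x $ i\<bar> \<le> 1" for i
    using sphere
  proof eventually_elim
    case (elim x)
    then show ?case using component_le_norm_cart[of "v x" i] by simp
  qed
  have LI_mult: "locally_integrable (\<lambda>x. v x $ i * f x)" if "locally_integrable f" for f i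
    using that v_le by (intro locally_integrable_mult_bounded) auto
  \<comment> \<open>The right-hand sides of w' = F, written as sums of constant multiples of
    products. Each product stacks components of v, bounded by 1, on one locally integrable factor,
    so local integrability follows factor by factor.\<close>
  define F1 where "F1 v1 v2 v3 w1 w2 w3 = (-c) * (v2 * w3) + c * (v3 * w2)
    + (-1) * (v1 * (w1\<^sup>2 + w2\<^sup>2 + w3\<^sup>2)) + (- lam) * (v1 * (v1 * v1)) + (- lam) * (v1 * (v3 * v3))
    + lam * v1 + \<omega> * (v2 * v1)" for v1 v2 v3 w1 w2 w3 :: real
  define F3 where "F3 v1 v2 v3 w1 w2 w3 = c * (v2 * w1) + (- c) * (v1 * w2)
    + (-1) * (v3 * (w1\<^sup>2 + w2\<^sup>2 + w3\<^sup>2)) + (- lam) * (v3 * (v1 * v1)) + (- lam) * (v3 * (v3 * v3))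
    + lam * v3 + \<omega> * (v2 * v3)" for v1 v2 v3 w1 w2 w3 :: real
  define F2 where "F2 v1 v2 v3 w1 w2 w3 = c * (v1 * w3) + (- c) * (v3 * w1)
    + (-1) * (v2 * (w1\<^sup>2 + w2\<^sup>2 + w3\<^sup>2)) + (- lam) * (v2 * (v1 * v1)) + (- lam) * (v2 * (v3 * v3))
    + (- \<omega>) * (v1 * v1) + (- \<omega>) * (v3 * v3)" for v1 v2 v3 w1 w2 w3 :: real
  let ?F = "\<lambda>F x. F (v x $ 1) (v x $ 2) (v x $ 3) (w x $ 1) (w x $ 2) (w x $ 3) :: real"
  have LI_F: "locally_integrable (?F F1)" "locally_integrable (?F F2)" "locally_integrable (?F F3)"
    unfolding F1_def F2_def F3_def e_def[symmetric]
    by (intro locally_integrable_add locally_integrable_cmult LI_e LI_mult LI_v LI_w)+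
  let ?H = "\<lambda>\<phi> i F x. deriv \<phi> x *\<^sub>R (w x $ i) + \<phi> x *\<^sub>R ?F F x"
  have wF1: "has_weak_deriv (\<lambda>x. w x $ 1) (?F F1)" and wF3: "has_weak_deriv (\<lambda>x. w x $ 3) (?F F3)"
  proof -
    have "(LINT x|lebesgue. deriv \<phi> x *\<^sub>R (w x $ 1)) = - (LINT x|lebesgue. \<phi> x *\<^sub>R ?F F1 x) \<and>
      (LINT x|lebesgue. deriv \<phi> x *\<^sub>R (w x $ 3)) = - (LINT x|lebesgue. \<phi> x *\<^sub>R ?F F3 x)"
      if \<phi>: "test_function \<phi>" for \<phi>
    proof -
      have "?I w \<phi> x = Complex (?H \<phi> 1 F1 x) (?H \<phi> 3 F3 x)" for x
        unfolding complex_eq_iff cmod_vcheck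
        by (simp add: vcheck_def F1_def F3_def algebra_simps power2_eq_square)
      with TW1[OF \<phi>] have *: "(LINT x|lebesgue. Complex (?H \<phi> 1 F1 x) (?H \<phi> 3 F3 x)) = 0" by simp
      note i = integrable_test_function[OF \<phi>]
      show ?thesis
        using LINT_Complex_eq_0D[OF _ _ *] i(1)[OF LI_F(1)] i(1)[OF LI_F(3)] i(2)[OF LI_w[of 1]] i(2)[OF LI_w[of 3]]
        by (simp add: Bochner_Integration.integral_add eq_neg_iff_add_eq_0)
    qed
    then show "has_weak_deriv (\<lambda>x. w x $ 1) (?F F1)" "has_weak_deriv (\<lambda>x. w x $ 3) (?F F3)"
      unfolding has_weak_deriv_def using LI_w LI_F by blast+
  qed
  have wF2: "has_weak_deriv (\<lambda>x. w x $ 2) (?F F2)"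
  proof -
    have "(LINT x|lebesgue. deriv \<phi> x *\<^sub>R (w x $ 2)) = - (LINT x|lebesgue. \<phi> x *\<^sub>R ?F F2 x)"
      if \<phi>: "test_function \<phi>" for \<phi>
    proof -
      have eq: "?J w \<phi> x = ?H \<phi> 2 F2 x" for x
        unfolding cmod_vcheck
        by (simp add: vcheck_def inner_C_def F2_def algebra_simps power2_eq_square)
      show ?thesis
        using TW2[OF \<phi>, unfolded eq]
        using integrable_test_function(1)[OF \<phi> LI_F(2)] integrable_test_function(2)[OF \<phi> LI_w[of 2]]
        by (simp add: Bochner_Integration.integral_add eq_neg_iff_add_eq_0)
    qed
    then show ?thesis
      unfolding has_weak_deriv_def using LI_w LI_F by blast
  qed
  obtain x where x: "continuous_on UNIV x" "AE t in lebesgue. v t $ 1 = x t" "primitive x (\<lambda>t. w t $ 1)"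
    using weak_deriv_imp_primitive[OF vw] by blast
  obtain m where m: "continuous_on UNIV m" "AE t in lebesgue. v t $ 2 = m t" "primitive m (\<lambda>t. w t $ 2)"
    using weak_deriv_imp_primitive[OF vw] by blast
  obtain y where y: "continuous_on UNIV y" "AE t in lebesgue. v t $ 3 = y t" "primitive y (\<lambda>t. w t $ 3)"
    using weak_deriv_imp_primitive[OF vw] by blast
  obtain x' where x': "continuous_on UNIV x'" "AE t in lebesgue. w t $ 1 = x' t" "primitive x' (?F F1)"
    using weak_deriv_imp_primitive[OF wF1] by blast
  obtain m' where m': "continuous_on UNIV m'" "AE t in lebesgue. w t $ 2 = m' t" "primitive m' (?F F2)"
    using weak_deriv_imp_primitive[OF wF2] by blast
  obtain y' where y': "continuous_on UNIV y'" "AE t in lebesgue. w t $ 3 = y' t" "primitive y' (?F F3)"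
    using weak_deriv_imp_primitive[OF wF3] by blast
  note cont = x(1) m(1) y(1) x'(1) m'(1) y'(1)
  let ?G = "\<lambda>F t. F (x t) (m t) (y t) (x' t) (m' t) (y' t) :: real"
  have AE_F: "AE t in lebesgue. ?F F t = ?G F t" for F
    using x(2) m(2) y(2) x'(2) m'(2) y'(2) by eventually_elim simp
  note der = primitive_has_vector_derivative[where 'a = real,
      unfolded has_real_derivative_iff_has_vector_derivative[symmetric]]
  have d1: "(x has_real_derivative x' t) (at t)" "(m has_real_derivative m' t) (at t)"
    "(y has_real_derivative y' t) (at t)" for t
    using der[OF x(3) x'(2,1)] der[OF m(3) m'(2,1)] der[OF y(3) y'(2,1)] by auto
  have d2: "(x' has_real_derivative ?G F1 t) (at t)" "(m' has_real_derivative ?G F2 t) (at t)"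
    "(y' has_real_derivative ?G F3 t) (at t)" for t
    by (rule der[OF x'(3) AE_F] der[OF m'(3) AE_F] der[OF y'(3) AE_F];
        unfold F1_def F2_def F3_def; intro continuous_intros cont)+
  have AE_sphere: "AE t in lebesgue. (x t)\<^sup>2 + (m t)\<^sup>2 + (y t)\<^sup>2 = 1"
    using x(2) m(2) y(2) sphere
  proof eventually_elim
    case (elim t)
    then show ?case using norm_real3_power2[of "v t"] by simp
  qed
  have sphere': "(x t)\<^sup>2 + (m t)\<^sup>2 + (y t)\<^sup>2 = 1" for t
    by (rule continuous_AE_eq_imp_eq[OF _ _ AE_sphere]) (intro continuous_intros cont)+
  let ?e = "\<lambda>t. (x' t)\<^sup>2 + (m' t)\<^sup>2 + (y' t)\<^sup>2 + lam * ((x t)\<^sup>2 + (y t)\<^sup>2)"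
  show thesis
  proof (rule that[of x m y x' m' y'])
    show "tw_profile lam c \<omega> x m y x' m' y'"
    proof (rule tw_profileI[OF d1 sphere' refl])
      fix t
      show "(x' has_real_derivative (lam + \<omega> * m t - ?e t) * x t - c * (m t * y' t - m' t * y t)) (at t)"
        using d2(1)[of t] by (rule DERIV_cong) (simp add: F1_def algebra_simps power2_eq_square)
      show "(m' has_real_derivative c * (x t * y' t - y t * x' t) - ?e t * m t - \<omega> * ((x t)\<^sup>2 + (y t)\<^sup>2)) (at t)"
        using d2(2)[of t] by (rule DERIV_cong) (simp add: F2_def algebra_simps power2_eq_square)
      show "(y' has_real_derivative (lam + \<omega> * m t - ?e t) * y t + c * (m t * x' t - m' t * x t)) (at t)"
        using d2(3)[of t] by (rule DERIV_cong) (simp add: F3_def algebra_simps power2_eq_square)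
    qed
    show "AE t in lebesgue. v t = vector [x t, m t, y t]"
      using x(2) m(2) y(2) by eventually_elim (simp add: vec_eq_iff forall_3)
    have "integrable lebesgue (\<lambda>t. (v t $ 1)\<^sup>2 + (v t $ 3)\<^sup>2 + e t)"
      using sq1 sq3 e_int by (auto simp: square_integrable_def)
    then show "integrable lebesgue (\<lambda>t. (x t)\<^sup>2 + (y t)\<^sup>2 + (x' t)\<^sup>2 + (m' t)\<^sup>2 + (y' t)\<^sup>2)"
    proof (rule integrable_cong_AE_imp)
      show "(\<lambda>t. (x t)\<^sup>2 + (y t)\<^sup>2 + (x' t)\<^sup>2 + (m' t)\<^sup>2 + (y' t)\<^sup>2) \<in> borel_measurable lebesgue"
        by (intro measurable_completion)
           (auto intro!: borel_measurable_continuous_onI continuous_intros cont)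
      show "AE t in lebesgue. (v t $ 1)\<^sup>2 + (v t $ 3)\<^sup>2 + e t
        = (x t)\<^sup>2 + (y t)\<^sup>2 + (x' t)\<^sup>2 + (m' t)\<^sup>2 + (y' t)\<^sup>2"
        using x(2) y(2) x'(2) m'(2) y'(2) by eventually_elim (simp add: e_def)
    qed
  qed
qed

section \<open>From classical profiles back to weak solutions\<close>

lemma has_weak_deriv_continuous:
  fixes f f' :: "real \<Rightarrow> 'a::euclidean_space"
  assumes d: "\<And>t. (f has_vector_derivative f' t) (at t)" and cont: "continuous_on UNIV f'"
  shows "has_weak_deriv f f'"
proof -
  have "continuous_on UNIV f"
    using has_vector_derivative_continuous[OF d] by (simp add: continuous_at_imp_continuous_on)
  then have LI: "locally_integrable f" "locally_integrable f'"
    using cont by (simp_all add: locally_integrable_continuous)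
  have "(LINT x|lebesgue. deriv \<phi> x *\<^sub>R f x) = - (LINT x|lebesgue. \<phi> x *\<^sub>R f' x)"
    if \<phi>: "test_function \<phi>" for \<phi>
  proof -
    obtain R where R: "R > 0" "\<And>x. x \<notin> {-R..R} \<Longrightarrow> \<phi> x = 0" "\<And>x. x \<notin> {-R..R} \<Longrightarrow> deriv \<phi> x = 0"
      and d\<phi>: "\<And>x. (\<phi> has_real_derivative deriv \<phi> x) (at x)"
      by (rule test_function_props[OF \<phi>]) (rule that)
    define h where "h x = \<phi> x *\<^sub>R f' x + deriv \<phi> x *\<^sub>R f x" for x
    have "((\<lambda>x. \<phi> x *\<^sub>R f x) has_vector_derivative h x) (at x)" for x
      unfolding h_def by (rule has_vector_derivative_scaleR[OF d\<phi> d])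
    \<comment> \<open>The interval reaches to R + 1 because \<phi> is known to vanish only outside
      {-R..R}; at these end points the product of \<phi> and f is 0.\<close>
    then have "(h has_integral \<phi> (R + 1) *\<^sub>R f (R + 1) - \<phi> (- (R + 1)) *\<^sub>R f (- (R + 1))) {- (R + 1)..R + 1}"
      using R(1) by (intro fundamental_theorem_of_calculus) (auto intro: has_vector_derivative_at_within)
    then have 0: "(h has_integral 0) {- (R + 1)..R + 1}"
      by (simp add: R(2))
    note i = integrable_test_function(1)[OF \<phi> LI(2)] integrable_test_function(2)[OF \<phi> LI(1)]
    have eq: "(\<lambda>x. indicator {- (R + 1)..R + 1} x *\<^sub>R h x) = h"
      using R(2,3) by (intro ext) (auto simp: h_def indicator_def)
    have "integrable lebesgue h"
      unfolding h_def[abs_def] using i by (rule Bochner_Integration.integrable_add)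
    then have "h absolutely_integrable_on {- (R + 1)..R + 1}"
      unfolding set_integrable_def eq .
    from set_lebesgue_integral_eq_integral(2)[OF this] have "(LINT x|lebesgue. h x) = 0"
      unfolding set_lebesgue_integral_def eq integral_unique[OF 0] .
    then have "(LINT x|lebesgue. \<phi> x *\<^sub>R f' x) + (LINT x|lebesgue. deriv \<phi> x *\<^sub>R f x) = 0"
      unfolding h_def Bochner_Integration.integral_add[OF i] .
    then show ?thesis
      by (metis add.commute eq_neg_iff_add_eq_0)
  qed
  with LI show ?thesis by (simp add: has_weak_deriv_def)
qed

lemma LINT_AE_cong:
  fixes f g :: "real \<Rightarrow> 'a::euclidean_space"
  assumes f: "f \<in> borel_measurable lebesgue" and eq: "AE x in lebesgue. f x = g x"
  shows "(LINT x|lebesgue. g x) = (LINT x|lebesgue. f x)"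
proof (rule integral_cong_AE)
  show "g \<in> borel_measurable lebesgue" using borel_measurable_AE[OF f eq] .
  show "AE x in lebesgue. g x = f x" using eq by eventually_elim simp
qed fact

lemma borel_measurable_lebesgue_continuous:
  fixes f :: "real \<Rightarrow> 'a::euclidean_space"
  shows "continuous_on UNIV f \<Longrightarrow> f \<in> borel_measurable lebesgue"
  by (intro measurable_completion) (auto intro: borel_measurable_continuous_onI)

lemma has_weak_deriv_AE_cong:
  fixes f g :: "real \<Rightarrow> 'a::euclidean_space"
  assumes "has_weak_deriv f f'" and eq: "AE x in lebesgue. f x = g x"
  shows "has_weak_deriv g f'"
proof -
  from assms have f: "locally_integrable f" by (simp add: has_weak_deriv_def)
  have "(LINT x|lebesgue. deriv \<phi> x *\<^sub>R g x) = (LINT x|lebesgue. deriv \<phi> x *\<^sub>R f x)"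
    if \<phi>: "test_function \<phi>" for \<phi>
  proof (rule LINT_AE_cong)
    show "AE x in lebesgue. deriv \<phi> x *\<^sub>R f x = deriv \<phi> x *\<^sub>R g x"
      using eq by eventually_elim simp
  qed (rule borel_measurable_integrable[OF integrable_test_function(2)[OF \<phi> f]])
  with assms(1) locally_integrable_AE_cong[OF f eq] show ?thesis
    by (simp add: has_weak_deriv_def)
qed

text \<open>Integration by parts: the second derivatives are continuous, hence they are the weak
  derivatives of x', m', y', and the tested system is this statement with the continuous
  representative replaced by v almost everywhere.\<close>

theorem tw_profile_imp_TW_solution:
  assumes prof: "tw_profile lam c \<omega> x m y x' m' y'"
    and v: "AE t in lebesgue. v t = vector [x t, m t, y t]"
    and int: "integrable lebesgue (\<lambda>t. (x t)\<^sup>2 + (y t)\<^sup>2 + (x' t)\<^sup>2 + (m' t)\<^sup>2 + (y' t)\<^sup>2)"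
  shows "v \<in> energy_space" "TW_solution lam c \<omega> v"
proof -
  define V where "V t = (vector [x t, m t, y t] :: real^3)" for t
  define W where "W t = (vector [x' t, m' t, y' t] :: real^3)" for t
  define e where "e t = (x' t)\<^sup>2 + (m' t)\<^sup>2 + (y' t)\<^sup>2 + lam * ((x t)\<^sup>2 + (y t)\<^sup>2)" for t
  define x'' where "x'' t = (lam + \<omega> * m t - e t) * x t - c * (m t * y' t - m' t * y t)" for t
  define m'' where "m'' t = c * (x t * y' t - y t * x' t) - e t * m t - \<omega> * ((x t)\<^sup>2 + (y t)\<^sup>2)" for t
  define y'' where "y'' t = (lam + \<omega> * m t - e t) * y t + c * (m t * x' t - m' t * x t)" for t
  have d: "(x has_real_derivative x' t) (at t)" "(m has_real_derivative m' t) (at t)"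
    "(y has_real_derivative y' t) (at t)" "(x t)\<^sup>2 + (m t)\<^sup>2 + (y t)\<^sup>2 = 1"
    "(x' has_real_derivative x'' t) (at t)" "(m' has_real_derivative m'' t) (at t)"
    "(y' has_real_derivative y'' t) (at t)" for t
    using prof by (auto simp: tw_profile_def Let_def x''_def m''_def y''_def e_def)
  have cont: "continuous_on UNIV x" "continuous_on UNIV m" "continuous_on UNIV y"
    "continuous_on UNIV x'" "continuous_on UNIV m'" "continuous_on UNIV y'"
    using d by (auto intro!: continuous_at_imp_continuous_on DERIV_isCont)
  have cont_e: "continuous_on UNIV e"
    unfolding e_def by (intro continuous_intros cont)
  have cont'': "continuous_on UNIV x''" "continuous_on UNIV m''" "continuous_on UNIV y''"
    unfolding x''_def m''_def y''_def by (intro continuous_intros cont cont_e)+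
  have V_eq: "V = (\<lambda>t. x t *\<^sub>R axis 1 1 + m t *\<^sub>R axis 2 1 + y t *\<^sub>R axis 3 1)"
    by (rule ext) (simp add: V_def vec_eq_iff forall_3 axis_def)
  have W_eq: "W = (\<lambda>t. x' t *\<^sub>R axis 1 1 + m' t *\<^sub>R axis 2 1 + y' t *\<^sub>R axis 3 1)"
    by (rule ext) (simp add: W_def vec_eq_iff forall_3 axis_def)
  have VW: "(V has_vector_derivative W t) (at t)" for t
    unfolding V_eq W_eq using d(1,2,3)[of t]
    by (auto intro!: derivative_eq_intros simp: has_real_derivative_iff_has_vector_derivative)
  have contW: "continuous_on UNIV W"
    unfolding W_eq by (intro continuous_intros cont)
  have vV: "AE t in lebesgue. V t = v t"
    using v by eventually_elim (simp add: V_def)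
  have weak: "has_weak_deriv v W"
    by (rule has_weak_deriv_AE_cong[OF has_weak_deriv_continuous vV]) (rule VW contW)+
  have normV: "norm (V t) = 1" for t
  proof -
    have "(norm (V t))\<^sup>2 = 1" using d(4)[of t] by (simp add: norm_real3_power2 V_def)
    then show ?thesis using norm_ge_zero[of "V t"] by (auto simp: power2_eq_1_iff)
  qed
  have sq: "square_integrable f" if f: "continuous_on UNIV g" "AE t in lebesgue. g t = f t"
    and le: "\<And>t. (norm (g t))\<^sup>2 \<le> (x t)\<^sup>2 + (y t)\<^sup>2 + (x' t)\<^sup>2 + (m' t)\<^sup>2 + (y' t)\<^sup>2"
    for f g :: "real \<Rightarrow> 'b::euclidean_space"
    unfolding square_integrable_def
  proof
    note g = borel_measurable_lebesgue_continuous[OF f(1)]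
    show fm: "f \<in> borel_measurable lebesgue"
      using borel_measurable_AE[OF g f(2)] .
    have "integrable lebesgue (\<lambda>t. (norm (g t))\<^sup>2)"
      by (rule Bochner_Integration.integrable_bound[OF int])
         (use g le in \<open>auto intro!: borel_measurable_power borel_measurable_norm order_trans[OF le]\<close>)
    then show "integrable lebesgue (\<lambda>t. (norm (f t))\<^sup>2)"
    proof (rule integrable_cong_AE_imp)
      show "(\<lambda>t. (norm (f t))\<^sup>2) \<in> borel_measurable lebesgue"
        using fm by measurable
      show "AE t in lebesgue. (norm (g t))\<^sup>2 = (norm (f t))\<^sup>2"
        using f(2) by eventually_elim simp
    qed
  qed
  show "v \<in> energy_space"
    unfolding energy_space_def
  proof (intro CollectI conjI exI[of _ W] weak)
    show "locally_integrable v"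
      using weak by (simp add: has_weak_deriv_def)
    show "AE x in lebesgue. v x \<in> sphere 0 1"
      using vV by eventually_elim (metis normV dist_0_norm mem_sphere)
    show "square_integrable W"
      by (rule sq[OF contW]) (auto simp: norm_real3_power2 W_def)
    show "square_integrable (\<lambda>t. v t $ 1)"
    proof (rule sq[OF cont(1)])
      show "AE t in lebesgue. x t = v t $ 1" using v by eventually_elim simp
    qed (auto intro: add_nonneg_nonneg)
    show "square_integrable (\<lambda>t. v t $ 3)"
    proof (rule sq[OF cont(3)])
      show "AE t in lebesgue. y t = v t $ 3" using v by eventually_elim simp
    qed (auto intro: add_nonneg_nonneg)
  qed
  show "TW_solution lam c \<omega> v"
    unfolding TW_solution_def
  proof (intro exI[of _ W] conjI allI impI weak)
    fix \<phi> assume \<phi>: "test_function \<phi>"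
    obtain c\<phi>: "continuous_on UNIV \<phi>" "continuous_on UNIV (deriv \<phi>)"
      by (rule test_function_props[OF \<phi>]) (rule that)
    have "((\<lambda>t. of_real (x' t) + \<i> * of_real (y' t)) has_vector_derivative
        (of_real (x'' t) + \<i> * of_real (y'' t))) (at t)" for t
      using d(5,7)[of t]
      by (auto intro!: derivative_eq_intros has_vector_derivative_of_real
          simp: has_real_derivative_iff_has_vector_derivative)
    then have "((\<lambda>t. Complex (x' t) (y' t)) has_vector_derivative Complex (x'' t) (y'' t)) (at t)" for t
      by (simp add: Complex_eq)
    moreover have ccont: "continuous_on UNIV (\<lambda>t. Complex (x'' t) (y'' t))"
      "continuous_on UNIV (\<lambda>t. Complex (x' t) (y' t))"
      unfolding Complex_eq by (intro continuous_intros cont cont'')+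
    ultimately have weakz: "has_weak_deriv (\<lambda>t. Complex (x' t) (y' t)) (\<lambda>t. Complex (x'' t) (y'' t))"
      by (intro has_weak_deriv_continuous)
    then have LI: "locally_integrable (\<lambda>t. Complex (x' t) (y' t))"
      "locally_integrable (\<lambda>t. Complex (x'' t) (y'' t))"
      by (auto simp: has_weak_deriv_def)
    let ?H = "\<lambda>t. deriv \<phi> t *\<^sub>R Complex (x' t) (y' t) + \<phi> t *\<^sub>R Complex (x'' t) (y'' t)"
    have H0: "(LINT t|lebesgue. ?H t) = 0"
      using weakz \<phi> integrable_test_function(2)[OF \<phi> LI(1)] integrable_test_function(1)[OF \<phi> LI(2)]
      by (simp add: has_weak_deriv_def)
    let ?I = "\<lambda>x. deriv \<phi> x *\<^sub>R vcheck (W x) + \<phi> x *\<^sub>R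
           (\<i> * of_real c * (of_real (v x $ 2) * vcheck (W x) - of_real (W x $ 2) * vcheck (v x))
            - of_real ((cmod (vcheck (W x)))\<^sup>2 + \<bar>W x $ 2\<bar>\<^sup>2 + lam * (cmod (vcheck (v x)))\<^sup>2)
                * vcheck (v x)
            + of_real lam * vcheck (v x) + of_real \<omega> * of_real (v x $ 2) * vcheck (v x))"
    have "(LINT x|lebesgue. ?I x)
      = (LINT t|lebesgue. ?H t)"
    proof (rule LINT_AE_cong)
      show "?H \<in> borel_measurable lebesgue"
        by (intro borel_measurable_lebesgue_continuous continuous_intros c\<phi> ccont)
      show "AE x in lebesgue. ?H x = ?I x"
        using vV
      proof eventually_elim
        case (elim t)
        show ?case
          unfolding elim[symmetric] complex_eq_iff cmod_vcheck
          by (simp add: vcheck_def V_def W_def x''_def y''_def e_def algebra_simps power2_eq_square)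
      qed
    qed
    then show "(LINT x|lebesgue. ?I x) = 0"
      using H0 by simp
    have weakm: "has_weak_deriv m' m''"
      using d(6) cont'' by (intro has_weak_deriv_continuous)
        (auto simp: has_real_derivative_iff_has_vector_derivative)
    then have LI: "locally_integrable m'" "locally_integrable m''"
      by (auto simp: has_weak_deriv_def)
    let ?K = "\<lambda>t. deriv \<phi> t *\<^sub>R m' t + \<phi> t *\<^sub>R m'' t"
    have K0: "(LINT t|lebesgue. ?K t) = 0"
      using weakm \<phi> integrable_test_function(2)[OF \<phi> LI(1)] integrable_test_function(1)[OF \<phi> LI(2)]
      by (simp add: has_weak_deriv_def)
    let ?J = "\<lambda>x. deriv \<phi> x * (W x $ 2) + \<phi> x *
           (c * inner_C (\<i> * vcheck (v x)) (vcheck (W x))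
            - ((cmod (vcheck (W x)))\<^sup>2 + \<bar>W x $ 2\<bar>\<^sup>2 + lam * (cmod (vcheck (v x)))\<^sup>2) * (v x $ 2)
            - \<omega> * (cmod (vcheck (v x)))\<^sup>2)"
    have "(LINT x|lebesgue. ?J x) = (LINT t|lebesgue. ?K t)"
    proof (rule LINT_AE_cong)
      show "?K \<in> borel_measurable lebesgue"
        by (intro borel_measurable_lebesgue_continuous continuous_intros c\<phi> cont cont'')
      show "AE x in lebesgue. ?K x = ?J x"
        using vV
      proof eventually_elim
        case (elim t)
        show ?case
          unfolding elim[symmetric] cmod_vcheck
          by (simp add: vcheck_def inner_C_def V_def W_def m''_def e_def algebra_simps power2_eq_square)
      qed
    qed
    then show "(LINT x|lebesgue. ?J x) = 0"
      using K0 by simp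
  qed
qed

section \<open>First integrals and uniqueness\<close>

lemma tw_profileD:
  assumes "tw_profile lam c \<omega> x m y x' m' y'"
  defines "e t \<equiv> (x' t)\<^sup>2 + (m' t)\<^sup>2 + (y' t)\<^sup>2 + lam * ((x t)\<^sup>2 + (y t)\<^sup>2)"
  shows "(x has_real_derivative x' t) (at t)" "(m has_real_derivative m' t) (at t)"
    "(y has_real_derivative y' t) (at t)"
    "(x' has_real_derivative (lam + \<omega> * m t - e t) * x t - c * (m t * y' t - m' t * y t)) (at t)"
    "(m' has_real_derivative c * (x t * y' t - y t * x' t) - e t * m t - \<omega> * ((x t)\<^sup>2 + (y t)\<^sup>2)) (at t)"
    "(y' has_real_derivative (lam + \<omega> * m t - e t) * y t + c * (m t * x' t - m' t * x t)) (at t)"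
    "(x t)\<^sup>2 + (m t)\<^sup>2 + (y t)\<^sup>2 = 1"
  using assms by (auto simp: tw_profile_def Let_def e_def)

lemma tw_profile_m_bounds:
  assumes "tw_profile lam c \<omega> x m y x' m' y'"
  shows "\<bar>m t\<bar> \<le> 1" "(m t)\<^sup>2 \<le> 1"
proof -
  show "(m t)\<^sup>2 \<le> 1" using tw_profileD(7)[OF assms, of t] by (smt (verit) zero_le_power2)
  then show "\<bar>m t\<bar> \<le> 1" by (simp add: abs_square_le_1)
qed

lemma tw_profile_tangent:
  assumes prof: "tw_profile lam c \<omega> x m y x' m' y'"
  shows "x t * x' t + m t * m' t + y t * y' t = 0"
proof -
  note d = tw_profileD[OF prof]
  have "((\<lambda>t. (x t)\<^sup>2 + (m t)\<^sup>2 + (y t)\<^sup>2) has_real_derivative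
    2 * (x t * x' t + m t * m' t + y t * y' t)) (at t)"
    by (rule derivative_eq_intros d refl)+ (simp add: algebra_simps)
  moreover have "((\<lambda>t. (x t)\<^sup>2 + (m t)\<^sup>2 + (y t)\<^sup>2) has_real_derivative 0) (at t)"
    unfolding d(7) by simp
  ultimately show ?thesis using DERIV_unique by fastforce
qed

text \<open>The quantities conserved by translation and by phase invariance. In the derivative of
  the first, the multiplier \<open>e\<close> cancels because v' is tangent to the sphere, and the
  terms with c cancel identically. In the derivative of x y' - y x', the coefficient common to the
  x- and y-equations cancels by antisymmetry, and the terms with c add up to -c m'.\<close>

lemma tw_profile_constants:
  assumes prof: "tw_profile lam c \<omega> x m y x' m' y'"
  shows "\<exists>E. \<forall>t. (x' t)\<^sup>2 + (m' t)\<^sup>2 + (y' t)\<^sup>2 - lam * (1 - (m t)\<^sup>2) + 2 * \<omega> * m t = E"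
    and "\<exists>J. \<forall>t. x t * y' t - y t * x' t + c * m t = J"
proof -
  note d = tw_profileD[OF prof]
  have S: "(x t)\<^sup>2 + (y t)\<^sup>2 = 1 - (m t)\<^sup>2" for t
    using d(7)[of t] by simp
  have T: "x t * x' t + y t * y' t = - (m t * m' t)" for t
    using tw_profile_tangent[OF prof, of t] by simp
  have "((\<lambda>t. (x' t)\<^sup>2 + (m' t)\<^sup>2 + (y' t)\<^sup>2 - lam * (1 - (m t)\<^sup>2) + 2 * \<omega> * m t)
    has_real_derivative 0) (at t)" for t
  proof -
    define e where "e = (x' t)\<^sup>2 + (m' t)\<^sup>2 + (y' t)\<^sup>2 + lam * ((x t)\<^sup>2 + (y t)\<^sup>2)"
    show ?thesis
    proof ((rule derivative_eq_intros d refl)+, fold e_def)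
      have "2 * ((lam + \<omega> * m t - e) * (x t * x' t + y t * y' t) - e * (m t * m' t)
        - \<omega> * m' t * ((x t)\<^sup>2 + (y t)\<^sup>2) + lam * m t * m' t + \<omega> * m' t) = 0"
        unfolding S T by (simp add: algebra_simps power2_eq_square)
      then show "real 2 * (((lam + \<omega> * m t - e) * x t - c * (m t * y' t - m' t * y t)) * x' t ^ (2 - Suc 0)) +
        real 2 * ((c * (x t * y' t - y t * x' t) - e * m t - \<omega> * ((x t)\<^sup>2 + (y t)\<^sup>2)) * m' t ^ (2 - Suc 0)) +
        real 2 * (((lam + \<omega> * m t - e) * y t + c * (m t * x' t - m' t * x t)) * y' t ^ (2 - Suc 0)) -
        (0 * (1 - (m t)\<^sup>2) + (0 - real 2 * (m' t * m t ^ (2 - Suc 0))) * lam) +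
        (0 * m t + m' t * (2 * \<omega>)) = 0"
        by (simp add: algebra_simps)
    qed
  qed
  then show "\<exists>E. \<forall>t. (x' t)\<^sup>2 + (m' t)\<^sup>2 + (y' t)\<^sup>2 - lam * (1 - (m t)\<^sup>2) + 2 * \<omega> * m t = E"
    using DERIV_isconst_all by blast
  have "((\<lambda>t. x t * y' t - y t * x' t + c * m t) has_real_derivative 0) (at t)" for t
  proof -
    define e where "e = (x' t)\<^sup>2 + (m' t)\<^sup>2 + (y' t)\<^sup>2 + lam * ((x t)\<^sup>2 + (y t)\<^sup>2)"
    have "((\<lambda>t. x t * y' t - y t * x' t + c * m t) has_real_derivative
      (x' t * y' t + ((lam + \<omega> * m t - e) * y t + c * (m t * x' t - m' t * x t)) * x t
      - (y' t * x' t + ((lam + \<omega> * m t - e) * x t - c * (m t * y' t - m' t * y t)) * y t) + c * m' t)) (at t)"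
      unfolding e_def by (rule derivative_eq_intros d refl)+ simp
    moreover have "(x' t * y' t + ((lam + \<omega> * m t - e) * y t + c * (m t * x' t - m' t * x t)) * x t
      - (y' t * x' t + ((lam + \<omega> * m t - e) * x t - c * (m t * y' t - m' t * y t)) * y t) + c * m' t)
      = c * (m t * (x t * x' t + y t * y' t) - m' t * ((x t)\<^sup>2 + (y t)\<^sup>2) + m' t)"
      by (simp add: algebra_simps power2_eq_square)
    moreover have "\<dots> = 0"
      unfolding S T by (simp add: algebra_simps power2_eq_square)
    ultimately show ?thesis by simp
  qed
  then show "\<exists>J. \<forall>t. x t * y' t - y t * x' t + c * m t = J"
    using DERIV_isconst_all by blast
qed

definition first_integrals :: "real \<Rightarrow> real \<Rightarrow> real \<Rightarrow> real \<Rightarrow> real_function \<Rightarrow> real_function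
    \<Rightarrow> real_function \<Rightarrow> real_function \<Rightarrow> real_function \<Rightarrow> real_function \<Rightarrow> bool" where
  "first_integrals lam c \<omega> \<delta> x m y x' m' y' \<longleftrightarrow> (\<forall>t.
     (x' t)\<^sup>2 + (m' t)\<^sup>2 + (y' t)\<^sup>2 = lam * (1 - (m t)\<^sup>2) + 2 * \<omega> * (\<delta> - m t) \<and>
     x t * y' t - y t * x' t = c * (\<delta> - m t))"

text \<open>Integrability does not make Q tend to 0; it only excludes a positive lower bound on a
  half-line. Arbitrarily late points with small Q are enough to evaluate conserved
  quantities.\<close>

lemma integrable_small_at_top:
  fixes Q :: "real \<Rightarrow> real"
  assumes int: "integrable lebesgue Q" and nn: "\<And>t. 0 \<le> Q t" and e: "0 < e"
  shows "\<exists>t\<ge>a. Q t < e"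
proof (rule ccontr)
  assume "\<not> ?thesis"
  then have ge: "e \<le> Q t" if "a \<le> t" for t using that by force
  \<comment> \<open>Chosen so that e L exceeds the integral of Q by e.\<close>
  define L where "L = (LINT t|lebesgue. Q t) / e + 1"
  have "0 \<le> (LINT t|lebesgue. Q t)" using nn by simp
  then have L: "0 \<le> L" using e by (simp add: L_def)
  have "(LINT t|lebesgue. e * indicator {a..a + L} t) \<le> (LINT t|lebesgue. Q t)"
  proof (rule integral_mono[OF _ int])
    show "integrable lebesgue (\<lambda>t. e * indicator {a..a + L} t)"
      by (intro integrable_mult_right integrable_real_indicator) (auto simp: emeasure_lborel_Icc_eq)
    show "e * indicator {a..a + L} t \<le> Q t" for t
      using ge[of t] nn[of t] by (auto simp: indicator_def)
  qed
  also have "(LINT t|lebesgue. e * indicator {a..a + L} t) = e * L"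
    using L by simp
  also have "e * L = (LINT t|lebesgue. Q t) + e" using e by (simp add: L_def distrib_left)
  finally show False using e by simp
qed

lemma abs_le_all_pos_mult_imp_zero:
  fixes a K :: real
  assumes "\<And>e. 0 < e \<Longrightarrow> e < 1 \<Longrightarrow> \<bar>a\<bar> \<le> K * e"
  shows "a = 0"
proof (rule ccontr)
  assume a: "a \<noteq> 0"
  define e where "e = min (1 / 2) (\<bar>a\<bar> / (2 * (\<bar>K\<bar> + 1)))"
  have e: "0 < e" "e < 1" using a by (auto simp: e_def)
  have "K * e \<le> \<bar>K\<bar> * (\<bar>a\<bar> / (2 * (\<bar>K\<bar> + 1)))"
    using e by (intro mult_mono) (auto simp: e_def)
  also have "\<dots> < \<bar>a\<bar>"
    using a by (auto simp: field_simps) (smt (verit) mult_nonneg_nonneg zero_less_abs_iff)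
  finally show False using assms[OF e] by simp
qed

text \<open>Small values of the energy integrand force m close to 1 or to -1. One of the two signs
  occurs at arbitrarily late times with arbitrarily small integrand, and \<delta> is such a sign.
  Only t tending to +infinity is used: for the static profile m tends to -\<delta> in the other
  direction.\<close>

theorem tw_profile_first_integrals:
  assumes prof: "tw_profile lam c \<omega> x m y x' m' y'" and lam: "lam > 0"
    and int: "integrable lebesgue (\<lambda>t. (x t)\<^sup>2 + (y t)\<^sup>2 + (x' t)\<^sup>2 + (m' t)\<^sup>2 + (y' t)\<^sup>2)"
  obtains \<delta> where "\<delta> \<in> {1, -1}" "first_integrals lam c \<omega> \<delta> x m y x' m' y'"
    "\<And>e a. 0 < e \<Longrightarrow> \<exists>t\<ge>a. 1 - \<delta> * m t < e"
proof -
  note d = tw_profileD[OF prof]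
  define Q where "Q t = (x t)\<^sup>2 + (y t)\<^sup>2 + (x' t)\<^sup>2 + (m' t)\<^sup>2 + (y' t)\<^sup>2" for t
  have small: "\<exists>t\<ge>a. Q t < e" if "0 < e" for a e
    by (rule integrable_small_at_top[OF _ _ that]) (use int in \<open>auto simp: Q_def[abs_def]\<close>)
  note m1 = tw_profile_m_bounds(1)[OF prof]
  have "\<exists>\<delta>\<in>{1, -1}. \<forall>e>0. \<forall>a. \<exists>t\<ge>a. Q t < e \<and> 0 \<le> \<delta> * m t"
  proof (rule ccontr)
    assume "\<not> ?thesis"
    then obtain e1 a1 e2 a2 where *: "e1 > 0" "e2 > 0"
      "\<And>t. a1 \<le> t \<Longrightarrow> Q t < e1 \<Longrightarrow> \<not> 0 \<le> 1 * m t"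
      "\<And>t. a2 \<le> t \<Longrightarrow> Q t < e2 \<Longrightarrow> \<not> 0 \<le> -1 * m t"
      unfolding bex_simps by blast
    obtain t where "max a1 a2 \<le> t" "Q t < min e1 e2"
      using small[of "min e1 e2" "max a1 a2"] *(1,2) by auto
    then show False using *(3)[of t] *(4)[of t] by auto
  qed
  then obtain \<delta> where \<delta>: "\<delta> \<in> {1, -1}"
    and sel: "\<And>e a. 0 < e \<Longrightarrow> \<exists>t\<ge>a. Q t < e \<and> 0 \<le> \<delta> * m t" by blast
  \<comment> \<open>For 0 \<le> \<delta> m \<le> 1, the quantity 1 - \<delta> m is at most 1 - m^2 =
    x^2 + y^2.\<close>
  have near: "1 - \<delta> * m t \<le> Q t" if "0 \<le> \<delta> * m t" for t
  proof -
    have "\<delta> * m t \<le> 1" using m1[of t] \<delta> by auto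
    then have "(\<delta> * m t) * (\<delta> * m t) \<le> \<delta> * m t"
      using that by (simp add: mult_left_le)
    then have "(m t)\<^sup>2 \<le> \<delta> * m t" using \<delta> by (auto simp: power2_eq_square)
    then show ?thesis
      unfolding Q_def using d(7)[of t] by (smt (verit) zero_le_power2)
  qed
  have sel': "\<exists>t. Q t < e \<and> \<bar>m t - \<delta>\<bar> \<le> e" if e: "0 < e" for e
  proof -
    obtain t where t: "Q t < e" "0 \<le> \<delta> * m t" using sel[OF e] by blast
    moreover have "\<bar>m t - \<delta>\<bar> = 1 - \<delta> * m t" using m1[of t] \<delta> by auto
    ultimately show ?thesis using near[of t] by force
  qed
  obtain E where E: "\<And>t. (x' t)\<^sup>2 + (m' t)\<^sup>2 + (y' t)\<^sup>2 - lam * (1 - (m t)\<^sup>2) + 2 * \<omega> * m t = E"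
    using tw_profile_constants(1)[OF prof] by blast
  obtain J where J: "\<And>t. x t * y' t - y t * x' t + c * m t = J"
    using tw_profile_constants(2)[OF prof] by blast
  have "E - 2 * \<omega> * \<delta> = 0"
  proof (rule abs_le_all_pos_mult_imp_zero)
    fix e :: real assume "0 < e" "e < 1"
    obtain t where t: "Q t < e" and m\<delta>: "\<bar>m t - \<delta>\<bar> \<le> e" using sel'[OF \<open>0 < e\<close>] by blast
    have "E - 2 * \<omega> * \<delta> = (x' t)\<^sup>2 + (m' t)\<^sup>2 + (y' t)\<^sup>2 - lam * (1 - (m t)\<^sup>2) + 2 * \<omega> * (m t - \<delta>)"
      using E[of t] by (simp add: algebra_simps)
    moreover have "\<bar>(x' t)\<^sup>2 + (m' t)\<^sup>2 + (y' t)\<^sup>2\<bar> \<le> e"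
      using t unfolding Q_def by (smt (verit) zero_le_power2)
    moreover have "\<bar>lam * (1 - (m t)\<^sup>2)\<bar> \<le> lam * e"
    proof -
      have "1 - (m t)\<^sup>2 = (x t)\<^sup>2 + (y t)\<^sup>2" using d(7)[of t] by simp
      then have "0 \<le> 1 - (m t)\<^sup>2" "1 - (m t)\<^sup>2 \<le> e"
        using t unfolding Q_def by (smt (verit) zero_le_power2)+
      then show ?thesis using lam by (simp add: abs_mult)
    qed
    moreover have "\<bar>2 * \<omega> * (m t - \<delta>)\<bar> \<le> 2 * \<bar>\<omega>\<bar> * e"
      using m\<delta> by (simp add: abs_mult mult_left_mono)
    ultimately have "\<bar>E - 2 * \<omega> * \<delta>\<bar> \<le> e + lam * e + 2 * \<bar>\<omega>\<bar> * e" by linarith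
    then show "\<bar>E - 2 * \<omega> * \<delta>\<bar> \<le> (1 + lam + 2 * \<bar>\<omega>\<bar>) * e" by (simp add: algebra_simps)
  qed
  moreover have "J - c * \<delta> = 0"
  proof (rule abs_le_all_pos_mult_imp_zero)
    fix e :: real assume "0 < e" "e < 1"
    obtain t where t: "Q t < e" and m\<delta>: "\<bar>m t - \<delta>\<bar> \<le> e" using sel'[OF \<open>0 < e\<close>] by blast
    have "J - c * \<delta> = x t * y' t - y t * x' t + c * (m t - \<delta>)"
      using J[of t] by (simp add: algebra_simps)
    moreover have "\<bar>x t * y' t - y t * x' t\<bar> \<le> e"
    proof -
      have "2 * \<bar>x t * y' t\<bar> \<le> (x t)\<^sup>2 + (y' t)\<^sup>2" "2 * \<bar>y t * x' t\<bar> \<le> (y t)\<^sup>2 + (x' t)\<^sup>2"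
        using sum_squares_bound[of "\<bar>x t\<bar>" "\<bar>y' t\<bar>"] sum_squares_bound[of "\<bar>y t\<bar>" "\<bar>x' t\<bar>"]
        by (simp_all add: abs_mult)
      then show ?thesis
        using t zero_le_power2[of "m' t"] unfolding Q_def by (smt (verit) zero_le_power2)
    qed
    moreover have "\<bar>c * (m t - \<delta>)\<bar> \<le> \<bar>c\<bar> * e"
      using m\<delta> by (simp add: abs_mult mult_left_mono)
    ultimately have "\<bar>J - c * \<delta>\<bar> \<le> e + \<bar>c\<bar> * e" by linarith
    then show "\<bar>J - c * \<delta>\<bar> \<le> (1 + \<bar>c\<bar>) * e" by (simp add: algebra_simps)
  qed
  ultimately have fi: "first_integrals lam c \<omega> \<delta> x m y x' m' y'"
    unfolding first_integrals_def using E J by (auto simp: algebra_simps)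
  show thesis
  proof (rule that[OF \<delta> fi])
    fix e a :: real assume "0 < e"
    from sel[OF this, of a] show "\<exists>t\<ge>a. 1 - \<delta> * m t < e"
      using near by force
  qed
qed

text \<open>Gronwall's inequality in both time directions: f exp(-K t) is nonincreasing and f exp(K
  t) is nondecreasing, so a zero of f spreads to the right and to the left.\<close>

lemma gronwall_zero:
  fixes f f' :: "real \<Rightarrow> real"
  assumes d: "\<And>t. (f has_real_derivative f' t) (at t)" and nn: "\<And>t. 0 \<le> f t"
    and le: "\<And>t. \<bar>f' t\<bar> \<le> K * f t" and a: "f a = 0"
  shows "f t = 0"
proof (cases "a \<le> t")
  case True
  have "f t * exp (- K * t) \<le> f a * exp (- K * a)"
  proof (rule DERIV_nonpos_imp_nonincreasing[OF True])
    fix s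
    have "((\<lambda>s. f s * exp (- K * s)) has_real_derivative (f' s - K * f s) * exp (- K * s)) (at s)"
      by (rule derivative_eq_intros d refl)+ (simp add: algebra_simps)
    moreover have "(f' s - K * f s) * exp (- K * s) \<le> 0"
      using le[of s] by (intro mult_nonpos_nonneg) auto
    ultimately show "\<exists>y. ((\<lambda>s. f s * exp (- K * s)) has_real_derivative y) (at s) \<and> y \<le> 0" by blast
  qed
  then have "f t \<le> 0" by (simp add: a mult_le_0_iff)
  then show ?thesis using nn[of t] by simp
next
  case False
  then have "t \<le> a" by simp
  have "f t * exp (K * t) \<le> f a * exp (K * a)"
  proof (rule DERIV_nonneg_imp_nondecreasing[OF \<open>t \<le> a\<close>])
    fix s
    have "((\<lambda>s. f s * exp (K * s)) has_real_derivative (f' s + K * f s) * exp (K * s)) (at s)"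
      by (rule derivative_eq_intros d refl)+ (simp add: algebra_simps)
    moreover have "(f' s + K * f s) * exp (K * s) \<ge> 0"
      using le[of s] by (intro mult_nonneg_nonneg) auto
    ultimately show "\<exists>y. ((\<lambda>s. f s * exp (K * s)) has_real_derivative y) (at s) \<and> y \<ge> 0" by blast
  qed
  then have "f t \<le> 0" by (simp add: a mult_le_0_iff)
  then show ?thesis using nn[of t] by simp
qed

text \<open>Once \<open>m\<close> is known, the first integral makes the system for \<open>(x, y)\<close> linear, so that \<open>(x, y)\<close>
  is determined by its value and derivative at one point; these are matched by a rotation.\<close>

theorem tw_profile_unique_up_to_rotation:
  assumes p1: "tw_profile lam c \<omega> x m y x' m' y'" and p2: "tw_profile lam c \<omega> \<xi> m \<eta> \<xi>' m' \<eta>'"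
    and f1: "first_integrals lam c \<omega> \<delta> x m y x' m' y'"
    and f2: "first_integrals lam c \<omega> \<delta> \<xi> m \<eta> \<xi>' m' \<eta>'"
    and lam: "lam > 0" and \<delta>: "\<delta> \<in> {1, -1}" and a: "(m a)\<^sup>2 \<noteq> 1"
  obtains \<theta> where "\<And>t. x t = cos \<theta> * \<xi> t - sin \<theta> * \<eta> t" "\<And>t. y t = sin \<theta> * \<xi> t + cos \<theta> * \<eta> t"
proof -
  note d1 = tw_profileD[OF p1] and d2 = tw_profileD[OF p2]
  define r where "r = 1 - (m a)\<^sup>2"
  have r: "(x a)\<^sup>2 + (y a)\<^sup>2 = r" "(\<xi> a)\<^sup>2 + (\<eta> a)\<^sup>2 = r"
    using d1(7)[of a] d2(7)[of a] by (auto simp: r_def)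
  have "r \<noteq> 0" using a by (simp add: r_def)
  \<comment> \<open>C + i S is the quotient of x + i y by \<xi> + i \<eta> at \<open>a\<close>; both
    have modulus sqrt r, so it lies on the unit circle.\<close>
  define C where "C = (x a * \<xi> a + y a * \<eta> a) / r"
  define S where "S = (y a * \<xi> a - x a * \<eta> a) / r"
  have "C\<^sup>2 + S\<^sup>2 = ((x a)\<^sup>2 + (y a)\<^sup>2) * ((\<xi> a)\<^sup>2 + (\<eta> a)\<^sup>2) / r\<^sup>2"
    by (simp add: C_def S_def power_divide add_divide_distrib[symmetric])
       (simp add: algebra_simps power2_eq_square)
  also have "\<dots> = 1" unfolding r using \<open>r \<noteq> 0\<close> by (simp add: power2_eq_square)
  finally obtain \<theta> where \<theta>: "C = cos \<theta>" "S = sin \<theta>"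
    using sincos_total_2pi by metis
  define X where "X t = x t - (C * \<xi> t - S * \<eta> t)" for t
  define Y where "Y t = y t - (S * \<xi> t + C * \<eta> t)" for t
  define X' where "X' t = x' t - (C * \<xi>' t - S * \<eta>' t)" for t
  define Y' where "Y' t = y' t - (S * \<xi>' t + C * \<eta>' t)" for t
  define e where "e t = lam * (1 - (m t)\<^sup>2) + 2 * \<omega> * (\<delta> - m t) + lam * (1 - (m t)\<^sup>2)" for t
  have e1: "(x' t)\<^sup>2 + (m' t)\<^sup>2 + (y' t)\<^sup>2 + lam * ((x t)\<^sup>2 + (y t)\<^sup>2) = e t"
    and e2: "(\<xi>' t)\<^sup>2 + (m' t)\<^sup>2 + (\<eta>' t)\<^sup>2 + lam * ((\<xi> t)\<^sup>2 + (\<eta> t)\<^sup>2) = e t" for t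
  proof -
    have "(x t)\<^sup>2 + (y t)\<^sup>2 = 1 - (m t)\<^sup>2" "(\<xi> t)\<^sup>2 + (\<eta> t)\<^sup>2 = 1 - (m t)\<^sup>2"
      using d1(7)[of t] d2(7)[of t] by auto
    then show "(x' t)\<^sup>2 + (m' t)\<^sup>2 + (y' t)\<^sup>2 + lam * ((x t)\<^sup>2 + (y t)\<^sup>2) = e t"
      "(\<xi>' t)\<^sup>2 + (m' t)\<^sup>2 + (\<eta>' t)\<^sup>2 + lam * ((\<xi> t)\<^sup>2 + (\<eta> t)\<^sup>2) = e t"
      using f1 f2 by (auto simp: first_integrals_def e_def)
  qed
  define A where "A t = lam + \<omega> * m t - e t" for t
  have dX: "(X has_real_derivative X' t) (at t)" "(Y has_real_derivative Y' t) (at t)" for t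
    unfolding X_def X'_def Y_def Y'_def
    by (rule derivative_eq_intros d1 d2 refl | simp)+
  have dX': "(X' has_real_derivative A t * X t - c * (m t * Y' t - m' t * Y t)) (at t)" for t
    unfolding X'_def X_def Y_def Y'_def A_def
    by (rule derivative_eq_intros d1(4,6)[unfolded e1] d2(4,6)[unfolded e2] refl)+ (simp add: algebra_simps)
  have dY': "(Y' has_real_derivative A t * Y t + c * (m t * X' t - m' t * X t)) (at t)" for t
    unfolding X'_def X_def Y_def Y'_def A_def
    by (rule derivative_eq_intros d1(4,6)[unfolded e1] d2(4,6)[unfolded e2] refl)+ (simp add: algebra_simps)
  define f where "f t = (X t)\<^sup>2 + (Y t)\<^sup>2 + (X' t)\<^sup>2 + (Y' t)\<^sup>2" for t
  \<comment> \<open>The terms with c m cancel by antisymmetry in X' and Y'; bounds on A and m'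
    therefore suffice for a Gronwall estimate.\<close>
  define f' where "f' t = (1 + A t) * (2 * (X t * X' t + Y t * Y' t))
    + c * m' t * (2 * (X' t * Y t - Y' t * X t))" for t
  have df: "(f has_real_derivative f' t) (at t)" for t
    unfolding f_def f'_def
    by (rule derivative_eq_intros dX dX' dY' refl)+ (simp add: algebra_simps)
  note m1 = tw_profile_m_bounds[OF p1]
  define B where "B = lam + 4 * \<bar>\<omega>\<bar>"
  have B: "0 \<le> B" using lam by (simp add: B_def)
  have v_le: "\<bar>lam * (1 - (m t)\<^sup>2) + 2 * \<omega> * (\<delta> - m t)\<bar> \<le> B" for t
  proof -
    have "\<bar>lam * (1 - (m t)\<^sup>2)\<bar> \<le> lam * 1"
      using m1[of t] lam by (simp add: abs_mult)
    moreover have "\<bar>2 * \<omega> * (\<delta> - m t)\<bar> \<le> (2 * \<bar>\<omega>\<bar>) * 2"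
      unfolding abs_mult using m1[of t] \<delta> by (intro mult_mono) auto
    ultimately show ?thesis unfolding B_def by linarith
  qed
  have m'_le: "\<bar>m' t\<bar> \<le> 1 + B" for t
  proof -
    have "(m' t)\<^sup>2 \<le> B"
      using f1 v_le[of t] unfolding first_integrals_def by (smt (verit) zero_le_power2)
    also have "B \<le> (1 + B)\<^sup>2" using B by (simp add: power2_eq_square algebra_simps)
    finally show ?thesis using B by (simp add: abs_le_square_iff[symmetric])
  qed
  have A_le: "\<bar>1 + A t\<bar> \<le> 1 + 2 * lam + \<bar>\<omega>\<bar> + B" for t
  proof -
    have "\<bar>\<omega> * m t\<bar> \<le> \<bar>\<omega>\<bar>" using m1[of t] by (simp add: abs_mult mult_left_le)
    moreover have "\<bar>lam * (1 - (m t)\<^sup>2)\<bar> \<le> lam * 1"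
      using m1[of t] lam by (simp add: abs_mult)
    ultimately show ?thesis using v_le[of t] lam unfolding A_def e_def by linarith
  qed
  define K where "K = (1 + 2 * lam + \<bar>\<omega>\<bar> + B) + \<bar>c\<bar> * (1 + B)"
  have fle: "\<bar>f' t\<bar> \<le> K * f t" for t
  proof -
    have *: "2 * (p * q) \<le> p\<^sup>2 + q\<^sup>2" "- (2 * (p * q)) \<le> p\<^sup>2 + q\<^sup>2" for p q :: real
      using sum_squares_bound[of p q] sum_squares_bound[of "- p" q] by simp_all
    have b1: "\<bar>2 * (X t * X' t + Y t * Y' t)\<bar> \<le> f t"
      using *[of "X t" "X' t"] *[of "Y t" "Y' t"] unfolding f_def abs_le_iff by (simp add: algebra_simps)
    have b2: "\<bar>2 * (X' t * Y t - Y' t * X t)\<bar> \<le> f t"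
      using *[of "X' t" "Y t"] *[of "Y' t" "X t"] unfolding f_def abs_le_iff by (simp add: algebra_simps)
    have "\<bar>(1 + A t) * (2 * (X t * X' t + Y t * Y' t))\<bar> \<le> (1 + 2 * lam + \<bar>\<omega>\<bar> + B) * f t"
      unfolding abs_mult[of "1 + A t"] using A_le b1 lam B by (intro mult_mono) auto
    moreover have "\<bar>c * m' t * (2 * (X' t * Y t - Y' t * X t))\<bar> \<le> \<bar>c\<bar> * (1 + B) * f t"
      unfolding abs_mult[of "c * m' t"] abs_mult[of c] using m'_le[of t] b2 B
      by (intro mult_mono mult_nonneg_nonneg) auto
    ultimately show ?thesis unfolding f'_def K_def by (simp only: distrib_right)
  qed
  have "f a = 0"
  proof -
    have rC: "r * C = x a * \<xi> a + y a * \<eta> a" and rS: "r * S = y a * \<xi> a - x a * \<eta> a"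
      using \<open>r \<noteq> 0\<close> by (auto simp: C_def S_def)
    have "r * (C * \<xi> a - S * \<eta> a) = x a * ((\<xi> a)\<^sup>2 + (\<eta> a)\<^sup>2)"
      "r * (S * \<xi> a + C * \<eta> a) = y a * ((\<xi> a)\<^sup>2 + (\<eta> a)\<^sup>2)"
      unfolding right_diff_distrib distrib_left mult.assoc[symmetric] rC rS
      by (simp_all add: algebra_simps power2_eq_square)
    then have XY: "x a = C * \<xi> a - S * \<eta> a" "y a = S * \<xi> a + C * \<eta> a"
      using \<open>r \<noteq> 0\<close> r by auto
    have t1: "x a * x' a + y a * y' a = - m a * m' a" and t2: "\<xi> a * \<xi>' a + \<eta> a * \<eta>' a = - m a * m' a"
      using tw_profile_tangent[OF p1, of a] tw_profile_tangent[OF p2, of a] by auto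
    have j1: "x a * y' a - y a * x' a = c * (\<delta> - m a)" and j2: "\<xi> a * \<eta>' a - \<eta> a * \<xi>' a = c * (\<delta> - m a)"
      using f1 f2 by (auto simp: first_integrals_def)
    \<comment> \<open>The derivatives at \<open>a\<close> need no separate matching: tangency to the
      sphere prescribes the radial part T of (x', y') and the momentum prescribes its angular part
      J, with the same values for both profiles.\<close>
    define T where "T = - m a * m' a"
    define J where "J = c * (\<delta> - m a)"
    have "((x a)\<^sup>2 + (y a)\<^sup>2) * x' a = x a * (x a * x' a + y a * y' a) - y a * (x a * y' a - y a * x' a)"
      "((x a)\<^sup>2 + (y a)\<^sup>2) * y' a = y a * (x a * x' a + y a * y' a) + x a * (x a * y' a - y a * x' a)"
      "((\<xi> a)\<^sup>2 + (\<eta> a)\<^sup>2) * \<xi>' a = \<xi> a * (\<xi> a * \<xi>' a + \<eta> a * \<eta>' a) - \<eta> a * (\<xi> a * \<eta>' a - \<eta> a * \<xi>' a)"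
      "((\<xi> a)\<^sup>2 + (\<eta> a)\<^sup>2) * \<eta>' a = \<eta> a * (\<xi> a * \<xi>' a + \<eta> a * \<eta>' a) + \<xi> a * (\<xi> a * \<eta>' a - \<eta> a * \<xi>' a)"
      by (simp_all add: algebra_simps power2_eq_square)
    then have D: "r * x' a = x a * T - y a * J" "r * y' a = y a * T + x a * J"
      "r * \<xi>' a = \<xi> a * T - \<eta> a * J" "r * \<eta>' a = \<eta> a * T + \<xi> a * J"
      unfolding r t1 t2 j1 j2 T_def J_def by auto
    have "r * X' a = r * x' a - (C * (r * \<xi>' a) - S * (r * \<eta>' a))"
      "r * Y' a = r * y' a - (S * (r * \<xi>' a) + C * (r * \<eta>' a))"
      by (simp_all add: X'_def Y'_def algebra_simps)
    then have "r * X' a = 0" "r * Y' a = 0"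
      unfolding D XY by (simp_all add: algebra_simps)
    then show ?thesis
      using \<open>r \<noteq> 0\<close> XY by (simp add: f_def X_def Y_def)
  qed
  have "f t = 0" for t
    by (rule gronwall_zero[OF df _ fle \<open>f a = 0\<close>]) (simp add: f_def)
  then have "X t = 0 \<and> Y t = 0" for t
    unfolding f_def by (smt (verit) zero_le_power2 power_eq_0_iff zero_eq_power2)
  then show thesis
    using that[of \<theta>] by (simp add: X_def Y_def \<theta>)
qed

section \<open>The component m\<close>

text \<open>The second-order equation is the m-component of the system with both first integrals
  inserted. It is not obtained by differentiating the relation for m'^2, which would yield it only
  where m' is nonzero.\<close>

lemma component_ode:
  assumes prof: "tw_profile lam c \<omega> x m y x' m' y'"
    and fi: "first_integrals lam c \<omega> \<delta> x m y x' m' y'" and \<delta>: "\<delta> \<in> {1, -1}"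
  defines "u t \<equiv> 1 - \<delta> * m t" and "k2 \<equiv> 4 * (lam + \<delta> * \<omega>) - c\<^sup>2"
  shows "(u has_real_derivative - \<delta> * m' t) (at t)"
    "((\<lambda>t. - \<delta> * m' t) has_real_derivative
       k2 * u t - 3 * (2 * lam + \<delta> * \<omega>) * (u t)\<^sup>2 + 2 * lam * (u t) ^ 3) (at t)"
    "(m' t)\<^sup>2 = (u t)\<^sup>2 * (k2 - 2 * (2 * lam + \<delta> * \<omega>) * u t + lam * (u t)\<^sup>2)"
    "0 \<le> u t" "u t \<le> 2"
proof -
  note d = tw_profileD[OF prof]
  have m: "m t = \<delta> * (1 - u t)"
    using \<delta> by (auto simp: u_def)
  have sph: "(x t)\<^sup>2 + (y t)\<^sup>2 = u t * (2 - u t)"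
    using d(7)[of t] \<delta> unfolding m by (auto simp: power2_eq_square algebra_simps)
  have f1: "(x' t)\<^sup>2 + (m' t)\<^sup>2 + (y' t)\<^sup>2 = lam * (u t * (2 - u t)) + 2 * (\<delta> * \<omega>) * u t"
    and f2: "x t * y' t - y t * x' t = c * \<delta> * u t"
    using fi \<delta> by (auto simp: first_integrals_def u_def power2_eq_square algebra_simps)
  show "(u has_real_derivative - \<delta> * m' t) (at t)"
    unfolding u_def by (rule derivative_eq_intros d refl)+ simp
  have "((\<lambda>t. - \<delta> * m' t) has_real_derivative - \<delta> * (c * (x t * y' t - y t * x' t)
    - ((x' t)\<^sup>2 + (m' t)\<^sup>2 + (y' t)\<^sup>2 + lam * ((x t)\<^sup>2 + (y t)\<^sup>2)) * m t - \<omega> * ((x t)\<^sup>2 + (y t)\<^sup>2))) (at t)"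
    (is "(_ has_real_derivative ?d) _")
    by (rule DERIV_cmult[OF d(5)])
  also have "?d = k2 * u t - 3 * (2 * lam + \<delta> * \<omega>) * (u t)\<^sup>2 + 2 * lam * (u t) ^ 3"
    unfolding f1 f2 sph m k2_def using \<delta>
    by (auto simp: power2_eq_square power3_eq_cube algebra_simps)
  finally show "((\<lambda>t. - \<delta> * m' t) has_real_derivative
       k2 * u t - 3 * (2 * lam + \<delta> * \<omega>) * (u t)\<^sup>2 + 2 * lam * (u t) ^ 3) (at t)" .
  \<comment> \<open>Lagrange's identity. Since u (2 - u) + (1 - u)^2 = 1, it isolates m'^2 with
    coefficient 1, so nothing is divided by u and points with u = 0 are covered.\<close>
  have "((x t)\<^sup>2 + (y t)\<^sup>2) * ((x' t)\<^sup>2 + (y' t)\<^sup>2)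
    = (x t * x' t + y t * y' t)\<^sup>2 + (x t * y' t - y t * x' t)\<^sup>2"
    by (simp add: power2_eq_square algebra_simps)
  moreover have "x t * x' t + y t * y' t = - (m t * m' t)"
    using tw_profile_tangent[OF prof, of t] by simp
  moreover have "(x' t)\<^sup>2 + (y' t)\<^sup>2 = lam * (u t * (2 - u t)) + 2 * (\<delta> * \<omega>) * u t - (m' t)\<^sup>2"
    using f1 by simp
  ultimately have "u t * (2 - u t) * (lam * (u t * (2 - u t)) + 2 * (\<delta> * \<omega>) * u t - (m' t)\<^sup>2)
    = (\<delta> * (1 - u t) * m' t)\<^sup>2 + (c * \<delta> * u t)\<^sup>2"
    unfolding sph f2 m by simp
  then show "(m' t)\<^sup>2 = (u t)\<^sup>2 * (k2 - 2 * (2 * lam + \<delta> * \<omega>) * u t + lam * (u t)\<^sup>2)"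
    unfolding k2_def using \<delta> by (auto simp: power2_eq_square algebra_simps)
  show "0 \<le> u t" "u t \<le> 2" using tw_profile_m_bounds(1)[OF prof, of t] \<delta> by (auto simp: u_def)
qed

lemma half_quotient: "(a / 2) / (b / 2) = a / (b :: real)"
  by simp

text \<open>The substitution \<open>w = 1 / u\<close> turns the equation for \<open>u\<close> into the linear equation
  \<open>w'' = k2 w - (2 lam + \<delta> \<omega>)\<close>; \<open>p\<close> and \<open>q\<close> below are its growing and decaying modes.\<close>

theorem component_classification:
  assumes prof: "tw_profile lam c \<omega> x m y x' m' y'"
    and fi: "first_integrals lam c \<omega> \<delta> x m y x' m' y'" and \<delta>: "\<delta> \<in> {1, -1}" and lam: "lam > 0"
    and reach: "\<forall>e>0. \<forall>a. \<exists>t\<ge>a. 1 - \<delta> * m t < e"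
    and nontriv: "m b \<noteq> \<delta>"
  defines "k2 \<equiv> 4 * (lam + \<delta> * \<omega>) - c\<^sup>2" and "\<alpha> \<equiv> 2 * lam + \<delta> * \<omega>"
    and "S \<equiv> sqrt (lam * c\<^sup>2 + \<omega>\<^sup>2)"
  shows "0 < k2" and "(0 < S \<and> (\<exists>a. \<forall>t. m t = \<delta> * (1 - k2 / (\<alpha> + S * cosh (sqrt k2 * (t - a)))))) \<or>
    (c = 0 \<and> \<omega> = 0 \<and> (\<exists>a. \<forall>t. m t = \<delta> * tanh (sqrt lam * (t - a))))"
proof -
  define u where "u t = 1 - \<delta> * m t" for t
  define u' where "u' t = - \<delta> * m' t" for t
  note ode = component_ode[OF prof fi \<delta>, folded k2_def \<alpha>_def u_def u'_def]
  have du: "(u has_real_derivative u' t) (at t)" for t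
    using ode(1)[of t] by (simp add: u_def[abs_def])
  have du': "(u' has_real_derivative k2 * u t - 3 * \<alpha> * (u t)\<^sup>2 + 2 * lam * (u t) ^ 3) (at t)" for t
    using ode(2)[of t] by (simp add: u'_def[abs_def])
  have u'2: "(u' t)\<^sup>2 = (u t)\<^sup>2 * (k2 - 2 * \<alpha> * u t + lam * (u t)\<^sup>2)" for t
  proof -
    have "(u' t)\<^sup>2 = (m' t)\<^sup>2" using \<delta> by (auto simp: u'_def)
    then show ?thesis using ode(3)[of t] by simp
  qed
  have u0: "0 \<le> u t" and u2: "u t \<le> 2" for t
    using ode(4,5)[of t] by auto
  \<comment> \<open>K bounds the quadratic factor of u'^2 for 0 \<le> u \<le> 2; being at least 1,
    it is at most its own square, so K u also bounds |u'|.\<close>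
  define K where "K = 1 + \<bar>k2\<bar> + 4 * \<bar>\<alpha>\<bar> + 4 * lam"
  have K: "1 \<le> K" using lam by (simp add: K_def)
  have le: "\<bar>u' t\<bar> \<le> K * u t" for t
  proof -
    have "\<bar>\<alpha> * u t\<bar> \<le> \<bar>\<alpha>\<bar> * 2"
      unfolding abs_mult using u0[of t] u2[of t] by (intro mult_mono) auto
    moreover have "lam * (u t)\<^sup>2 \<le> lam * 2\<^sup>2"
      using u0[of t] u2[of t] lam by (intro mult_left_mono power_mono) auto
    ultimately have "k2 - 2 * \<alpha> * u t + lam * (u t)\<^sup>2 \<le> K"
      using abs_ge_self[of k2] unfolding K_def abs_le_iff[of "\<alpha> * u t"] power2_eq_square[of 2] by linarith
    also have "\<dots> \<le> K * K" using K by simp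
    finally have "(u' t)\<^sup>2 \<le> (u t)\<^sup>2 * (K * K)"
      unfolding u'2 by (intro mult_left_mono) auto
    then have "(u' t)\<^sup>2 \<le> (K * u t)\<^sup>2" by (simp add: power2_eq_square algebra_simps)
    then have "\<bar>u' t\<bar> \<le> \<bar>K * u t\<bar>" by (simp add: abs_le_square_iff)
    then show ?thesis using K u0[of t] by simp
  qed
  have pos: "0 < u t" for t
  proof (rule ccontr)
    assume "\<not> 0 < u t"
    then have "u t = 0" using u0[of t] by simp
    then have "u b = 0"
      by (rule gronwall_zero[OF du u0 le])
    then show False using nontriv \<delta> by (auto simp: u_def)
  qed
  have P: "0 \<le> k2 - 2 * \<alpha> * u t + lam * (u t)\<^sup>2" for t
  proof -
    have "0 \<le> (u t)\<^sup>2 * (k2 - 2 * \<alpha> * u t + lam * (u t)\<^sup>2)"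
      unfolding u'2[symmetric] by simp
    then show ?thesis using pos[of t] by (simp add: zero_le_mult_iff)
  qed
  have small: "\<exists>t\<ge>a. u t < e" if "0 < e" for e a
    using reach that unfolding u_def by blast
  \<comment> \<open>By \<open>small\<close>, u comes arbitrarily close to 0, where the nonnegative
    factor in \<open>P\<close> is close to k2; this excludes k2 < 0. If k2 = 0, then 4 (lam +
    \<delta> \<omega>) = c^2 gives \<alpha> \<ge> lam, and the factor is negative for 0 < u <
    1.\<close>
  show k2: "0 < k2"
  proof (rule ccontr)
    assume "\<not> 0 < k2"
    then have k2: "k2 \<le> 0" by simp
    have "0 \<le> k2"
    proof (rule ccontr)
      assume "\<not> 0 \<le> k2"
      define e where "e = - k2 / (2 * \<bar>\<alpha>\<bar> + lam + 1)"
      have e: "0 < e" "e * (2 * \<bar>\<alpha>\<bar> + lam + 1) = - k2"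
        using \<open>\<not> 0 \<le> k2\<close> lam by (simp_all add: e_def divide_neg_pos)
      obtain t where "u t < min 1 e" using small[of "min 1 e"] e(1) by auto
      then have t: "u t < 1" "u t < e" by auto
      have ut: "0 < u t" "u t \<le> 1" using pos t by auto
      have "- (2 * \<alpha> * u t) \<le> 2 * \<bar>\<alpha>\<bar> * u t"
        using ut mult_right_mono[of "- \<alpha>" "\<bar>\<alpha>\<bar>" "u t"] by simp
      moreover have "lam * (u t)\<^sup>2 \<le> lam * u t"
        using ut lam by (simp add: power2_eq_square mult_left_le)
      ultimately have "- k2 \<le> u t * (2 * \<bar>\<alpha>\<bar> + lam)"
        using P[of t] by (simp add: algebra_simps)
      also have "\<dots> \<le> u t * (2 * \<bar>\<alpha>\<bar> + lam + 1)"
        using ut by (intro mult_left_mono) auto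
      also have "\<dots> < e * (2 * \<bar>\<alpha>\<bar> + lam + 1)"
        using t lam by (intro mult_strict_right_mono) auto
      finally show False using e(2) by simp
    qed
    with k2 have "k2 = 0" by simp
    then have "0 \<le> 4 * (lam + \<delta> * \<omega>)" by (simp add: k2_def)
    then have \<alpha>: "lam \<le> \<alpha>" by (simp add: \<alpha>_def)
    obtain t where t: "u t < 1" using small[of 1] by auto
    have "2 * \<alpha> * u t \<le> lam * u t * u t" using P[of t] \<open>k2 = 0\<close> by (simp add: power2_eq_square)
    then have "2 * \<alpha> \<le> lam * u t" using pos[of t] by (simp add: mult_le_cancel_right)
    also have "\<dots> \<le> lam" using t lam by simp
    finally show False using \<alpha> lam by simp
  qed
  define k where "k = sqrt k2"
  have k: "0 < k" "k * k = k2" using k2 by (auto simp: k_def)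
  define w where "w t = 1 / u t" for t
  define w' where "w' t = - u' t / (u t)\<^sup>2" for t
  have dw: "(w has_real_derivative w' t) (at t)" for t
    unfolding w_def w'_def
    by (rule derivative_eq_intros du refl | use pos[of t] in \<open>simp add: power2_eq_square\<close>)+
  have dw': "(w' has_real_derivative k2 * w t - \<alpha>) (at t)" for t
  proof -
    have "(w' has_real_derivative (- (k2 * u t - 3 * \<alpha> * (u t)\<^sup>2 + 2 * lam * (u t) ^ 3) * (u t)\<^sup>2
      + 2 * u t * (u' t)\<^sup>2) / ((u t)\<^sup>2 * (u t)\<^sup>2)) (at t)"
      unfolding w'_def
      by (rule derivative_eq_intros du du' refl | use pos[of t] in \<open>simp add: power2_eq_square algebra_simps\<close>)+
    moreover have "(- (k2 * u t - 3 * \<alpha> * (u t)\<^sup>2 + 2 * lam * (u t) ^ 3) * (u t)\<^sup>2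
      + 2 * u t * (u' t)\<^sup>2) / ((u t)\<^sup>2 * (u t)\<^sup>2) = k2 * w t - \<alpha>"
      unfolding u'2 w_def using pos[of t]
      by (simp add: field_simps power2_eq_square power3_eq_cube)
    ultimately show ?thesis by simp
  qed
  have w'2: "(w' t)\<^sup>2 = k2 * (w t)\<^sup>2 - 2 * \<alpha> * w t + lam" for t
    using u'2[of t] pos[of t] by (simp add: w'_def w_def field_simps power2_eq_square)
  \<comment> \<open>The equilibrium of w'' = k2 w - \<alpha>; the deviation w - A solves the
    homogeneous equation, so the amplitudes p and q are constant.\<close>
  define A where "A = \<alpha> / k2"
  have A: "k2 * A = \<alpha>" using k2 by (simp add: A_def)
  define p where "p t = (w' t + k * (w t - A)) * exp (- k * t)" for t
  define q where "q t = (w' t - k * (w t - A)) * exp (k * t)" for t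
  have "(p has_real_derivative 0) (at t)" for t
    unfolding p_def
    by (rule derivative_eq_intros dw dw' refl)+ (simp add: algebra_simps flip: k(2) A)
  then have p: "p t = p 0" for t using DERIV_isconst_all by blast
  have "(q has_real_derivative 0) (at t)" for t
    unfolding q_def
    by (rule derivative_eq_intros dw dw' refl)+ (simp add: algebra_simps flip: k(2) A)
  then have q: "q t = q 0" for t using DERIV_isconst_all by blast
  have h: "2 * k * (w t - A) = p 0 * exp (k * t) - q 0 * exp (- k * t)" for t
  proof -
    have "p t * exp (k * t) = w' t + k * (w t - A)" "q t * exp (- k * t) = w' t - k * (w t - A)"
      unfolding p_def q_def by (simp_all add: mult.assoc flip: exp_add)
    then show ?thesis using p[of t] q[of t] by (simp add: algebra_simps)
  qed
  have S2: "S\<^sup>2 = lam * c\<^sup>2 + \<omega>\<^sup>2" using lam by (simp add: S_def)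
  have S0: "0 \<le> S" using lam by (simp add: S_def)
  have "\<alpha>\<^sup>2 - lam * k2 = S\<^sup>2"
    unfolding S2 \<alpha>_def k2_def using \<delta> by (auto simp: power2_eq_square algebra_simps)
  \<comment> \<open>In these modes the relation w'^2 = k2 w^2 - 2 \<alpha> w + lam reads p (-q) =
    (\<alpha>^2 - lam k2) / k2. The discriminant \<alpha>^2 - lam k2 equals S^2, which is the origin
    of the root S in the formulas.\<close>
  then have pq: "p 0 * - q 0 = (S / k)\<^sup>2"
  proof -
    have "p 0 * - q 0 = (k * k) * (w 0 - A)\<^sup>2 - (w' 0)\<^sup>2"
      by (simp add: p_def q_def power2_eq_square algebra_simps)
    also have "\<dots> = (k2 * A) * A - lam + 2 * (\<alpha> - k2 * A) * w 0"
      unfolding k(2) w'2 by (simp add: power2_eq_square algebra_simps)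
    also have "\<dots> = \<alpha> * \<alpha> / k2 - lam" unfolding A by (simp add: A_def)
    also have "\<dots> = (\<alpha>\<^sup>2 - lam * k2) / k2" using k2 by (simp add: field_simps power2_eq_square)
    also have "\<dots> = (S / k)\<^sup>2"
      unfolding \<open>\<alpha>\<^sup>2 - lam * k2 = S\<^sup>2\<close> by (simp add: power2_eq_square k(2))
    finally show ?thesis .
  qed
  \<comment> \<open>Otherwise w stays below M for t \<ge> 0, whereas u = 1 / w comes arbitrarily
    close to 0 at late times.\<close>
  have p0: "0 < p 0"
  proof (rule ccontr)
    assume "\<not> 0 < p 0"
    define M where "M = \<bar>A\<bar> + \<bar>q 0\<bar> / (2 * k) + 1"
    have M: "0 < M" using k by (simp add: M_def add_nonneg_pos)
    obtain t where t: "0 \<le> t" "u t < 1 / M" using small[of "1 / M" 0] M by auto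
    have "M < w t" using t(2) M pos[of t] by (simp add: w_def field_simps)
    then have "\<bar>q 0\<bar> / (2 * k) < w t - A" by (simp add: M_def)
    then have "\<bar>q 0\<bar> < 2 * k * (w t - A)" using k by (simp add: field_simps)
    also have "\<dots> \<le> - q 0 * exp (- k * t)"
      unfolding h using \<open>\<not> 0 < p 0\<close> by (simp add: mult_le_0_iff)
    also have "\<dots> \<le> \<bar>q 0\<bar> * exp (- k * t)"
      by (intro mult_right_mono) auto
    also have "\<dots> \<le> \<bar>q 0\<bar> * 1"
      using t(1) k(1) by (intro mult_left_mono) auto
    finally show False by simp
  qed
  have mu: "m t = \<delta> * (1 - 1 / w t)" for t
    using \<delta> pos[of t] by (auto simp: w_def u_def)
  show "(0 < S \<and> (\<exists>a. \<forall>t. m t = \<delta> * (1 - k2 / (\<alpha> + S * cosh (sqrt k2 * (t - a)))))) \<or>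
    (c = 0 \<and> \<omega> = 0 \<and> (\<exists>a. \<forall>t. m t = \<delta> * tanh (sqrt lam * (t - a))))"
  proof (cases "S = 0")
    case False
    then have S: "0 < S" using S0 by simp
    \<comment> \<open>The translation that balances the two modes: p exp(k a) and -q exp(-k a) both
      equal S / k, so that their sum becomes a hyperbolic cosine.\<close>
    define a where "a = ln (S / k / p 0) / k"
    have ea: "exp (k * a) = S / k / p 0" using S k p0 by (simp add: a_def)
    have eq1: "p 0 = S / k * exp (- k * a)"
      using ea S k p0 by (simp add: exp_minus)
    have "p 0 * - q 0 = p 0 * (S / k * exp (k * a))"
      unfolding pq ea using p0 by (simp add: power2_eq_square)
    moreover have "p 0 \<noteq> 0" using p0 by simp
    ultimately have eq2: "- q 0 = S / k * exp (k * a)"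
      using iffD1[OF mult_left_cancel] by blast
    have "m t = \<delta> * (1 - k2 / (\<alpha> + S * cosh (sqrt k2 * (t - a))))" for t
    proof -
      have "2 * k * (w t - A) = S / k * exp (- k * a) * exp (k * t) + S / k * exp (k * a) * exp (- k * t)"
        unfolding h eq2[symmetric] by (subst eq1[symmetric]) simp
      also have "\<dots> = S / k * (exp (k * (t - a)) + exp (- (k * (t - a))))"
        by (simp add: distrib_left mult.assoc flip: exp_add) (simp add: algebra_simps)
      also have "\<dots> = 2 * (S / k) * cosh (k * (t - a))"
        by (simp add: cosh_field_def)
      finally have "k * (k * (w t - A)) = S * cosh (k * (t - a))"
        using k(1) by (simp add: field_simps)
      then have eq: "k2 * w t = \<alpha> + S * cosh (k * (t - a))"
        using A unfolding mult.assoc[symmetric] k(2) by (simp add: algebra_simps)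
      have "k2 / (\<alpha> + S * cosh (k * (t - a))) = 1 / w t"
        unfolding eq[symmetric] using k2 by simp
      then show ?thesis unfolding mu k_def by simp
    qed
    with S show ?thesis by blast
  next
    case True
    then have "lam * c\<^sup>2 + \<omega>\<^sup>2 = 0" using S2 by simp
    then have c0: "c = 0" and \<omega>0: "\<omega> = 0"
      using lam by (auto simp: add_nonneg_eq_0_iff)
    have "q 0 = 0" using pq p0 True by simp
    define s where "s = sqrt lam"
    have s: "0 < s" "s * s = lam" using lam by (auto simp: s_def)
    have k2s: "k = 2 * s" unfolding k_def k2_def c0 \<omega>0 s_def
      by (simp add: real_sqrt_mult)
    have A2: "A = 1 / 2" unfolding A_def \<alpha>_def k2_def c0 \<omega>0 using lam by simp
    \<comment> \<open>Only the growing mode survives. With k = 2 sqrt lam and A = 1 / 2, the choice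
      p = k exp(-k a) gives w = (1 + exp(2 sqrt lam (t - a))) / 2, and 1 - 1 / w is a hyperbolic
      tangent.\<close>
    define a where "a = ln (k / p 0) / k"
    have ea: "exp (k * a) = k / p 0" using k p0 by (simp add: a_def)
    have eq1: "p 0 = k * exp (- k * a)"
      using ea k p0 by (simp add: exp_minus)
    have "m t = \<delta> * tanh (sqrt lam * (t - a))" for t
    proof -
      define E where "E = exp (s * (t - a))"
      have E: "E > 0" by (simp add: E_def)
      have "2 * k * (w t - A) = k * exp (- k * a) * exp (k * t)"
        unfolding h \<open>q 0 = 0\<close> by (subst eq1[symmetric]) simp
      also have "\<dots> = k * (E * E)"
        unfolding E_def k2s by (simp flip: exp_add) (simp add: algebra_simps)
      finally have "k * (2 * (w t - A)) = k * (E * E)" by (simp only: mult.assoc mult.left_commute)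
      moreover have "k \<noteq> 0" using k(1) by simp
      ultimately have "2 * (w t - A) = E * E" using iffD1[OF mult_left_cancel] by blast
      then have wE: "w t = (1 + E * E) / 2" using A2 by simp
      have em: "exp (- (s * (t - a))) = 1 / E"
        by (simp add: E_def exp_minus inverse_eq_divide)
      have "tanh (s * (t - a)) = (E - 1 / E) / (E + 1 / E)"
        unfolding tanh_def sinh_field_def cosh_field_def em E_def[symmetric] by (rule half_quotient)
      also have "\<dots> = 1 - 1 / w t"
      proof -
        have "0 < E * E" "0 < E * (E * E)" using E by simp_all
        then have "1 + E * E \<noteq> 0" "E + E * (E * E) \<noteq> 0" using E by linarith+
        then show ?thesis unfolding wE using E by (simp add: field_simps)
      qed
      finally show ?thesis unfolding mu s_def by simp
    qed
    with c0 \<omega>0 show ?thesis by blast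
  qed
qed

text \<open>1 / cosh (k t) is at most 2 exp(-k |t|); integrability of this exponential on the left
  half-line comes from the right one by reflection.\<close>

lemma integrable_bound_cosh:
  fixes Q :: "real \<Rightarrow> real"
  assumes cont: "continuous_on UNIV Q" and k: "0 < k"
    and le: "\<And>t. \<bar>Q t\<bar> \<le> C / cosh (k * t)"
  shows "integrable lebesgue Q"
proof -
  define h where "h t = exp (- k * \<bar>t\<bar>)" for t
  have "(\<lambda>t. exp (- k * t)) absolutely_integrable_on {0..}"
    using k by (intro nonnegative_absolutely_integrable_1 integrable_on_exp_minus_to_infinity) auto
  then have r: "h absolutely_integrable_on {0..}"
    by (rule absolutely_integrable_spike[where S = "{}"]) (auto simp: h_def)
  have "(\<lambda>t. h (- t)) absolutely_integrable_on {..0} \<and> integral {..0} (\<lambda>t. h (- t)) = integral {0..} h"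
    by (subst has_absolute_integral_reflect_real[where B = "{0..}"]) (use r in auto)
  moreover have "(\<lambda>t. h (- t)) = h" by (simp add: h_def fun_eq_iff)
  ultimately have "h absolutely_integrable_on {..0}" by simp
  with r have "h absolutely_integrable_on ({0..} \<union> {..0})"
    by (rule absolutely_integrable_Un)
  moreover have "{0..} \<union> {..0} = (UNIV :: real set)" by auto
  ultimately have h: "integrable lebesgue h" by (simp add: set_integrable_def)
  show ?thesis
  proof (rule Bochner_Integration.integrable_bound)
    show "integrable lebesgue (\<lambda>t. 2 * \<bar>C\<bar> * h t)"
      using h by simp
    show "Q \<in> borel_measurable lebesgue"
      using cont by (rule borel_measurable_lebesgue_continuous)
    show "AE t in lebesgue. norm (Q t) \<le> norm (2 * \<bar>C\<bar> * h t)"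
    proof (rule AE_I2)
      fix t
      have "exp (k * \<bar>t\<bar>) \<le> 2 * cosh (k * t)"
        by (cases "0 \<le> t") (auto simp: cosh_field_def)
      then have "1 / cosh (k * t) \<le> 2 * h t"
        by (simp add: h_def exp_minus field_simps)
      then have "\<bar>C\<bar> * (1 / cosh (k * t)) \<le> \<bar>C\<bar> * (2 * h t)"
        by (intro mult_left_mono) auto
      moreover have "C / cosh (k * t) \<le> \<bar>C\<bar> * (1 / cosh (k * t))"
        by (simp add: divide_right_mono)
      ultimately have "\<bar>Q t\<bar> \<le> 2 * \<bar>C\<bar> * h t"
        using le[of t] by linarith
      then show "norm (Q t) \<le> norm (2 * \<bar>C\<bar> * h t)"
        by (simp add: h_def)
    qed
  qed
qed

section \<open>Explicit profiles\<close>

text \<open>All that the two directions of the classification ask of an explicit profile. The first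
  integrals with the same \<delta> allow comparison with a given solution; the point where m^2
  differs from 1 rules out the trivial solutions and is the base point for finding the
  rotation.\<close>

definition tw_soliton :: "real \<Rightarrow> real \<Rightarrow> real \<Rightarrow> real
    \<Rightarrow> real_function \<Rightarrow> real_function \<Rightarrow> real_function \<Rightarrow> bool" where
  "tw_soliton lam c \<omega> \<delta> x m y \<longleftrightarrow> (\<exists>x' m' y'.
     tw_profile lam c \<omega> x m y x' m' y' \<and> first_integrals lam c \<omega> \<delta> x m y x' m' y' \<and>
     integrable lebesgue (\<lambda>t. (x t)\<^sup>2 + (y t)\<^sup>2 + (x' t)\<^sup>2 + (m' t)\<^sup>2 + (y' t)\<^sup>2) \<and>
     (\<exists>t. (m t)\<^sup>2 \<noteq> 1))"

lemma disj_le_double: "a \<le> d \<or> (P \<and> b \<le> d) \<Longrightarrow> b \<le> 2 * a \<Longrightarrow> 0 \<le> d \<Longrightarrow> b \<le> 2 * (d :: real)"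
  by auto

text \<open>The constraint and the energy integral turn the energy integrand into (1 + lam) (1 -
  m^2) + 2 \<omega> (\<delta> - m), so only decay of m is to be checked. The second alternative in
  \<open>le\<close> serves the static profile: there 1 - \<delta> m tends to 2 at -infinity, but its
  coefficient vanishes with \<omega>.\<close>

lemma tw_solitonI:
  assumes prof: "tw_profile lam c \<omega> x m y x' m' y'"
    and fi: "first_integrals lam c \<omega> \<delta> x m y x' m' y'" and \<delta>: "\<delta> \<in> {1, -1}"
    and k: "0 < k" and le: "\<And>t. 1 - \<delta> * m t \<le> C / cosh (k * t) \<or> (\<omega> = 0 \<and> 1 - (m t)\<^sup>2 \<le> C / cosh (k * t))"
    and ex: "(m a)\<^sup>2 \<noteq> 1" and lam: "0 < lam"
  shows "tw_soliton lam c \<omega> \<delta> x m y"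
proof -
  note d = tw_profileD[OF prof]
  define Q where "Q t = (x t)\<^sup>2 + (y t)\<^sup>2 + (x' t)\<^sup>2 + (m' t)\<^sup>2 + (y' t)\<^sup>2" for t
  have Q: "Q t = (1 + lam) * (1 - (m t)\<^sup>2) + 2 * \<omega> * (\<delta> - m t)" for t
  proof -
    have "(x' t)\<^sup>2 + (m' t)\<^sup>2 + (y' t)\<^sup>2 = lam * (1 - (m t)\<^sup>2) + 2 * \<omega> * (\<delta> - m t)"
      using fi by (simp add: first_integrals_def)
    then have "Q t = (1 - (m t)\<^sup>2) + (lam * (1 - (m t)\<^sup>2) + 2 * \<omega> * (\<delta> - m t))"
      using d(7)[of t] unfolding Q_def by linarith
    then show ?thesis by (simp add: distrib_right)
  qed
  have cont: "continuous_on UNIV Q"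
    unfolding Q using d(2) by (intro continuous_intros) (auto intro!: continuous_at_imp_continuous_on DERIV_isCont)
  have "integrable lebesgue Q"
  proof (rule integrable_bound_cosh[OF cont k])
    fix t
    define D where "D = C / cosh (k * t)"
    have Q0: "0 \<le> Q t" by (simp add: Q_def)
    note m1 = tw_profile_m_bounds(1)[OF prof, of t]
    have u: "0 \<le> 1 - \<delta> * m t" "1 - (m t)\<^sup>2 \<le> 2 * (1 - \<delta> * m t)"
    proof -
      show u0: "0 \<le> 1 - \<delta> * m t" using m1 \<delta> by auto
      have "1 - (m t)\<^sup>2 = (1 - \<delta> * m t) * (1 + \<delta> * m t)"
        using \<delta> by (auto simp: power2_eq_square algebra_simps)
      also have "\<dots> \<le> (1 - \<delta> * m t) * 2" using m1 \<delta> u0 by (intro mult_left_mono) auto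
      finally show "1 - (m t)\<^sup>2 \<le> 2 * (1 - \<delta> * m t)" by simp
    qed
    have le': "1 - \<delta> * m t \<le> D \<or> (\<omega> = 0 \<and> 1 - (m t)\<^sup>2 \<le> D)"
      using le[of t] by (simp add: D_def)
    have D1: "1 - (m t)\<^sup>2 \<le> 2 * D" and D2: "\<omega> * (\<delta> - m t) \<le> \<bar>\<omega>\<bar> * D" and D0: "0 \<le> D"
    proof -
      have m2: "0 \<le> 1 - (m t)\<^sup>2" using tw_profile_m_bounds(2)[OF prof, of t] by simp
      show D0: "0 \<le> D" using le' u(1) m2 by linarith
      show "1 - (m t)\<^sup>2 \<le> 2 * D" using disj_le_double[OF le' u(2) D0] .
      show "\<omega> * (\<delta> - m t) \<le> \<bar>\<omega>\<bar> * D"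
      proof (cases "\<omega> = 0")
        case False
        have "\<omega> * (\<delta> - m t) = (\<omega> * \<delta>) * (1 - \<delta> * m t)" using \<delta> by (auto simp: algebra_simps)
        also have "\<dots> \<le> \<bar>\<omega>\<bar> * (1 - \<delta> * m t)"
          using u(1) \<delta> by (intro mult_right_mono) auto
        also have "\<dots> \<le> \<bar>\<omega>\<bar> * D"
          using le' False by (intro mult_left_mono) auto
        finally show ?thesis .
      qed simp
    qed
    have "Q t \<le> (1 + lam) * (2 * D) + 2 * (\<bar>\<omega>\<bar> * D)"
      unfolding Q using D1 D2 lam by (intro add_mono) auto
    also have "\<dots> = ((1 + lam) * 2 + 2 * \<bar>\<omega>\<bar>) * C / cosh (k * t)"
      by (simp add: D_def algebra_simps add_divide_distrib)
    finally show "\<bar>Q t\<bar> \<le> ((1 + lam) * 2 + 2 * \<bar>\<omega>\<bar>) * C / cosh (k * t)" using Q0 by simp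
  qed
  then show ?thesis
    unfolding tw_soliton_def using prof fi ex by (auto simp: Q_def[abs_def])
qed

text \<open>Away from the poles, a profile is determined by its component \<open>m\<close>: the conditions on
  \<open>x\<^sup>2 + y\<^sup>2\<close> and \<open>x y' - y x'\<close> are a linear first order system for \<open>(x, y)\<close>.\<close>

lemma tw_profile_from_component:
  fixes u u' x y x0 y0 :: "real \<Rightarrow> real"
  assumes \<delta>: "\<delta> \<in> {1, -1}"
    and du: "\<And>t. (u has_real_derivative u' t) (at t)"
    and du': "\<And>t. (u' has_real_derivative
        (4 * (lam + \<delta> * \<omega>) - c\<^sup>2) * u t - 3 * (2 * lam + \<delta> * \<omega>) * (u t)\<^sup>2 + 2 * lam * (u t) ^ 3) (at t)"
    and u'2: "\<And>t. (u' t)\<^sup>2 = (u t)\<^sup>2 * (4 * (lam + \<delta> * \<omega>) - c\<^sup>2 - 2 * (2 * lam + \<delta> * \<omega>) * u t + lam * (u t)\<^sup>2)"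
    and u0: "\<And>t. 0 < u t" and u2: "\<And>t. u t < 2"
    and dx: "\<And>t. (x has_real_derivative x0 t) (at t)" and dy: "\<And>t. (y has_real_derivative y0 t) (at t)"
    and sph: "\<And>t. (x t)\<^sup>2 + (y t)\<^sup>2 = u t * (2 - u t)"
    and mom: "\<And>t. x t * y0 t - y t * x0 t = c * \<delta> * u t"
  shows "\<exists>x' m' y'. tw_profile lam c \<omega> x (\<lambda>t. \<delta> * (1 - u t)) y x' m' y' \<and>
    first_integrals lam c \<omega> \<delta> x (\<lambda>t. \<delta> * (1 - u t)) y x' m' y'"
proof -
  have nz: "u t \<noteq> 0" "2 - u t \<noteq> 0" for t using u0[of t] u2[of t] by auto
  have \<delta>2: "\<delta> * \<delta> = 1" "\<delta>\<^sup>2 = 1" using \<delta> by auto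
  \<comment> \<open>With z = x + i y these are the rates in z' = (p + i q) z: p is half the
    logarithmic derivative of |z|^2 = u (2 - u), and q is the momentum divided by |z|^2. The bounds
    0 < u < 2 keep the denominators nonzero.\<close>
  define p where "p t = u' t * (1 - u t) / (u t * (2 - u t))" for t
  define q where "q t = c * \<delta> / (2 - u t)" for t
  define v where "v t = (4 * (lam + \<delta> * \<omega>) - c\<^sup>2) - 3 * (2 * lam + \<delta> * \<omega>) * u t + 2 * lam * (u t)\<^sup>2" for t
  define w where "w t = 4 * (lam + \<delta> * \<omega>) - c\<^sup>2 - 2 * (2 * lam + \<delta> * \<omega>) * u t + lam * (u t)\<^sup>2" for t
  have du': "(u' has_real_derivative u t * v t) (at t)" for t
    using du'[of t] by (simp add: v_def algebra_simps power2_eq_square power3_eq_cube)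
  have u'2: "u' t * u' t = (u t * u t) * w t" for t
    using u'2[of t] by (simp add: w_def power2_eq_square)
  have tang: "x t * x0 t + y t * y0 t = u' t * (1 - u t)" for t
  proof -
    have "((\<lambda>t. (x t)\<^sup>2 + (y t)\<^sup>2) has_real_derivative 2 * (x t * x0 t + y t * y0 t)) (at t)"
      by (rule derivative_eq_intros dx dy refl)+ (simp add: algebra_simps)
    moreover have "((\<lambda>t. (x t)\<^sup>2 + (y t)\<^sup>2) has_real_derivative 2 * (u' t * (1 - u t))) (at t)"
      unfolding sph by (rule derivative_eq_intros du refl)+ (simp add: algebra_simps)
    ultimately show ?thesis using DERIV_unique by fastforce
  qed
  have x0: "x0 t = p t * x t - q t * y t" and y0: "y0 t = p t * y t + q t * x t" for t
  proof -
    let ?r = "u t * (2 - u t)"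
    have r: "?r \<noteq> 0" using nz by simp
    have P: "?r * p t = u' t * (1 - u t)" and Q: "?r * q t = c * \<delta> * u t"
      using nz[of t] by (simp_all add: p_def q_def)
    have "?r * x0 t = x t * (x t * x0 t + y t * y0 t) - y t * (x t * y0 t - y t * x0 t)"
      "?r * y0 t = y t * (x t * x0 t + y t * y0 t) + x t * (x t * y0 t - y t * x0 t)"
      unfolding sph[of t, symmetric] by (simp_all add: algebra_simps power2_eq_square)
    moreover have "?r * (p t * x t - q t * y t) = (?r * p t) * x t - (?r * q t) * y t"
      "?r * (p t * y t + q t * x t) = (?r * p t) * y t + (?r * q t) * x t"
      by (simp_all only: right_diff_distrib distrib_left mult.assoc)
    ultimately have "?r * x0 t = ?r * (p t * x t - q t * y t)" "?r * y0 t = ?r * (p t * y t + q t * x t)"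
      unfolding tang mom P Q by (simp_all only: mult.commute[of "x t"] mult.commute[of "y t"])
    then show "x0 t = p t * x t - q t * y t" "y0 t = p t * y t + q t * x t"
      using iffD1[OF mult_left_cancel[OF r]] by blast+
  qed
  define p' where "p' t = ((u t * v t * (1 - u t) - u' t * u' t) * (u t * (2 - u t))
    - u' t * (1 - u t) * (u' t * (2 - 2 * u t))) / ((u t * (2 - u t)) * (u t * (2 - u t)))" for t
  define q' where "q' t = c * \<delta> * u' t / ((2 - u t) * (2 - u t))" for t
  have dp: "(p has_real_derivative p' t) (at t)" for t
  proof -
    have "((\<lambda>t. u' t * (1 - u t)) has_real_derivative u t * v t * (1 - u t) - u' t * u' t) (at t)"
      by (rule derivative_eq_intros du du' refl)+ (simp add: algebra_simps)
    moreover have "((\<lambda>t. u t * (2 - u t)) has_real_derivative u' t * (2 - 2 * u t)) (at t)"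
      by (rule derivative_eq_intros du refl)+ (simp add: algebra_simps)
    ultimately show ?thesis
      unfolding p_def p'_def by (rule DERIV_divide) (use nz in simp)
  qed
  have dq: "(q has_real_derivative q' t) (at t)" for t
  proof -
    have "((\<lambda>t. 2 - u t) has_real_derivative - u' t) (at t)"
      by (rule derivative_eq_intros du refl)+ simp
    from DERIV_divide[OF DERIV_const[of "c * \<delta>"] this] show ?thesis
      unfolding q_def q'_def using nz by simp
  qed
  define m where "m t = \<delta> * (1 - u t)" for t
  define m' where "m' t = - \<delta> * u' t" for t
  have energy: "(x0 t)\<^sup>2 + (m' t)\<^sup>2 + (y0 t)\<^sup>2 = lam * (u t * (2 - u t)) + 2 * (\<delta> * \<omega>) * u t" for t
  proof -
    have "(x0 t)\<^sup>2 + (y0 t)\<^sup>2 = (p t * p t + q t * q t) * ((x t)\<^sup>2 + (y t)\<^sup>2)"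
      unfolding x0 y0 by (simp add: algebra_simps power2_eq_square)
    also have "\<dots> = (u t * u t * w t * (1 - u t) * (1 - u t) + c\<^sup>2 * u t * u t) / (u t * (2 - u t))"
      unfolding sph p_def q_def using nz[of t]
      by (simp add: divide_simps u'2[symmetric]) (simp add: algebra_simps \<delta>2 power2_eq_square)
    finally have "(x0 t)\<^sup>2 + (y0 t)\<^sup>2 =
      (u t * u t * w t * (1 - u t) * (1 - u t) + c\<^sup>2 * u t * u t) / (u t * (2 - u t))" .
    moreover have "(m' t)\<^sup>2 = u t * u t * w t"
      using u'2[of t] \<delta> by (auto simp: m'_def power2_eq_square)
    moreover have "(u t * u t * w t * (1 - u t) * (1 - u t) + c\<^sup>2 * u t * u t) / (u t * (2 - u t)) + u t * u t * w t
      = lam * (u t * (2 - u t)) + 2 * (\<delta> * \<omega>) * u t"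
      using nz[of t] unfolding w_def
      by (simp add: divide_simps) (simp add: algebra_simps power2_eq_square)
    ultimately show ?thesis by simp
  qed
  define e where "e t = lam * (u t * (2 - u t)) + 2 * (\<delta> * \<omega>) * u t + lam * (u t * (2 - u t))" for t
  \<comment> \<open>One has z'' = (p' + p^2 - q^2 + i (q' + 2 p q)) z, while the system asks for z''
    = (lam + \<omega> m - e) z + i c (m z' - m' z). Dividing by z leaves two scalar identities: the
    real part here, the imaginary part in \<open>coeff2\<close>.\<close>
  have coeff1: "p' t + p t * p t - q t * q t = lam + \<omega> * m t - e t - c * m t * q t" for t
  proof -
    have "p' t + p t * p t = (v t * (1 - u t) * (2 - u t) - w t) / ((2 - u t) * (2 - u t))"
    proof -
      have "p' t = ((u t * v t * (1 - u t) - u' t * u' t) * (u t * (2 - u t))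
        - (1 - u t) * (2 - 2 * u t) * (u' t * u' t)) / ((u t * (2 - u t)) * (u t * (2 - u t)))"
        unfolding p'_def by (simp add: algebra_simps)
      moreover have "p t * p t = (1 - u t) * (1 - u t) * (u' t * u' t) / ((u t * (2 - u t)) * (u t * (2 - u t)))"
        unfolding p_def by (simp add: algebra_simps)
      ultimately have "p' t + p t * p t = ((u t * v t * (1 - u t) - u t * u t * w t) * (u t * (2 - u t))
        - (1 - u t) * (2 - 2 * u t) * (u t * u t * w t) + (1 - u t) * (1 - u t) * (u t * u t * w t))
        / ((u t * (2 - u t)) * (u t * (2 - u t)))"
        unfolding u'2 by (simp only: add_divide_distrib)
      also have "\<dots> = ((u t * u t) * (v t * (1 - u t) * (2 - u t) - w t)) / ((u t * u t) * ((2 - u t) * (2 - u t)))"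
        by (rule arg_cong2[where f = "(/)"]) (simp_all add: algebra_simps)
      also have "\<dots> = (v t * (1 - u t) * (2 - u t) - w t) / ((2 - u t) * (2 - u t))"
        using nz[of t] by simp
      finally show ?thesis .
    qed
    moreover have "(v t * (1 - u t) * (2 - u t) - w t) / ((2 - u t) * (2 - u t)) - q t * q t
      = lam + \<omega> * m t - e t - c * m t * q t"
      unfolding v_def w_def q_def e_def m_def using nz[of t] \<delta>
      by (auto simp add: divide_simps) (simp_all add: algebra_simps power2_eq_square)
    ultimately show ?thesis by simp
  qed
  have coeff2: "q' t + 2 * p t * q t = c * (m t * p t - m' t)" for t
    unfolding q'_def p_def q_def m_def m'_def using nz[of t]
    by (simp add: divide_simps) (simp add: algebra_simps)
  have e: "(x0 t)\<^sup>2 + (m' t)\<^sup>2 + (y0 t)\<^sup>2 + lam * ((x t)\<^sup>2 + (y t)\<^sup>2) = e t" for t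
    unfolding energy sph e_def ..
  have "tw_profile lam c \<omega> x m y x0 m' y0"
  proof (rule tw_profileI[OF dx _ dy _ e])
    fix t
    show "(m has_real_derivative m' t) (at t)"
      unfolding m_def m'_def by (rule derivative_eq_intros du refl)+ simp
    show "(x t)\<^sup>2 + (m t)\<^sup>2 + (y t)\<^sup>2 = 1"
      using sph[of t] \<delta> by (auto simp: m_def power2_eq_square algebra_simps)
    have "(x0 has_real_derivative p' t * x t + p t * x0 t - (q' t * y t + q t * y0 t)) (at t)"
      (is "(_ has_real_derivative ?d) _")
      unfolding x0[abs_def] by (rule derivative_eq_intros dx dy dp dq refl)+ (simp add: x0 y0 algebra_simps)
    also have "?d = (p' t + p t * p t - q t * q t) * x t - (q' t + 2 * p t * q t) * y t"
      by (simp add: x0 y0 algebra_simps)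
    also have "\<dots> = (lam + \<omega> * m t - e t) * x t - c * (m t * y0 t - m' t * y t)"
      unfolding coeff1 coeff2 by (simp add: x0 y0 algebra_simps)
    finally show "(x0 has_real_derivative (lam + \<omega> * m t - e t) * x t - c * (m t * y0 t - m' t * y t)) (at t)" .
    have "(y0 has_real_derivative p' t * y t + p t * y0 t + (q' t * x t + q t * x0 t)) (at t)"
      (is "(_ has_real_derivative ?d) _")
      unfolding y0[abs_def] by (rule derivative_eq_intros dx dy dp dq refl)+ (simp add: x0 y0 algebra_simps)
    also have "?d = (p' t + p t * p t - q t * q t) * y t + (q' t + 2 * p t * q t) * x t"
      by (simp add: x0 y0 algebra_simps)
    also have "\<dots> = (lam + \<omega> * m t - e t) * y t + c * (m t * x0 t - m' t * x t)"
      unfolding coeff1 coeff2 by (simp add: x0 y0 algebra_simps)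
    finally show "(y0 has_real_derivative (lam + \<omega> * m t - e t) * y t + c * (m t * x0 t - m' t * x t)) (at t)" .
    have "(m' has_real_derivative - \<delta> * (u t * v t)) (at t)"
      unfolding m'_def by (rule DERIV_cmult[OF du'])
    also have "- \<delta> * (u t * v t) = c * (x t * y0 t - y t * x0 t) - e t * m t - \<omega> * (u t * (2 - u t))"
      unfolding mom v_def m_def e_def using \<delta> by (auto simp: algebra_simps power2_eq_square)
    finally show "(m' has_real_derivative c * (x t * y0 t - y t * x0 t) - e t * m t - \<omega> * ((x t)\<^sup>2 + (y t)\<^sup>2)) (at t)"
      unfolding sph .
  qed
  moreover have "first_integrals lam c \<omega> \<delta> x m y x0 m' y0"
    unfolding first_integrals_def energy mom m_def
    using \<delta> by (auto simp: algebra_simps power2_eq_square)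
  ultimately show ?thesis unfolding m_def[abs_def] by blast
qed

lemma DERIV_shift_minus:
  fixes f :: "real \<Rightarrow> real"
  assumes "(f has_real_derivative d) (at (t - a))"
  shows "((\<lambda>t. f (t - a)) has_real_derivative d) (at t)"
proof -
  have "((\<lambda>t. f (t - a)) has_real_derivative d * 1) (at t)"
    by (rule DERIV_chain2[where f = f and g = "\<lambda>t. t - a", OF assms]) (auto intro!: derivative_eq_intros)
  then show ?thesis by simp
qed

text \<open>Rotations preserve x^2 + y^2, x'^2 + y'^2 and x y' - y x', hence the multiplier and both
  first integrals; for a given multiplier and given m the equations for (x, y) are linear and
  commute with rotations.\<close>

lemma tw_soliton_rigid_motion:
  assumes sol: "tw_soliton lam c \<omega> \<delta> x m y"
  shows "tw_soliton lam c \<omega> \<delta> (\<lambda>t. cos \<theta> * x (t - a) - sin \<theta> * y (t - a)) (\<lambda>t. m (t - a))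
    (\<lambda>t. sin \<theta> * x (t - a) + cos \<theta> * y (t - a))"
proof -
  from sol obtain x' m' y' s where prof: "tw_profile lam c \<omega> x m y x' m' y'"
    and fi: "first_integrals lam c \<omega> \<delta> x m y x' m' y'"
    and int: "integrable lebesgue (\<lambda>t. (x t)\<^sup>2 + (y t)\<^sup>2 + (x' t)\<^sup>2 + (m' t)\<^sup>2 + (y' t)\<^sup>2)"
    and s: "(m s)\<^sup>2 \<noteq> 1"
    unfolding tw_soliton_def by blast
  note d = tw_profileD[OF prof]
  define C where "C = cos \<theta>"
  define S where "S = sin \<theta>"
  have CS: "C * C + S * S = 1" "C\<^sup>2 + S\<^sup>2 = 1" by (simp_all add: C_def S_def flip: power2_eq_square)
  define X where "X t = C * x (t - a) - S * y (t - a)" for t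
  define Y where "Y t = S * x (t - a) + C * y (t - a)" for t
  define X' where "X' t = C * x' (t - a) - S * y' (t - a)" for t
  define Y' where "Y' t = S * x' (t - a) + C * y' (t - a)" for t
  have rot: "(C * p - S * q)\<^sup>2 + (S * p + C * q)\<^sup>2 = p\<^sup>2 + q\<^sup>2" for p q
  proof -
    have "(C * p - S * q)\<^sup>2 + (S * p + C * q)\<^sup>2 = (C * C + S * S) * (p\<^sup>2 + q\<^sup>2)"
      by (simp add: algebra_simps power2_eq_square)
    then show ?thesis using CS by simp
  qed
  have XY: "(X t)\<^sup>2 + (Y t)\<^sup>2 = (x (t - a))\<^sup>2 + (y (t - a))\<^sup>2"
    and XY': "(X' t)\<^sup>2 + (Y' t)\<^sup>2 = (x' (t - a))\<^sup>2 + (y' (t - a))\<^sup>2" for t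
    by (simp_all add: X_def Y_def X'_def Y'_def rot)
  have mom: "X t * Y' t - Y t * X' t = x (t - a) * y' (t - a) - y (t - a) * x' (t - a)" for t
  proof -
    have "X t * Y' t - Y t * X' t = (C * C + S * S) * (x (t - a) * y' (t - a) - y (t - a) * x' (t - a))"
      by (simp add: X_def Y_def X'_def Y'_def algebra_simps)
    then show ?thesis using CS by simp
  qed
  define e where "e t = (x' t)\<^sup>2 + (m' t)\<^sup>2 + (y' t)\<^sup>2 + lam * ((x t)\<^sup>2 + (y t)\<^sup>2)" for t
  have e: "(X' t)\<^sup>2 + (m' (t - a))\<^sup>2 + (Y' t)\<^sup>2 + lam * ((X t)\<^sup>2 + (Y t)\<^sup>2) = e (t - a)" for t
    using XY[of t] XY'[of t] by (simp add: e_def)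
  note ds = d(1-6)[folded e_def, THEN DERIV_shift_minus]
  have "tw_profile lam c \<omega> X (\<lambda>t. m (t - a)) Y X' (\<lambda>t. m' (t - a)) Y'"
  proof (rule tw_profileI[OF _ _ _ _ e])
    fix t
    show "(X has_real_derivative X' t) (at t)" "(Y has_real_derivative Y' t) (at t)"
      unfolding X_def X'_def Y_def Y'_def by (rule derivative_eq_intros ds refl | simp)+
    show "((\<lambda>t. m (t - a)) has_real_derivative m' (t - a)) (at t)" by (rule ds)
    show "(X t)\<^sup>2 + (m (t - a))\<^sup>2 + (Y t)\<^sup>2 = 1" using XY[of t] d(7)[of "t - a"] by simp
    show "((\<lambda>t. m' (t - a)) has_real_derivative c * (X t * Y' t - Y t * X' t)
      - e (t - a) * m (t - a) - \<omega> * ((X t)\<^sup>2 + (Y t)\<^sup>2)) (at t)"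
      unfolding XY mom by (rule ds(5))
    show "(X' has_real_derivative (lam + \<omega> * m (t - a) - e (t - a)) * X t
       - c * (m (t - a) * Y' t - m' (t - a) * Y t)) (at t)"
      unfolding X_def X'_def Y_def Y'_def
      by (rule derivative_eq_intros ds refl)+ (simp add: algebra_simps)
    show "(Y' has_real_derivative (lam + \<omega> * m (t - a) - e (t - a)) * Y t
       + c * (m (t - a) * X' t - m' (t - a) * X t)) (at t)"
      unfolding X_def X'_def Y_def Y'_def
      by (rule derivative_eq_intros ds refl)+ (simp add: algebra_simps)
  qed
  moreover have "first_integrals lam c \<omega> \<delta> X (\<lambda>t. m (t - a)) Y X' (\<lambda>t. m' (t - a)) Y'"
    unfolding first_integrals_def mom
  proof (intro allI conjI)
    fix t
    have "(X' t)\<^sup>2 + (m' (t - a))\<^sup>2 + (Y' t)\<^sup>2 = (x' (t - a))\<^sup>2 + (m' (t - a))\<^sup>2 + (y' (t - a))\<^sup>2"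
      using XY'[of t] by simp
    also have "\<dots> = lam * (1 - (m (t - a))\<^sup>2) + 2 * \<omega> * (\<delta> - m (t - a))"
      using fi by (simp add: first_integrals_def)
    finally show "(X' t)\<^sup>2 + (m' (t - a))\<^sup>2 + (Y' t)\<^sup>2 = lam * (1 - (m (t - a))\<^sup>2) + 2 * \<omega> * (\<delta> - m (t - a))" .
    show "x (t - a) * y' (t - a) - y (t - a) * x' (t - a) = c * (\<delta> - m (t - a))"
      using fi by (simp add: first_integrals_def)
  qed
  moreover have "integrable lebesgue (\<lambda>t. (X t)\<^sup>2 + (Y t)\<^sup>2 + (X' t)\<^sup>2 + (m' (t - a))\<^sup>2 + (Y' t)\<^sup>2)"
  proof -
    define Q where "Q t = (x t)\<^sup>2 + (y t)\<^sup>2 + (x' t)\<^sup>2 + (m' t)\<^sup>2 + (y' t)\<^sup>2" for t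
    have "continuous_on UNIV Q"
      unfolding Q_def
      by (intro continuous_intros continuous_at_imp_continuous_on ballI DERIV_isCont[OF d(1)]
          DERIV_isCont[OF d(3)] DERIV_isCont[OF d(4)] DERIV_isCont[OF d(5)] DERIV_isCont[OF d(6)])
    \<comment> \<open>The affine substitution is carried out for \<open>lborel\<close>; continuity
      makes Q Borel, so its integrability can be moved to \<open>lborel\<close> and back.\<close>
    then have "Q \<in> borel_measurable lborel" by (auto intro: borel_measurable_continuous_onI)
    moreover have "integrable lebesgue Q" using int by (simp add: Q_def[abs_def])
    ultimately have "integrable lborel Q" by (simp add: integrable_completion)
    then have i: "integrable lborel (\<lambda>t. Q (- a + 1 * t))"
      by (rule lborel_integrable_real_affine) simp
    then have "integrable lebesgue (\<lambda>t. Q (- a + 1 * t))"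
      using integrable_completion[OF borel_measurable_integrable[OF i]] by simp
    moreover have "Q (- a + 1 * t) = (X t)\<^sup>2 + (Y t)\<^sup>2 + (X' t)\<^sup>2 + (m' (t - a))\<^sup>2 + (Y' t)\<^sup>2" for t
      using XY[of t] XY'[of t] by (simp add: Q_def)
    ultimately show ?thesis by simp
  qed
  moreover have "(m (s + a - a))\<^sup>2 \<noteq> 1" using s by simp
  ultimately show ?thesis
    unfolding tw_soliton_def X_def[abs_def] Y_def[abs_def] C_def S_def by blast
qed

section \<open>The soliton family and its phase\<close>

lemma soliton_range_facts:
  assumes lam: "lam > 0" and \<delta>: "\<delta> \<in> {1, -1}" and range: "soliton_range lam c \<omega> \<delta>"
  defines "k2 \<equiv> 4 * (lam + \<delta> * \<omega>) - c\<^sup>2" and "S \<equiv> sqrt (lam * c\<^sup>2 + \<omega>\<^sup>2)"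
  shows "0 < k2" "0 < 2 * lam + \<delta> * \<omega>" "0 < S" "0 < 2 * S + c\<^sup>2 - 2 * \<delta> * \<omega>"
    "0 \<le> 2 * S - c\<^sup>2 + 2 * \<delta> * \<omega>" "S\<^sup>2 = (2 * lam + \<delta> * \<omega>)\<^sup>2 - lam * k2"
    "(2 * S + c\<^sup>2 - 2 * \<delta> * \<omega>) * (2 * S - c\<^sup>2 + 2 * \<delta> * \<omega>) = c\<^sup>2 * k2"
proof -
  from range have k2: "0 < k2" by (auto simp: soliton_range_def k2_def mult.commute)
  then show "0 < k2" .
  have "0 < 4 * (lam + a) - b \<Longrightarrow> 0 \<le> b \<Longrightarrow> 0 < 2 * lam + a" for a b
    using lam by (simp add: algebra_simps)
  from this[OF k2[unfolded k2_def] zero_le_power2] show "0 < 2 * lam + \<delta> * \<omega>" .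
  have S2: "S\<^sup>2 = lam * c\<^sup>2 + \<omega>\<^sup>2" using lam by (simp add: S_def)
  then show "S\<^sup>2 = (2 * lam + \<delta> * \<omega>)\<^sup>2 - lam * k2"
    unfolding k2_def using \<delta> by (auto simp: algebra_simps power2_eq_square)
  have nz: "c \<noteq> 0 \<or> \<delta> * \<omega> < 0" using range by (auto simp: soliton_range_def mult.commute)
  have "0 < lam * c\<^sup>2 + \<omega>\<^sup>2"
  proof (cases "c = 0")
    case True
    then have "\<omega> \<noteq> 0" using nz by auto
    then show ?thesis using lam by (simp add: add_nonneg_pos)
  next
    case False
    then show ?thesis using lam by (simp add: add_pos_nonneg)
  qed
  then show S: "0 < S" by (simp add: S_def)
  have "\<bar>\<omega>\<bar> \<le> S"
    unfolding S_def using lam by (intro real_le_rsqrt) simp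
  then have "\<delta> * \<omega> \<le> S" "- S \<le> \<delta> * \<omega>" using \<delta> by auto
  \<comment> \<open>For c = 0 and \<delta> \<omega> \<ge> 0 one would have S = \<delta> \<omega> and
    this quantity would be 0; \<open>soliton_range\<close> excludes that case.\<close>
  show A2: "0 < 2 * S + c\<^sup>2 - 2 * \<delta> * \<omega>"
  proof (cases "c = 0")
    case True
    then have "\<delta> * \<omega> < 0" using nz by simp
    then show ?thesis using S True by simp
  next
    case False
    then have "0 < c\<^sup>2 + 2 * (S - \<delta> * \<omega>)"
      using \<open>\<delta> * \<omega> \<le> S\<close> by (intro add_pos_nonneg) simp_all
    then show ?thesis by (simp add: algebra_simps)
  qed
  have "(2 * S + c\<^sup>2 - 2 * \<delta> * \<omega>) * (2 * S - c\<^sup>2 + 2 * \<delta> * \<omega>) = 4 * S\<^sup>2 - (c\<^sup>2 - 2 * (\<delta> * \<omega>))\<^sup>2"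
    by (simp add: algebra_simps power2_eq_square)
  also have "\<dots> = c\<^sup>2 * k2"
    unfolding S2 k2_def using \<delta> by (auto simp: algebra_simps power2_eq_square)
  finally show prod: "(2 * S + c\<^sup>2 - 2 * \<delta> * \<omega>) * (2 * S - c\<^sup>2 + 2 * \<delta> * \<omega>) = c\<^sup>2 * k2" .
  have "0 \<le> (2 * S + c\<^sup>2 - 2 * \<delta> * \<omega>) * (2 * S - c\<^sup>2 + 2 * \<delta> * \<omega>)"
    unfolding prod using k2 by simp
  then show "0 \<le> 2 * S - c\<^sup>2 + 2 * \<delta> * \<omega>" using A2 by (simp add: zero_le_mult_iff)
qed

lemma sqrt_diff_quarter: "sqrt (a - b / 4) = sqrt (4 * a - b) / 2"
proof -
  have "sqrt (a - b / 4) = sqrt ((4 * a - b) / 4)" by (simp add: field_simps)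
  then show ?thesis by (simp add: real_sqrt_divide)
qed

text \<open>The hyperbolic argument in the numerator is k / 2, where k is the rate in the
  denominator; double-angle formulas can then relate the two.\<close>

lemma soliton_check_polar:
  assumes "0 < 4 * (lam + \<delta> * \<omega>) - c\<^sup>2"
  defines "k \<equiv> sqrt (4 * (lam + \<delta> * \<omega>) - c\<^sup>2)" and "S \<equiv> sqrt (lam * c\<^sup>2 + \<omega>\<^sup>2)"
  shows "soliton_check lam c \<omega> \<delta> t = of_real (k / (2 * lam + \<delta> * \<omega> + S * cosh (k * t))) * cis (c * \<delta> * t / 2) *
    Complex (sqrt (2 * S + c\<^sup>2 - 2 * \<delta> * \<omega>) * cosh (k / 2 * t))
      (sgn c * \<delta> * sqrt (2 * S - c\<^sup>2 + 2 * \<delta> * \<omega>) * sinh (k / 2 * t))"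
proof -
  show ?thesis
    unfolding soliton_check_def sqrt_diff_quarter k_def[symmetric] S_def[symmetric] cis_conv_exp Complex_eq
    by simp
qed

text \<open>In the open right half-plane the arctangent of the slope is an argument, and no branch
  has to be chosen.\<close>

lemma Complex_eq_norm_times_arctan:
  assumes "0 < p"
  shows "Complex p q = of_real (cmod (Complex p q)) * cis (arctan (q / p))"
proof -
  define n where "n = sqrt (1 + (q / p)\<^sup>2)"
  have "1 \<le> 1 + (q / p)\<^sup>2" by simp
  then have n: "0 < n" unfolding n_def by (smt (verit) real_sqrt_gt_0_iff)
  have "cmod (Complex p q) = sqrt (p\<^sup>2 * (1 + (q / p)\<^sup>2))"
    using assms by (simp add: complex_norm power_divide algebra_simps)
  also have "\<dots> = p * n" using assms by (simp add: real_sqrt_mult n_def)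
  finally have *: "cmod (Complex p q) = p * n" .
  show ?thesis
    unfolding * using n assms
    by (simp add: complex_eq_iff cos_arctan sin_arctan n_def[symmetric])
qed

text \<open>The last factor of the polar form has positive real part, so an arctangent serves as its
  argument for all t and the lift is global. For c nonzero, sgn c \<delta> is 1 or -1 and moves out
  of the arctangent by oddness.\<close>

theorem soliton_check_lift:
  assumes lam: "lam > 0" and \<delta>: "\<delta> \<in> {1, -1}" and range: "soliton_range lam c \<omega> \<delta>" and c: "c \<noteq> 0"
  shows "soliton_check lam c \<omega> \<delta> t = of_real (cmod (soliton_check lam c \<omega> \<delta> t))
    * exp (\<i> * of_real (soliton_phase lam c \<omega> \<delta> t))"
proof -
  define S where "S = sqrt (lam * c\<^sup>2 + \<omega>\<^sup>2)"
  define k where "k = sqrt (4 * (lam + \<delta> * \<omega>) - c\<^sup>2)"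
  note facts = soliton_range_facts[OF lam \<delta> range, folded S_def]
  define A where "A = 2 * S + c\<^sup>2 - 2 * \<delta> * \<omega>"
  define B where "B = 2 * S - c\<^sup>2 + 2 * \<delta> * \<omega>"
  have A: "0 < A" and B: "0 \<le> B" using facts by (auto simp: A_def B_def)
  have k: "0 < k" using facts(1) by (simp add: k_def)
  define g where "g = k / (2 * lam + \<delta> * \<omega> + S * cosh (k * t))"
  have g: "0 < g" using facts(2,3) k by (auto simp: g_def intro!: divide_pos_pos add_pos_pos)
  define p where "p = sqrt A * cosh (k / 2 * t)"
  define q where "q = sgn c * \<delta> * sqrt B * sinh (k / 2 * t)"
  have p: "0 < p" using A by (simp add: p_def)
  have chk: "soliton_check lam c \<omega> \<delta> t = of_real g * cis (c * \<delta> * t / 2) * Complex p q"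
    unfolding soliton_check_polar[OF facts(1)] g_def p_def q_def k_def[symmetric] S_def[symmetric] A_def B_def by simp
  have "q / p = sgn c * \<delta> * (sqrt (B / A) * tanh (k / 2 * t))"
    by (simp add: p_def q_def tanh_def real_sqrt_divide)
  moreover have "sgn c * \<delta> = 1 \<or> sgn c * \<delta> = -1" using c \<delta> by (auto simp: sgn_if)
  ultimately have "arctan (q / p) = sgn c * \<delta> * arctan (sqrt (B / A) * tanh (k / 2 * t))"
    by (auto simp: arctan_minus)
  then have phase: "soliton_phase lam c \<omega> \<delta> t = c * \<delta> * t / 2 + arctan (q / p)"
    unfolding soliton_phase_def sqrt_diff_quarter k_def[symmetric] S_def[symmetric] A_def B_def by simp
  have "cmod (soliton_check lam c \<omega> \<delta> t) = g * cmod (Complex p q)"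
    unfolding chk using g by (simp add: norm_mult)
  then have "of_real (cmod (soliton_check lam c \<omega> \<delta> t)) * exp (\<i> * of_real (soliton_phase lam c \<omega> \<delta> t))
    = of_real g * cis (c * \<delta> * t / 2) * (of_real (cmod (Complex p q)) * cis (arctan (q / p)))"
    unfolding phase cis_conv_exp by (simp add: distrib_left exp_add)
  also have "\<dots> = soliton_check lam c \<omega> \<delta> t"
    unfolding chk Complex_eq_norm_times_arctan[OF p, symmetric] by simp
  finally show ?thesis by simp
qed

lemma rotation_square_sum:
  fixes g a b r s :: real
  shows "(g * (a * r - b * s))\<^sup>2 + (g * (b * r + a * s))\<^sup>2 = (g * g) * ((r * r + s * s) * (b * b + a * a))"
  by (simp add: algebra_simps power2_eq_square)

text \<open>For z = g (a + i b) (r + i s), with a + i b rotating at rate q, the left-hand side is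
  the imaginary part of the conjugate of z times z'. The terms with g' cancel, as they only change
  the modulus; the rotation contributes q (r^2 + s^2) and the last factor r s' - s r'.\<close>

lemma rotation_momentum:
  fixes g a b r s q g' r' s' :: real
  shows "g * (a * r - b * s) * (g' * (b * r + a * s) + g * (b * r' + a * q * r - b * q * s + a * s'))
    - g * (b * r + a * s) * (g' * (a * r - b * s) + g * (a * r' - b * q * r - a * q * s - b * s'))
    = (g * g) * ((b * b + a * a) * (q * (r * r + s * s) + (r * s' - s * r')))"
  by (simp add: algebra_simps)

text \<open>Through \<open>tw_profile_from_component\<close> the verification reduces to the
  equation for u = k2 / D and to the modulus and momentum of g exp(i \<psi>) (r + i s); second
  derivatives of the complex profile never appear.\<close>

theorem tw_soliton_soliton:
  assumes lam: "lam > 0" and \<delta>: "\<delta> \<in> {1, -1}" and range: "soliton_range lam c \<omega> \<delta>"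
  shows "tw_soliton lam c \<omega> \<delta> (\<lambda>t. Re (soliton_check lam c \<omega> \<delta> t)) (soliton_2 lam c \<omega> \<delta>)
    (\<lambda>t. Im (soliton_check lam c \<omega> \<delta> t))"
proof -
  define S where "S = sqrt (lam * c\<^sup>2 + \<omega>\<^sup>2)"
  define k2 where "k2 = 4 * (lam + \<delta> * \<omega>) - c\<^sup>2"
  define k where "k = sqrt k2"
  define \<alpha> where "\<alpha> = 2 * lam + \<delta> * \<omega>"
  define A where "A = 2 * S + c\<^sup>2 - 2 * \<delta> * \<omega>"
  define B where "B = 2 * S - c\<^sup>2 + 2 * \<delta> * \<omega>"
  note facts = soliton_range_facts[OF lam \<delta> range, folded S_def k2_def \<alpha>_def, folded A_def B_def]
  have k: "0 < k" "k * k = k2" using facts(1) by (auto simp: k_def)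
  define C where "C t = cosh (k * t)" for t
  define H where "H t = sinh (k * t)" for t
  have C1: "1 \<le> C t" for t by (simp add: C_def cosh_real_ge_1)
  have CH: "C t * C t = H t * H t + 1" for t
    using cosh_square_eq[of "k * t"] by (simp add: C_def H_def power2_eq_square)
  define D where "D t = \<alpha> + S * C t" for t
  have D: "0 < D t" for t
    using facts(2,3) C1[of t] by (auto simp: D_def intro!: add_pos_pos mult_pos_pos)
  have dC: "(C has_real_derivative k * H t) (at t)" and dH: "(H has_real_derivative k * C t) (at t)" for t
    unfolding C_def H_def by (auto intro!: derivative_eq_intros)
  have dD: "(D has_real_derivative S * (k * H t)) (at t)" for t
    unfolding D_def by (rule derivative_eq_intros dC refl)+ simp
  define u where "u t = k2 / D t" for t
  define u' where "u' t = - (k2 * (S * (k * H t))) / (D t * D t)" for t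
  \<comment> \<open>Eliminates sinh^2 in favour of the denominator D by S^2 = \<alpha>^2 - lam k2;
    the equations for u become identities between rational functions of D.\<close>
  have SH: "S * S * (H t * H t) = D t * D t - 2 * \<alpha> * D t + lam * k2" for t
  proof -
    have "S * S * (H t * H t) = (S * C t) * (S * C t) - S * S"
      using CH[of t] by (simp add: algebra_simps)
    then show ?thesis using facts(6) by (simp add: D_def algebra_simps power2_eq_square)
  qed
  have du: "(u has_real_derivative u' t) (at t)" for t
    using DERIV_divide[OF DERIV_const[of k2] dD, of t] D[of t]
    by (simp add: u_def[abs_def] u'_def)
  have du': "(u' has_real_derivative
      k2 * u t - 3 * \<alpha> * (u t)\<^sup>2 + 2 * lam * (u t) ^ 3) (at t)" for t
  proof -
    have n: "((\<lambda>t. - (k2 * (S * (k * H t)))) has_real_derivative - (k2 * S * (k * k) * C t)) (at t)"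
      by (rule derivative_eq_intros dH refl)+ (simp add: algebra_simps)
    have d: "((\<lambda>t. D t * D t) has_real_derivative 2 * (D t * (S * (k * H t)))) (at t)"
      by (rule derivative_eq_intros dD refl)+ (simp add: algebra_simps)
    have "(u' has_real_derivative (- (k2 * S * (k * k) * C t) * (D t * D t)
      - - (k2 * (S * (k * H t))) * (2 * (D t * (S * (k * H t))))) / ((D t * D t) * (D t * D t))) (at t)"
      (is "(_ has_real_derivative ?d) _")
      unfolding u'_def using D[of t] by (intro DERIV_divide n d) simp
    also have "?d = (- (k2 * (k * k) * (D t - \<alpha>)) * (D t * D t) + 2 * k2 * (k * k) * D t * (S * S * (H t * H t)))
      / ((D t * D t) * (D t * D t))"
      by (rule arg_cong2[where f = "(/)"]) (simp_all add: D_def algebra_simps)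
    also have "\<dots> = k2 * u t - 3 * \<alpha> * (u t)\<^sup>2 + 2 * lam * (u t) ^ 3"
      unfolding SH k(2) u_def using D[of t]
      by (simp add: field_simps power2_eq_square power3_eq_cube)
    finally show ?thesis .
  qed
  have u'2: "(u' t)\<^sup>2 = (u t)\<^sup>2 * (k2 - 2 * \<alpha> * u t + lam * (u t)\<^sup>2)" for t
  proof -
    have "(u' t)\<^sup>2 = k2 * k2 * (k * k) * (S * S * (H t * H t)) / ((D t * D t) * (D t * D t))"
      unfolding u'_def by (simp add: power2_eq_square algebra_simps)
    also have "\<dots> = (u t)\<^sup>2 * (k2 - 2 * \<alpha> * u t + lam * (u t)\<^sup>2)"
      unfolding SH k(2) u_def using D[of t] by (simp add: field_simps power2_eq_square)
    finally show ?thesis .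
  qed
  have u0: "0 < u t" for t using D[of t] facts(1) by (simp add: u_def)
  have u2: "u t < 2" for t
  proof -
    \<comment> \<open>2 \<alpha> + 2 S - k2 equals A, whose positivity keeps the profile off the
      pole m = -\<delta>, where u = 2.\<close>
    have "k2 < 2 * \<alpha> + 2 * S" using facts(4) unfolding A_def k2_def \<alpha>_def by simp
    also have "\<dots> \<le> 2 * D t" using facts(3) C1[of t] by (simp add: D_def)
    finally show ?thesis using D[of t] by (simp add: u_def field_simps)
  qed
  define g where "g t = k / D t" for t
  define g' where "g' t = - (k * (S * (k * H t))) / (D t * D t)" for t
  have dg: "(g has_real_derivative g' t) (at t)" for t
    using DERIV_divide[OF DERIV_const[of k] dD, of t] D[of t]
    by (simp add: g_def[abs_def] g'_def)
  define \<sigma> where "\<sigma> = sgn c * \<delta>"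
  define r where "r t = sqrt A * cosh (k / 2 * t)" for t
  define r' where "r' t = sqrt A * (k / 2 * sinh (k / 2 * t))" for t
  define s where "s t = \<sigma> * sqrt B * sinh (k / 2 * t)" for t
  define s' where "s' t = \<sigma> * sqrt B * (k / 2 * cosh (k / 2 * t))" for t
  have dr: "(r has_real_derivative r' t) (at t)" and ds: "(s has_real_derivative s' t) (at t)" for t
    unfolding r_def r'_def s_def s'_def by (auto intro!: derivative_eq_intros)
  define \<psi> where "\<psi> t = c * \<delta> * t / 2" for t
  have d\<psi>: "(\<psi> has_real_derivative c * \<delta> / 2) (at t)" for t
    unfolding \<psi>_def by (auto intro!: derivative_eq_intros)
  have chk: "soliton_check lam c \<omega> \<delta> t = of_real (g t) * cis (\<psi> t) * Complex (r t) (s t)" for t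
    using soliton_check_polar[of lam \<delta> \<omega> c t, folded k2_def] facts(1)
    unfolding g_def \<psi>_def r_def s_def D_def C_def \<alpha>_def \<sigma>_def A_def B_def S_def k_def k2_def by simp
  define x where "x t = g t * (cos (\<psi> t) * r t - sin (\<psi> t) * s t)" for t
  define y where "y t = g t * (sin (\<psi> t) * r t + cos (\<psi> t) * s t)" for t
  define x0 where "x0 t = g' t * (cos (\<psi> t) * r t - sin (\<psi> t) * s t) + g t *
    (cos (\<psi> t) * r' t - sin (\<psi> t) * (c * \<delta> / 2) * r t - cos (\<psi> t) * (c * \<delta> / 2) * s t - sin (\<psi> t) * s' t)" for t
  define y0 where "y0 t = g' t * (sin (\<psi> t) * r t + cos (\<psi> t) * s t) + g t *
    (sin (\<psi> t) * r' t + cos (\<psi> t) * (c * \<delta> / 2) * r t - sin (\<psi> t) * (c * \<delta> / 2) * s t + cos (\<psi> t) * s' t)" for t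
  have dx: "(x has_real_derivative x0 t) (at t)" and dy: "(y has_real_derivative y0 t) (at t)" for t
    unfolding x_def x0_def y_def y0_def
    by (rule derivative_eq_intros dg dr ds d\<psi> refl | simp add: algebra_simps)+
  have trig: "sin (\<psi> t) * sin (\<psi> t) = 1 - cos (\<psi> t) * cos (\<psi> t)" for t
    using sin_cos_squared_add[of "\<psi> t"] by (simp add: power2_eq_square)
  have gg: "g t * g t = u t / D t" for t
    using k(2) by (simp add: g_def u_def)
  \<comment> \<open>For c = 0 the factor \<sigma>^2 is 0 rather than 1, but A B = c^2 k2 = 0 and A >
    0 make B vanish as well, so the value of sgn 0 does no harm.\<close>
  have \<sigma>B: "\<sigma> * \<sigma> * B = B"
  proof (cases "c = 0")
    case True
    then have "A * B = 0" using facts(7) by simp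
    then have "B = 0" using facts(4) by simp
    then show ?thesis by simp
  next
    case False
    then have "\<sigma> * \<sigma> = 1" using \<delta> by (auto simp: \<sigma>_def sgn_if)
    then show ?thesis by simp
  qed
  have half: "cosh (k / 2 * t) * cosh (k / 2 * t) = (C t + 1) / 2"
    "sinh (k / 2 * t) * sinh (k / 2 * t) = (C t - 1) / 2" for t
    using cosh_double_cosh[of "k / 2 * t"] cosh_square_eq[of "k / 2 * t"]
    by (simp_all add: C_def power2_eq_square)
  \<comment> \<open>The half-angle formulas give (A + B) / 2 cosh (k t) + (A - B) / 2, with (A + B)
    / 2 = 2 S and (A - B) / 2 = c^2 - 2 \<delta> \<omega>.\<close>
  have rs: "r t * r t + s t * s t = 2 * D t - k2" for t
  proof -
    have "r t * r t + s t * s t = (sqrt A * sqrt A) * (cosh (k / 2 * t) * cosh (k / 2 * t))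
      + \<sigma> * \<sigma> * (sqrt B * sqrt B) * (sinh (k / 2 * t) * sinh (k / 2 * t))"
      by (simp only: r_def s_def mult_ac)
    also have "\<dots> = A * ((C t + 1) / 2) + B * ((C t - 1) / 2)"
      unfolding half using facts(4,5) \<sigma>B by simp
    also have "\<dots> = 2 * D t - k2"
      unfolding A_def B_def D_def k2_def \<alpha>_def by (simp add: field_simps)
    finally show ?thesis .
  qed
  \<comment> \<open>A B = c^2 k2 gives sqrt A sqrt B = |c| k, and the factor sgn c in \<sigma>
    restores the sign of c.\<close>
  have rs': "r t * s' t - s t * r' t = c * \<delta> / 2 * k2" for t
  proof -
    have "r t * s' t - s t * r' t = \<sigma> * (sqrt A * sqrt B) * (k / 2) *
      (cosh (k / 2 * t) * cosh (k / 2 * t) - sinh (k / 2 * t) * sinh (k / 2 * t))"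
      by (simp add: r_def s_def r'_def s'_def algebra_simps)
    also have "\<dots> = \<sigma> * (sqrt A * sqrt B) * (k / 2)" unfolding half by (simp add: field_simps)
    also have "sqrt A * sqrt B = sqrt (c\<^sup>2 * k2)" using facts(7) by (simp flip: real_sqrt_mult)
    also have "\<dots> = \<bar>c\<bar> * k" by (simp add: real_sqrt_mult k_def)
    also have "\<sigma> * (\<bar>c\<bar> * k) * (k / 2) = (sgn c * \<bar>c\<bar>) * \<delta> * (k * k) / 2"
      by (simp add: \<sigma>_def)
    also have "\<dots> = c * \<delta> / 2 * k2" unfolding k(2) by (simp add: sgn_mult_abs)
    finally show ?thesis .
  qed
  have sph: "(x t)\<^sup>2 + (y t)\<^sup>2 = u t * (2 - u t)" for t
  proof -
    have "(x t)\<^sup>2 + (y t)\<^sup>2 = (g t * g t) * ((r t * r t + s t * s t) * (sin (\<psi> t) * sin (\<psi> t) + cos (\<psi> t) * cos (\<psi> t)))"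
      unfolding x_def y_def by (rule rotation_square_sum)
    also have "\<dots> = u t / D t * (2 * D t - k2)" unfolding gg rs trig by simp
    also have "\<dots> = u t * (2 - u t)" using D[of t] by (simp add: u_def field_simps)
    finally show ?thesis .
  qed
  \<comment> \<open>Up to the factor u / D, the phase factor contributes c \<delta> / 2 (2 D - k2)
    and the last factor c \<delta> / 2 k2; the terms with k2 cancel.\<close>
  have mom: "x t * y0 t - y t * x0 t = c * \<delta> * u t" for t
  proof -
    have "x t * y0 t - y t * x0 t = (g t * g t) * ((sin (\<psi> t) * sin (\<psi> t) + cos (\<psi> t) * cos (\<psi> t)) *
      (c * \<delta> / 2 * (r t * r t + s t * s t) + (r t * s' t - s t * r' t)))"
      unfolding x_def y_def x0_def y0_def by (rule rotation_momentum)
    also have "\<dots> = u t / D t * (c * \<delta> / 2 * (2 * D t - k2) + c * \<delta> / 2 * k2)"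
      unfolding gg rs rs' trig by simp
    also have "\<dots> = c * \<delta> * u t" using D[of t] by (simp add: field_simps)
    finally show ?thesis .
  qed
  have Re: "(\<lambda>t. Re (soliton_check lam c \<omega> \<delta> t)) = x" and Im: "(\<lambda>t. Im (soliton_check lam c \<omega> \<delta> t)) = y"
    by (auto simp: chk x_def y_def algebra_simps)
  have m: "soliton_2 lam c \<omega> \<delta> = (\<lambda>t. \<delta> * (1 - u t))"
    by (rule ext) (simp add: soliton_2_def u_def D_def C_def k_def k2_def \<alpha>_def S_def)
  obtain x' m' y' where "tw_profile lam c \<omega> x (\<lambda>t. \<delta> * (1 - u t)) y x' m' y'"
    "first_integrals lam c \<omega> \<delta> x (\<lambda>t. \<delta> * (1 - u t)) y x' m' y'"
    using tw_profile_from_component[OF \<delta> du du'[unfolded k2_def \<alpha>_def] u'2[unfolded k2_def \<alpha>_def] u0 u2 dx dy sph mom]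
    by blast
  then show ?thesis
    unfolding Re Im m
  proof (rule tw_solitonI[OF _ _ \<delta> k(1) _ _ lam, where C = "k2 / S" and a = 0])
    show "1 - \<delta> * (\<delta> * (1 - u t)) \<le> k2 / S / cosh (k * t) \<or>
      \<omega> = 0 \<and> 1 - (\<delta> * (1 - u t))\<^sup>2 \<le> k2 / S / cosh (k * t)" for t
    proof
      \<comment> \<open>D is at least S cosh (k t) because \<alpha> > 0, and S > 0 then yields
        exponential decay of u.\<close>
      have "k2 / D t \<le> k2 / (S * C t)"
        using facts(1,2,3) C1[of t] D[of t] by (intro divide_left_mono) (auto simp: D_def)
      then show "1 - \<delta> * (\<delta> * (1 - u t)) \<le> k2 / S / cosh (k * t)"
        using \<delta> by (auto simp: u_def C_def)
    qed
    show "(\<delta> * (1 - u 0))\<^sup>2 \<noteq> 1"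
      using u0[of 0] u2[of 0] \<delta> by (auto simp: power2_eq_1_iff)
  qed
qed

section \<open>The static profile\<close>

theorem tw_soliton_static:
  assumes lam: "lam > 0" and \<delta>: "\<delta> \<in> {1, -1}"
  shows "tw_soliton lam 0 0 \<delta> (\<lambda>t. Re (static_check lam t)) (static_2 lam \<delta>) (\<lambda>t. Im (static_check lam t))"
proof -
  define s where "s = sqrt lam"
  have s: "0 < s" "s * s = lam" using lam by (auto simp: s_def)
  define T where "T t = tanh (s * t)" for t
  define u where "u t = 1 - T t" for t
  define x where "x t = 1 / cosh (s * t)" for t
  have xx: "x t * x t = 1 - T t * T t" for t
  proof -
    have "x t * x t = (cosh (s * t) * cosh (s * t) - sinh (s * t) * sinh (s * t)) / (cosh (s * t) * cosh (s * t))"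
      using cosh_square_eq[of "s * t"] by (simp add: x_def power2_eq_square)
    also have "\<dots> = 1 - T t * T t" by (simp add: T_def tanh_def diff_divide_distrib)
    finally show ?thesis .
  qed
  have dT: "(T has_real_derivative s * (1 - T t * T t)) (at t)" for t
    unfolding T_def by (auto intro!: derivative_eq_intros simp: power2_eq_square)
  have du: "(u has_real_derivative - (s * (1 - T t * T t))) (at t)" for t
    unfolding u_def by (rule derivative_eq_intros dT refl)+ simp
  let ?k2 = "4 * (lam + \<delta> * 0) - 0\<^sup>2" and ?a = "2 * lam + \<delta> * 0"
  have du': "((\<lambda>t. - (s * (1 - T t * T t))) has_real_derivative
      ?k2 * u t - 3 * ?a * (u t)\<^sup>2 + 2 * lam * (u t) ^ 3) (at t)" for t
  proof -
    have "((\<lambda>t. - (s * (1 - T t * T t))) has_real_derivative 2 * (s * s) * T t * (1 - T t * T t)) (at t)"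
      (is "(_ has_real_derivative ?d) _")
      by (rule derivative_eq_intros dT refl)+ (simp add: algebra_simps)
    also have "?d = ?k2 * u t - 3 * ?a * (u t)\<^sup>2 + 2 * lam * (u t) ^ 3"
      unfolding s(2) u_def by (simp add: algebra_simps power2_eq_square power3_eq_cube)
    finally show ?thesis .
  qed
  have u'2: "(- (s * (1 - T t * T t)))\<^sup>2 =
      (u t)\<^sup>2 * (?k2 - 2 * ?a * u t + lam * (u t)\<^sup>2)" for t
  proof -
    have "(- (s * (1 - T t * T t)))\<^sup>2 = (s * s) * ((1 - T t * T t) * (1 - T t * T t))"
      by (simp add: power2_eq_square algebra_simps)
    then show ?thesis
      unfolding s(2) u_def by (simp add: algebra_simps power2_eq_square)
  qed
  have u0: "0 < u t" and u2: "u t < 2" for t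
    using tanh_real_lt_1[of "s * t"] tanh_real_gt_neg1[of "s * t"] by (auto simp: u_def T_def)
  have dx: "(x has_real_derivative - (s * sinh (s * t)) / (cosh (s * t))\<^sup>2) (at t)" for t
    unfolding x_def by (auto intro!: derivative_eq_intros simp: power2_eq_square)
  have sph: "(x t)\<^sup>2 + 0\<^sup>2 = u t * (2 - u t)" for t
    using xx[of t] by (simp add: u_def power2_eq_square algebra_simps)
  have mom: "x t * 0 - 0 * (- (s * sinh (s * t)) / (cosh (s * t))\<^sup>2) = 0 * \<delta> * u t" for t
    by simp
  have Re: "(\<lambda>t. Re (static_check lam t)) = x" and Im: "(\<lambda>t. Im (static_check lam t)) = (\<lambda>t. 0)"
    by (auto simp: static_check_def x_def s_def)
  have m: "static_2 lam \<delta> = (\<lambda>t. \<delta> * (1 - u t))"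
    by (rule ext) (simp add: static_2_def u_def T_def s_def)
  obtain x' m' y' where "tw_profile lam 0 0 x (\<lambda>t. \<delta> * (1 - u t)) (\<lambda>t. 0) x' m' y'"
    "first_integrals lam 0 0 \<delta> x (\<lambda>t. \<delta> * (1 - u t)) (\<lambda>t. 0) x' m' y'"
    using tw_profile_from_component[OF \<delta> du du' u'2 u0 u2 dx DERIV_const sph mom] by blast
  then show ?thesis
    unfolding Re Im m
  proof (rule tw_solitonI[OF _ _ \<delta> s(1) _ _ lam, where C = 1 and a = 0])
    show "1 - \<delta> * (\<delta> * (1 - u t)) \<le> 1 / cosh (s * t) \<or>
      0 = (0::real) \<and> 1 - (\<delta> * (1 - u t))\<^sup>2 \<le> 1 / cosh (s * t)" for t
    \<comment> \<open>The first alternative fails towards -infinity, where \<delta> m tends to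
      -1.\<close>
    proof (intro disjI2 conjI refl)
      have "1 - (\<delta> * (1 - u t))\<^sup>2 = x t * x t"
        unfolding xx u_def using \<delta> by (auto simp: power2_eq_square)
      also have "\<dots> \<le> 1 / cosh (s * t)"
        using cosh_real_ge_1[of "s * t"] by (simp add: x_def field_simps)
      finally show "1 - (\<delta> * (1 - u t))\<^sup>2 \<le> 1 / cosh (s * t)" .
    qed
    show "(\<delta> * (1 - u 0))\<^sup>2 \<noteq> 1" by (simp add: u_def T_def)
  qed
qed

text \<open>At t = 0 the profile sits at the pole m = -\<delta>, so u = 2 there and
  \<open>tw_profile_from_component\<close> does not apply. The system is verified directly; with y =
  0 and c = 0 only the equations for x and m remain, and they are rational identities in sinh and
  cosh.\<close>

theorem tw_soliton_wall:
  assumes lam: "lam > 0" and \<delta>: "\<delta> \<in> {1, -1}" and \<omega>: "0 < \<omega> * \<delta>"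
  shows "tw_soliton lam 0 \<omega> \<delta> (\<lambda>t. Re (wall_check lam \<omega> \<delta> t)) (wall_2 lam \<omega> \<delta>)
    (\<lambda>t. Im (wall_check lam \<omega> \<delta> t))"
proof -
  have \<delta>\<omega>: "0 < \<delta> * \<omega>" using \<omega> by (simp add: mult.commute)
  define k where "k = sqrt (lam + \<delta> * \<omega>)"
  define r where "r = sqrt (\<delta> * \<omega>)"
  have k: "0 < k" "k * k = lam + \<delta> * \<omega>" and r: "0 < r" "r * r = \<delta> * \<omega>"
    using lam \<delta>\<omega> by (auto simp: k_def r_def)
  \<comment> \<open>Replacing lam and \<omega> by k and r turns the square roots of the formulas
    into products, so that all numerators to be compared are polynomials in k, r, sinh and
    cosh.\<close>
  have lam_eq: "lam = k * k - r * r" using k r by simp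
  have \<omega>_eq: "\<omega> = \<delta> * (r * r)" using r(2) \<delta> by auto
  define s where "s t = sinh (k * t)" for t
  define h where "h t = cosh (k * t)" for t
  have hh: "h t * h t = s t * s t + 1" for t
    using cosh_square_eq[of "k * t"] by (simp add: s_def h_def power2_eq_square)
  have ds: "(s has_real_derivative k * h t) (at t)" and dh: "(h has_real_derivative k * s t) (at t)" for t
    unfolding s_def h_def by (auto intro!: derivative_eq_intros)
  \<comment> \<open>Half the denominator of the profile: by the double-angle formula, 2 G is 2 lam +
    \<delta> \<omega> + \<delta> \<omega> cosh (2 k t).\<close>
  define G where "G t = k * k + r * r * (s t * s t)" for t
  have G: "0 < G t" for t
    unfolding G_def
    by (rule add_pos_nonneg[OF mult_pos_pos[OF k(1) k(1)] mult_nonneg_nonneg[OF zero_le_square zero_le_square]])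
  have dG: "(G has_real_derivative 2 * r * r * k * (s t * h t)) (at t)" for t
    unfolding G_def by (rule derivative_eq_intros ds refl)+ (simp add: algebra_simps)
  define x where "x t = 2 * k * r * s t / G t" for t
  define u where "u t = 2 * k * k / G t" for t
  define x' where "x' t = 2 * k * k * r * h t * (k * k - r * r * (s t * s t)) / (G t * G t)" for t
  define u' where "u' t = - (4 * k * k * k * r * r * (s t * h t)) / (G t * G t)" for t
  define m where "m t = \<delta> * (1 - u t)" for t
  define m' where "m' t = - \<delta> * u' t" for t
  \<comment> \<open>The multiplier predicted by the energy integral, with r^2 u in place of \<omega>
    (\<delta> - m); \<open>energy\<close> and \<open>et\<close> confirm that it is the actual
    one.\<close>
  define e where "e t = lam * (x t * x t) + 2 * r * r * u t + lam * (x t * x t)" for t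
  have dx: "(x has_real_derivative x' t) (at t)" for t
  proof -
    have "((\<lambda>t. 2 * k * r * s t) has_real_derivative 2 * k * r * (k * h t)) (at t)"
      by (rule derivative_eq_intros ds refl)+ simp
    from DERIV_divide[OF this dG] have "(x has_real_derivative
      (2 * k * r * (k * h t) * G t - 2 * k * r * s t * (2 * r * r * k * (s t * h t))) / (G t * G t)) (at t)"
      (is "(_ has_real_derivative ?d) _")
      using G[of t] by (simp add: x_def[abs_def])
    also have "?d = x' t"
      unfolding x'_def by (rule arg_cong2[where f = "(/)"]) (simp_all add: G_def algebra_simps)
    finally show ?thesis .
  qed
  have du: "(u has_real_derivative u' t) (at t)" for t
  proof -
    from DERIV_divide[OF DERIV_const[of "2 * k * k"] dG, of t] have "(u has_real_derivative
      (0 * G t - 2 * k * k * (2 * r * r * k * (s t * h t))) / (G t * G t)) (at t)"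
      (is "(_ has_real_derivative ?d) _")
      using G[of t] by (simp add: u_def[abs_def])
    also have "?d = u' t"
      unfolding u'_def by (rule arg_cong2[where f = "(/)"]) (simp_all add: algebra_simps)
    finally show ?thesis .
  qed
  have dGG: "((\<lambda>t. G t * G t) has_real_derivative 4 * r * r * k * (s t * h t) * G t) (at t)" for t
    by (rule derivative_eq_intros dG refl)+ (simp add: algebra_simps)
  have dx': "(x' has_real_derivative (lam + r * r * (1 - u t) - e t) * x t) (at t)" for t
  proof -
    let ?A = "2 * k * k * k * r * s t * (k * k - r * r * (s t * s t)) - 4 * k * k * k * r * r * r * s t * (h t * h t)"
    let ?N = "?A * G t - 8 * k * k * k * r * r * r * s t * (k * k - r * r * (s t * s t)) * (h t * h t)"
    have "((\<lambda>t. 2 * k * k * r * h t * (k * k - r * r * (s t * s t))) has_real_derivative ?A) (at t)"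
      by (rule derivative_eq_intros ds dh refl)+ (simp add: algebra_simps)
    from DERIV_divide[OF this dGG] have "(x' has_real_derivative
      (?A * (G t * G t) - 2 * k * k * r * h t * (k * k - r * r * (s t * s t)) * (4 * r * r * k * (s t * h t) * G t))
      / ((G t * G t) * (G t * G t))) (at t)"
      (is "(_ has_real_derivative ?d) _")
      using G[of t] by (simp add: x'_def[abs_def])
    also have "?d = (G t * ?N) / (G t * (G t * G t * G t))"
      by (rule arg_cong2[where f = "(/)"]) (simp_all add: algebra_simps)
    also have "\<dots> = ?N / (G t * G t * G t)"
      using G[of t] by simp
    also have "\<dots> = (lam + r * r * (1 - u t) - e t) * x t"
    proof -
      have "(lam + r * r * (1 - u t) - e t) * x t =
        (2 * k * r * s t * (lam * (G t * G t) + r * r * (G t * (G t - 2 * k * k))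
          - 8 * lam * k * k * r * r * (s t * s t) - 4 * r * r * k * k * G t)) / (G t * G t * G t)"
        unfolding e_def x_def u_def using G[of t] by (simp add: field_simps)
      also have "\<dots> = ?N / (G t * G t * G t)"
        by (rule arg_cong2[where f = "(/)"]) (simp_all add: hh lam_eq G_def algebra_simps)
      finally show ?thesis by simp
    qed
    finally show ?thesis .
  qed
  have du': "(u' has_real_derivative e t * (1 - u t) + r * r * (x t * x t)) (at t)" for t
  proof -
    let ?B = "4 * k * k * k * k * r * r * (h t * h t + s t * s t)"
    let ?N = "16 * k * k * k * k * r * r * r * r * (s t * s t) * (h t * h t) - ?B * G t"
    have "((\<lambda>t. - (4 * k * k * k * r * r * (s t * h t))) has_real_derivative - ?B) (at t)"
      by (rule derivative_eq_intros ds dh refl)+ (simp add: algebra_simps)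
    from DERIV_divide[OF this dGG] have "(u' has_real_derivative
      (- ?B * (G t * G t) - - (4 * k * k * k * r * r * (s t * h t)) * (4 * r * r * k * (s t * h t) * G t))
      / ((G t * G t) * (G t * G t))) (at t)"
      (is "(_ has_real_derivative ?d) _")
      using G[of t] by (simp add: u'_def[abs_def])
    also have "?d = (G t * ?N) / (G t * (G t * G t * G t))"
      by (rule arg_cong2[where f = "(/)"]) (simp_all add: algebra_simps)
    also have "\<dots> = ?N / (G t * G t * G t)"
      using G[of t] by simp
    also have "\<dots> = e t * (1 - u t) + r * r * (x t * x t)"
    proof -
      have "e t * (1 - u t) + r * r * (x t * x t) =
        ((8 * lam * k * k * r * r * (s t * s t) + 4 * r * r * k * k * G t) * (G t - 2 * k * k)
          + 4 * k * k * r * r * r * r * (s t * s t) * G t) / (G t * G t * G t)"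
        unfolding e_def x_def u_def using G[of t] by (simp add: field_simps)
      also have "\<dots> = ?N / (G t * G t * G t)"
        by (rule arg_cong2[where f = "(/)"]) (simp_all add: hh lam_eq G_def algebra_simps)
      finally show ?thesis by simp
    qed
    finally show ?thesis .
  qed
  have xx: "x t * x t = u t * (2 - u t)" for t
  proof -
    have "u t * (2 - u t) = 4 * k * k * (G t - k * k) / (G t * G t)"
      unfolding u_def using G[of t] by (simp add: field_simps)
    also have "\<dots> = x t * x t" by (simp add: x_def G_def algebra_simps)
    finally show ?thesis by simp
  qed
  have energy: "(x' t)\<^sup>2 + (m' t)\<^sup>2 + 0\<^sup>2 = lam * (x t * x t) + 2 * r * r * u t" for t
  proof -
    have "(m' t)\<^sup>2 = (u' t)\<^sup>2" using \<delta> by (auto simp: m'_def)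
    then have "(x' t)\<^sup>2 + (m' t)\<^sup>2 + 0\<^sup>2 = 4 * k * k * k * k * r * r * (h t * h t) *
      ((k * k - r * r * (s t * s t)) * (k * k - r * r * (s t * s t)) + 4 * k * k * r * r * (s t * s t))
      / ((G t * G t) * (G t * G t))"
      by (simp add: x'_def u'_def power2_eq_square algebra_simps add_divide_distrib diff_divide_distrib)
    also have "(k * k - r * r * (s t * s t)) * (k * k - r * r * (s t * s t)) + 4 * k * k * r * r * (s t * s t) = G t * G t"
      by (simp add: G_def algebra_simps)
    also have "4 * k * k * k * k * r * r * (h t * h t) * (G t * G t) / ((G t * G t) * (G t * G t))
      = 4 * k * k * k * k * r * r * (h t * h t) / (G t * G t)"
      using G[of t] by simp
    also have "\<dots> = (lam * 4 * k * k * r * r * (s t * s t) + 4 * r * r * k * k * G t) / (G t * G t)"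
      by (rule arg_cong2[where f = "(/)"]) (simp_all add: hh lam_eq G_def algebra_simps)
    also have "\<dots> = lam * (x t * x t) + 2 * r * r * u t"
      unfolding x_def u_def using G[of t] by (simp add: field_simps)
    finally show ?thesis .
  qed
  have \<omega>m: "\<omega> * m t = r * r * (1 - u t)" "\<omega> * (\<delta> - m t) = r * r * u t" for t
    unfolding \<omega>_eq m_def using \<delta> by (auto simp: algebra_simps)
  have mm: "1 - (m t)\<^sup>2 = x t * x t" for t
    unfolding xx m_def using \<delta> by (auto simp: power2_eq_square algebra_simps)
  have et: "(x' t)\<^sup>2 + (m' t)\<^sup>2 + 0\<^sup>2 + lam * ((x t)\<^sup>2 + 0\<^sup>2) = e t" for t
    unfolding energy e_def by (simp add: power2_eq_square)
  have prof: "tw_profile lam 0 \<omega> x m (\<lambda>_. 0) x' m' (\<lambda>_. 0)"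
  proof (rule tw_profileI[OF dx _ _ _ et])
    fix t
    show "(m has_real_derivative m' t) (at t)"
      unfolding m_def m'_def by (rule derivative_eq_intros du refl)+ simp
    show "(x t)\<^sup>2 + (m t)\<^sup>2 + 0\<^sup>2 = 1" using mm[of t] by (simp add: power2_eq_square)
    show "(x' has_real_derivative (lam + \<omega> * m t - e t) * x t - 0 * (m t * 0 - m' t * 0)) (at t)"
      unfolding \<omega>m using dx'[of t] by simp
    have "(m' has_real_derivative - \<delta> * (e t * (1 - u t) + r * r * (x t * x t))) (at t)"
      unfolding m'_def by (rule DERIV_cmult[OF du'])
    then show "(m' has_real_derivative 0 * (x t * 0 - 0 * x' t) - e t * m t - \<omega> * ((x t)\<^sup>2 + 0\<^sup>2)) (at t)"
      by (rule DERIV_cong) (simp add: \<omega>_eq m_def algebra_simps power2_eq_square)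
  qed simp_all
  have fi: "first_integrals lam 0 \<omega> \<delta> x m (\<lambda>_. 0) x' m' (\<lambda>_. 0)"
    unfolding first_integrals_def energy mm using \<omega>m(2) by (simp add: mult.assoc)
  have D: "2 * lam + \<delta> * \<omega> + \<delta> * \<omega> * cosh (2 * k * t) = 2 * G t" for t
    using cosh_double_cosh[of "k * t"] hh[of t]
    unfolding G_def k(2) by (simp add: mult.assoc h_def power2_eq_square r(2) algebra_simps)
  have Re: "(\<lambda>t. Re (wall_check lam \<omega> \<delta> t)) = x" and Im: "(\<lambda>t. Im (wall_check lam \<omega> \<delta> t)) = (\<lambda>t. 0)"
    unfolding wall_check_def k_def[symmetric] D
    by (auto simp: x_def s_def real_sqrt_mult k_def r_def)
  have m: "wall_2 lam \<omega> \<delta> = m"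
    unfolding wall_2_def[abs_def] k_def[symmetric] D m_def[abs_def] u_def
    unfolding k(2)[symmetric] by (simp add: mult.assoc)
  show ?thesis
    unfolding Re Im m
  proof (rule tw_solitonI[OF prof fi \<delta> _ _ _ lam, where C = "4 * k * k / (\<delta> * \<omega>)" and a = 1 and k = "2 * k"])
    show "1 - \<delta> * m t \<le> 4 * k * k / (\<delta> * \<omega>) / cosh (2 * k * t) \<or>
      \<omega> = 0 \<and> 1 - (m t)\<^sup>2 \<le> 4 * k * k / (\<delta> * \<omega>) / cosh (2 * k * t)" for t
    proof
      have "4 * k * k / (2 * G t) \<le> 4 * k * k / (\<delta> * \<omega> * cosh (2 * k * t))"
        using D[of t] lam \<delta>\<omega> G[of t] k(1) by (intro divide_left_mono) auto
      then show "1 - \<delta> * m t \<le> 4 * k * k / (\<delta> * \<omega>) / cosh (2 * k * t)"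
        using \<delta> by (auto simp: m_def u_def)
    qed
    \<comment> \<open>At t = 0 one has m^2 = 1, so the point off the poles is taken at t =
      1.\<close>
    have "0 < s 1" using k by (simp add: s_def)
    then have "0 < x 1 * x 1" using k r G[of 1] by (simp add: x_def)
    then show "(m 1)\<^sup>2 \<noteq> 1" unfolding mm[symmetric] by simp
  qed (use k in simp)
qed

section \<open>Matching solutions with explicit profiles\<close>

theorem tw_soliton_imp_TW_solution:
  assumes sol: "tw_soliton lam c \<omega> \<delta> (\<lambda>t. Re (Z t)) V2 (\<lambda>t. Im (Z t))"
    and same: "same_up_to_invariance v Z V2"
  shows "v \<in> energy_space \<and> TW_solution lam c \<omega> v \<and> nontrivial v"
proof -
  obtain a \<theta> where ae: "AE t in lebesgue.
      vcheck (v t) = exp (\<i> * of_real \<theta>) * Z (t - a) \<and> v t $ 2 = V2 (t - a)"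
    using same unfolding same_up_to_invariance_def by blast
  define x where "x t = cos \<theta> * Re (Z (t - a)) - sin \<theta> * Im (Z (t - a))" for t
  define y where "y t = sin \<theta> * Re (Z (t - a)) + cos \<theta> * Im (Z (t - a))" for t
  define m where "m t = V2 (t - a)" for t
  have "tw_soliton lam c \<omega> \<delta> x m y"
    unfolding x_def y_def m_def by (rule tw_soliton_rigid_motion[OF sol])
  then obtain x' m' y' s where prof: "tw_profile lam c \<omega> x m y x' m' y'"
    and int: "integrable lebesgue (\<lambda>t. (x t)\<^sup>2 + (y t)\<^sup>2 + (x' t)\<^sup>2 + (m' t)\<^sup>2 + (y' t)\<^sup>2)"
    and s: "(m s)\<^sup>2 \<noteq> 1"
    unfolding tw_soliton_def by blast
  have v: "AE t in lebesgue. v t = vector [x t, m t, y t]"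
    using ae
  proof eventually_elim
    case (elim t)
    then have "Complex (v t $ 1) (v t $ 3) = cis \<theta> * Z (t - a)"
      by (simp add: vcheck_def cis_conv_exp)
    then have "v t $ 1 = x t" "v t $ 3 = y t"
      by (auto simp: complex_eq_iff x_def y_def)
    with elim show ?case by (simp add: vec_eq_iff forall_3 m_def)
  qed
  have cont: "continuous_on UNIV m"
    using tw_profileD(2)[OF prof] by (auto intro!: continuous_at_imp_continuous_on DERIV_isCont)
  have "\<not> (AE t in lebesgue. v t = vector [0, b, 0])" if "b\<^sup>2 = 1" for b
  proof
    assume "AE t in lebesgue. v t = vector [0, b, 0]"
    with v have "AE t in lebesgue. m t = b"
    proof eventually_elim
      case (elim t)
      then have "(vector [x t, m t, y t] :: real^3) $ 2 = (vector [0, b, 0] :: real^3) $ 2" by metis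
      then show ?case by simp
    qed
    then have "m s = b"
      by (rule continuous_AE_eq_imp_eq[OF cont continuous_on_const])
    then show False using s that by simp
  qed
  from this[of 1] this[of "-1"] have "nontrivial v" by (simp add: nontrivial_def)
  with tw_profile_imp_TW_solution[OF prof v int] show ?thesis by blast
qed

text \<open>Only the second component has to be recognized: a translate of the explicit profile then
  shares m and the first integrals with the solution, and uniqueness up to rotation supplies the
  phase.\<close>

lemma tw_profile_same_component:
  assumes prof: "tw_profile lam c \<omega> x m y x' m' y'"
    and fi: "first_integrals lam c \<omega> \<delta> x m y x' m' y'" and lam: "lam > 0" and \<delta>: "\<delta> \<in> {1, -1}"
    and v: "AE t in lebesgue. v t = vector [x t, m t, y t]"
    and sol: "tw_soliton lam c \<omega> \<delta> (\<lambda>t. Re (Z t)) V2 (\<lambda>t. Im (Z t))"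
    and m: "\<And>t. m t = V2 (t - a)"
  shows "same_up_to_invariance v Z V2"
proof -
  have meq: "(\<lambda>t. V2 (t - a)) = m" using m by auto
  have "tw_soliton lam c \<omega> \<delta> (\<lambda>t. Re (Z (t - a))) m (\<lambda>t. Im (Z (t - a)))"
    using tw_soliton_rigid_motion[OF sol, of 0 a] unfolding meq by simp
  then obtain \<xi>' n' \<eta>' s where p2: "tw_profile lam c \<omega> (\<lambda>t. Re (Z (t - a))) m (\<lambda>t. Im (Z (t - a))) \<xi>' n' \<eta>'"
    and f2: "first_integrals lam c \<omega> \<delta> (\<lambda>t. Re (Z (t - a))) m (\<lambda>t. Im (Z (t - a))) \<xi>' n' \<eta>'"
    and s: "(m s)\<^sup>2 \<noteq> 1"
    unfolding tw_soliton_def by blast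
  \<comment> \<open>\<open>tw_soliton\<close> hides its derivatives, while the uniqueness theorem
    compares profiles with a common m'.\<close>
  have n': "n' = m'"
    using DERIV_unique[OF tw_profileD(2)[OF p2] tw_profileD(2)[OF prof]] by auto
  obtain \<theta> where \<theta>: "\<And>t. x t = cos \<theta> * Re (Z (t - a)) - sin \<theta> * Im (Z (t - a))"
    "\<And>t. y t = sin \<theta> * Re (Z (t - a)) + cos \<theta> * Im (Z (t - a))"
    using tw_profile_unique_up_to_rotation[OF prof p2[unfolded n'] fi f2[unfolded n'] lam \<delta> s]
    by blast
  show ?thesis
    unfolding same_up_to_invariance_def
  proof (intro exI)
    show "AE t in lebesgue. vcheck (v t) = exp (\<i> * of_real \<theta>) * Z (t - a) \<and> v t $ 2 = V2 (t - a)"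
      using v
    proof eventually_elim
      case (elim t)
      have "vcheck (v t) = cis \<theta> * Z (t - a)"
        unfolding elim by (simp add: vcheck_def complex_eq_iff \<theta>)
      then show ?case by (simp add: elim m cis_conv_exp)
    qed
  qed
qed

text \<open>The formula for m with S > 0 covers two families. Within \<open>soliton_range\<close> it
  belongs to a soliton that stays off the poles; outside, it belongs to the profile through the pole
  -\<delta>, for which the pair (x, y) has to be matched separately.\<close>

theorem TW_solution_classification:
  assumes lam: "lam > 0" and v: "v \<in> energy_space" "TW_solution lam c \<omega> v" "nontrivial v"
  shows "(\<omega> = 0 \<and> c = 0 \<and>
      (\<exists>\<delta>\<in>{1, -1}. same_up_to_invariance v (static_check lam) (static_2 lam \<delta>))) \<or>
    (\<exists>\<delta>\<in>{1, -1}. soliton_range lam c \<omega> \<delta> \<and>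
      same_up_to_invariance v (soliton_check lam c \<omega> \<delta>) (soliton_2 lam c \<omega> \<delta>)) \<or>
    (c = 0 \<and> (\<exists>\<delta>\<in>{1, -1}. 0 < \<omega> * \<delta> \<and>
      same_up_to_invariance v (wall_check lam \<omega> \<delta>) (wall_2 lam \<omega> \<delta>)))"
proof -
  obtain x m y x' m' y' where prof: "tw_profile lam c \<omega> x m y x' m' y'"
    and veq: "AE t in lebesgue. v t = vector [x t, m t, y t]"
    and int: "integrable lebesgue (\<lambda>t. (x t)\<^sup>2 + (y t)\<^sup>2 + (x' t)\<^sup>2 + (m' t)\<^sup>2 + (y' t)\<^sup>2)"
    by (rule TW_solution_imp_tw_profile[OF v(1,2)])
  obtain \<delta> where \<delta>: "\<delta> \<in> {1, -1}" and fi: "first_integrals lam c \<omega> \<delta> x m y x' m' y'"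
    and reach: "\<And>e a. 0 < e \<Longrightarrow> \<exists>t\<ge>a. 1 - \<delta> * m t < e"
    by (rule tw_profile_first_integrals[OF prof lam int]) (rule that)
  have "\<exists>b. m b \<noteq> \<delta>"
  proof (rule ccontr)
    assume "\<not> ?thesis"
    then have m: "m t = \<delta>" for t by simp
    have "(x t)\<^sup>2 + (y t)\<^sup>2 = 0" for t
      using tw_profileD(7)[OF prof, of t] \<delta> by (auto simp: m)
    then have "x t = 0 \<and> y t = 0" for t by (simp add: add_nonneg_eq_0_iff)
    with veq m have "AE t in lebesgue. v t = vector [0, \<delta>, 0]" by simp
    then show False using v(3) \<delta> by (auto simp: nontrivial_def)
  qed
  then obtain b where b: "m b \<noteq> \<delta>" by blast
  define k2 where "k2 = 4 * (lam + \<delta> * \<omega>) - c\<^sup>2"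
  define S where "S = sqrt (lam * c\<^sup>2 + \<omega>\<^sup>2)"
  have "\<forall>e>0. \<forall>a. \<exists>t\<ge>a. 1 - \<delta> * m t < e" using reach by blast
  note cl = component_classification[OF prof fi \<delta> lam this b, folded k2_def S_def]
  note same = tw_profile_same_component[OF prof fi lam \<delta> veq]
  from cl(2) show ?thesis
  proof (elim disjE conjE exE)
    fix a assume S: "0 < S" and m: "\<forall>t. m t = \<delta> * (1 - k2 / (2 * lam + \<delta> * \<omega> + S * cosh (sqrt k2 * (t - a))))"
    show ?thesis
    proof (cases "soliton_range lam c \<omega> \<delta>")
      case True
      have "same_up_to_invariance v (soliton_check lam c \<omega> \<delta>) (soliton_2 lam c \<omega> \<delta>)"
        by (rule same[OF tw_soliton_soliton[OF lam \<delta> True], where a = a])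
           (simp add: m soliton_2_def k2_def S_def)
      with True \<delta> show ?thesis by blast
    next
      case False
      \<comment> \<open>For \<omega> \<delta> < 0 the bound k2 > 0 already gives all inequalities of
        \<open>soliton_range\<close>; its failure therefore means \<omega> \<delta> \<ge> 0 and c =
        0, and S > 0 then excludes \<omega> = 0.\<close>
      have "c = 0 \<and> 0 < \<omega> * \<delta>"
      proof (cases "\<omega> * \<delta> < 0")
        case True
        have "0 < 4 * (lam + w) - q \<Longrightarrow> 0 \<le> q \<Longrightarrow> - w < lam \<and> q < 4 * (lam + w)" for w q
          by (simp add: algebra_simps)
        from this[OF cl(1)[unfolded k2_def] zero_le_power2] True False show ?thesis
          by (simp add: soliton_range_def mult.commute)
      next
        case nonneg: False
        have "c\<^sup>2 < 4 * (lam + \<omega> * \<delta>)" using cl(1) by (simp add: k2_def mult.commute)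
        with False nonneg have c: "c = 0" by (auto simp: soliton_range_def)
        with S have "\<omega> \<noteq> 0" by (auto simp: S_def)
        with nonneg \<delta> c show ?thesis by auto
      qed
      then have c: "c = 0" and \<omega>: "0 < \<omega> * \<delta>" by auto
      \<comment> \<open>At c = 0 the root S is |\<omega>|, which is \<delta> \<omega> by the sign of
        \<omega> \<delta>; the soliton formula for m thereby becomes \<open>wall_2\<close>.\<close>
      have S': "S = \<delta> * \<omega>" using \<omega> \<delta> by (auto simp: S_def c)
      have "sqrt (4 * z) = 2 * sqrt z" for z :: real by (simp add: real_sqrt_mult)
      moreover have "k2 = 4 * (lam + \<delta> * \<omega>)" by (simp add: k2_def c)
      ultimately have k': "sqrt k2 = 2 * sqrt (lam + \<delta> * \<omega>)" by (simp only:)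
      have "same_up_to_invariance v (wall_check lam \<omega> \<delta>) (wall_2 lam \<omega> \<delta>)"
      proof (rule same[where a = a])
        show "tw_soliton lam c \<omega> \<delta> (\<lambda>t. Re (wall_check lam \<omega> \<delta> t)) (wall_2 lam \<omega> \<delta>) (\<lambda>t. Im (wall_check lam \<omega> \<delta> t))"
          unfolding c by (rule tw_soliton_wall[OF lam \<delta> \<omega>])
        show "m t = wall_2 lam \<omega> \<delta> (t - a)" for t
          unfolding m[rule_format] wall_2_def S' k' by (simp add: k2_def c)
      qed
      with c \<omega> \<delta> show ?thesis by blast
    qed
  next
    fix a assume c: "c = 0" and \<omega>: "\<omega> = 0" and m: "\<forall>t. m t = \<delta> * tanh (sqrt lam * (t - a))"
    have "same_up_to_invariance v (static_check lam) (static_2 lam \<delta>)"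
    proof (rule same[where a = a])
      show "tw_soliton lam c \<omega> \<delta> (\<lambda>t. Re (static_check lam t)) (static_2 lam \<delta>) (\<lambda>t. Im (static_check lam t))"
        unfolding c \<omega> by (rule tw_soliton_static[OF lam \<delta>])
    qed (simp add: m static_2_def)
    with c \<omega> \<delta> show ?thesis by blast
  qed
qed

theorem theoremA1:
  fixes lam c \<omega> :: real
  assumes "lam > 0"
  shows "(\<forall>v. (v \<in> energy_space \<and> TW_solution lam c \<omega> v \<and> nontrivial v) \<longleftrightarrow>
            (\<omega> = 0 \<and> c = 0 \<and>
               (\<exists>\<delta>\<in>{1, -1}. same_up_to_invariance v (static_check lam) (static_2 lam \<delta>))) \<or>
            (\<exists>\<delta>\<in>{1, -1}. soliton_range lam c \<omega> \<delta> \<and>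
               same_up_to_invariance v (soliton_check lam c \<omega> \<delta>) (soliton_2 lam c \<omega> \<delta>)) \<or>
            (c = 0 \<and> (\<exists>\<delta>\<in>{1, -1}. 0 < \<omega> * \<delta> \<and>
               same_up_to_invariance v (wall_check lam \<omega> \<delta>) (wall_2 lam \<omega> \<delta>)))) \<and>
         (\<forall>\<delta>\<in>{1, -1}. soliton_range lam c \<omega> \<delta> \<and> c \<noteq> 0 \<longrightarrow>
            (\<forall>x. soliton_check lam c \<omega> \<delta> x =
               of_real (cmod (soliton_check lam c \<omega> \<delta> x))
                 * exp (\<i> * of_real (soliton_phase lam c \<omega> \<delta> x))))"
  (is "(\<forall>v. ?sol v \<longleftrightarrow> ?profiles v) \<and> _")
proof (rule conjI; intro allI ballI impI)
  note sol = tw_soliton_imp_TW_solution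
  have "v \<in> energy_space \<and> TW_solution lam c \<omega> v \<and> nontrivial v"
    if "\<delta> \<in> {1, -1}" "soliton_range lam c \<omega> \<delta>"
      "same_up_to_invariance v (soliton_check lam c \<omega> \<delta>) (soliton_2 lam c \<omega> \<delta>)" for v \<delta>
    using sol[OF tw_soliton_soliton[OF assms that(1,2)] that(3)] .
  moreover have "v \<in> energy_space \<and> TW_solution lam 0 0 v \<and> nontrivial v"
    if "\<delta> \<in> {1, -1}" "same_up_to_invariance v (static_check lam) (static_2 lam \<delta>)" for v \<delta>
    using sol[OF tw_soliton_static[OF assms that(1)] that(2)] .
  moreover have "v \<in> energy_space \<and> TW_solution lam 0 \<omega> v \<and> nontrivial v"
    if "\<delta> \<in> {1, -1}" "0 < \<omega> * \<delta>" "same_up_to_invariance v (wall_check lam \<omega> \<delta>) (wall_2 lam \<omega> \<delta>)"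
    for v \<delta>
    using sol[OF tw_soliton_wall[OF assms that(1,2)] that(3)] .
  ultimately show "?sol v \<longleftrightarrow> ?profiles v" for v
    using TW_solution_classification[OF assms, of v c \<omega>] by blast
next
  fix \<delta> x :: real
  assume "\<delta> \<in> {1, -1}" "soliton_range lam c \<omega> \<delta> \<and> c \<noteq> 0"
  then show "soliton_check lam c \<omega> \<delta> x = of_real (cmod (soliton_check lam c \<omega> \<delta> x))
      * exp (\<i> * of_real (soliton_phase lam c \<omega> \<delta> x))"
    using soliton_check_lift[OF assms] by blast
qed

end
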